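(* Let $p,c\in\mathbb{N}$ be constants and let $\varepsilon>0$ be a constant. There exists a randomized polynomial-time algorithm for \textsc{Matroid Packing-Covering Submodular Maximization} that outputs a set $S\in\mathcal{I}$ satisfying (1) $f(S)\geq\left(1-\frac1e-\varepsilon\right)f(O)$ and (2) $\mathbf{P}\mathbf{1}_S\leq\mathbf{1}_p$ and $\mathbf{C}\mathbf{1}_S\geq(1-\varepsilon)\mathbf{1}_c$, where $O$ is an optimal solution.
   Context: \textsc{Matroid Packing-Covering Submodular Maximization}: given a ground set $\mathcal{N}=\{1,\dots,n\}$, a monotone submodular $f:2^{\mathcal{N}}\to\mathbb{R}_+$ (value oracle), $\mathbf{P}\in\mathbb{R}_+^{p\times n}$, $\mathbf{C}\in\mathbb{R}_+^{c\times n}$, and a matroid $\mathcal{M}=(\mathcal{N},\mathcal{I})$, solve $\max\{f(S): S\subseteq\mathcal{N},\ \mathbf{P}\mathbf{1}_S\leq\mathbf{1}_p,\ \mathbf{C}\mathbf{1}_S\geq\mathbf{1}_c,\ S\in\mathcal{I}\}$. Here $\mathbf{1}_S$ is the indicator vector of $S$ and $\mathbf{1}_k$ the all-ones vector in $\mathbb{R}^k$. The instance is assumed feasible (some $S\in\mathcal{I}$ satisfies both constraint systems); $O$ denotes an optimal solution. *)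

theory Defs
  imports
    "HOL-Probability.Probability_Mass_Function"
    "HOL-Computational_Algebra.Polynomial"
    "Jordan_Normal_Form.Matrix"
begin

section \<open>The optimization problem\<close>

definition matroid :: "'a set \<Rightarrow> 'a set set \<Rightarrow> bool" where
  "matroid E \<I> \<longleftrightarrow>
     finite E \<and> \<I> \<subseteq> Pow E \<and> {} \<in> \<I> \<and>
     (\<forall>A B. B \<in> \<I> \<and> A \<subseteq> B \<longrightarrow> A \<in> \<I>) \<and>
     (\<forall>A B. A \<in> \<I> \<and> B \<in> \<I> \<and> card A < card B \<longrightarrow> (\<exists>x \<in> B - A. insert x A \<in> \<I>))"

definition submodular_on :: "'a set \<Rightarrow> ('a set \<Rightarrow> real) \<Rightarrow> bool" where
  "submodular_on E f \<longleftrightarrow> (\<forall>A \<subseteq> E. \<forall>B \<subseteq> E. f (A \<union> B) + f (A \<inter> B) \<le> f A + f B)"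

text \<open>Ground set elements, like rows and columns of a matrix, are numbered from \<open>0\<close>:
  element \<open>j < ground_size\<close> belongs to column \<open>j\<close>.\<close>

record mpc_input =
  ground_size :: nat
  objective :: "nat set \<Rightarrow> real"
  packing :: "real mat"
  covering :: "real mat"
  indep_sets :: "nat set set"

definition ground :: "mpc_input \<Rightarrow> nat set" where
  "ground I = {0..<ground_size I}"

definition indicator_vec :: "nat \<Rightarrow> nat set \<Rightarrow> real Matrix.vec" where
  "indicator_vec n S = Matrix.vec n (indicator S)"

definition all_ones :: "nat \<Rightarrow> real Matrix.vec" where
  "all_ones k = Matrix.vec k (\<lambda>_. 1)"

definition mpc_instance :: "nat \<Rightarrow> nat \<Rightarrow> mpc_input \<Rightarrow> bool" where
  "mpc_instance p c I \<longleftrightarrow>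
     (\<forall>S \<subseteq> ground I. 0 \<le> objective I S) \<and>
     mono_on (Pow (ground I)) (objective I) \<and>
     submodular_on (ground I) (objective I) \<and>
     packing I \<in> carrier_mat p (ground_size I) \<and>
     (\<forall>i < p. \<forall>j < ground_size I. 0 \<le> packing I $$ (i, j)) \<and>
     covering I \<in> carrier_mat c (ground_size I) \<and>
     (\<forall>i < c. \<forall>j < ground_size I. 0 \<le> covering I $$ (i, j)) \<and>
     matroid (ground I) (indep_sets I)"

definition satisfies_packing :: "mpc_input \<Rightarrow> nat set \<Rightarrow> bool" where
  "satisfies_packing I S \<longleftrightarrow>
     packing I *\<^sub>v indicator_vec (ground_size I) S \<le> all_ones (dim_row (packing I))"

definition satisfies_covering :: "real \<Rightarrow> mpc_input \<Rightarrow> nat set \<Rightarrow> bool" where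
  "satisfies_covering \<alpha> I S \<longleftrightarrow>
     \<alpha> \<cdot>\<^sub>v all_ones (dim_row (covering I)) \<le> covering I *\<^sub>v indicator_vec (ground_size I) S"

definition feasible :: "mpc_input \<Rightarrow> nat set \<Rightarrow> bool" where
  "feasible I S \<longleftrightarrow>
     S \<subseteq> ground I \<and> S \<in> indep_sets I \<and> satisfies_packing I S \<and> satisfies_covering 1 I S"

definition optimal :: "mpc_input \<Rightarrow> nat set \<Rightarrow> bool" where
  "optimal I S \<longleftrightarrow> feasible I S \<and> (\<forall>T. feasible I T \<longrightarrow> objective I T \<le> objective I S)"


section \<open>Randomized algorithms\<close>

text \<open>
  Algorithms are programs for a probabilistic real RAM. The memory consists of arrays of natural
  numbers and arrays of real numbers, identified by names; a scalar variable is cell \<open>0\<close> of an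
  array. Reals support exact arithmetic and comparison, but there is no rounding of reals to
  integers. Natural numbers only support addition and truncated subtraction, so that their
  binary length grows by \<open>O(1)\<close> per step. Programs contain no real constants, hence they cannot
  encode infinite advice.

  The matrices are read entry by entry, the objective function through a value oracle and the
  matroid through an independence oracle. The argument of an oracle query is the set of those
  ground set elements at which a given array of naturals is nonzero.
\<close>

datatype nexp =
    NConst nat
  | GroundSize
  | NCell string nexp
  | NAdd nexp nexp
  | NSub nexp nexp

datatype rexp =
    OfNat nexp
  | RCell string nexp
  | PEntry nexp nexp
  | CEntry nexp nexp
  | ValueQuery string
  | RAdd rexp rexp
  | RSub rexp rexp
  | RMul rexp rexp
  | RDiv rexp rexp

datatype bexp =
    NLess nexp nexp
  | RLess rexp rexp
  | IndepQuery string
  | BNot bexp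
  | BAnd bexp bexp

datatype com =
    Skip
  | NAssign string nexp nexp
  | RAssign string nexp rexp
  | CoinFlip string nexp
  | Seq com com
  | Cond bexp com com
  | While bexp com

record state =
  nats :: "string \<Rightarrow> nat \<Rightarrow> nat"
  reals :: "string \<Rightarrow> nat \<Rightarrow> real"

definition set_of_array :: "mpc_input \<Rightarrow> state \<Rightarrow> string \<Rightarrow> nat set" where
  "set_of_array I s x = {j \<in> ground I. nats s x j \<noteq> 0}"

definition read_entry :: "real mat \<Rightarrow> nat \<Rightarrow> nat \<Rightarrow> real" where
  "read_entry M i j = (if i < dim_row M \<and> j < dim_col M then M $$ (i, j) else 0)"

fun nval :: "mpc_input \<Rightarrow> state \<Rightarrow> nexp \<Rightarrow> nat" where
  "nval I s (NConst k) = k"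
| "nval I s GroundSize = ground_size I"
| "nval I s (NCell x a) = nats s x (nval I s a)"
| "nval I s (NAdd a b) = nval I s a + nval I s b"
| "nval I s (NSub a b) = nval I s a - nval I s b"

fun rval :: "mpc_input \<Rightarrow> state \<Rightarrow> rexp \<Rightarrow> real" where
  "rval I s (OfNat a) = real (nval I s a)"
| "rval I s (RCell x a) = reals s x (nval I s a)"
| "rval I s (PEntry a b) = read_entry (packing I) (nval I s a) (nval I s b)"
| "rval I s (CEntry a b) = read_entry (covering I) (nval I s a) (nval I s b)"
| "rval I s (ValueQuery x) = objective I (set_of_array I s x)"
| "rval I s (RAdd a b) = rval I s a + rval I s b"
| "rval I s (RSub a b) = rval I s a - rval I s b"
| "rval I s (RMul a b) = rval I s a * rval I s b"
| "rval I s (RDiv a b) = rval I s a / rval I s b"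

fun bval :: "mpc_input \<Rightarrow> state \<Rightarrow> bexp \<Rightarrow> bool" where
  "bval I s (NLess a b) \<longleftrightarrow> nval I s a < nval I s b"
| "bval I s (RLess a b) \<longleftrightarrow> rval I s a < rval I s b"
| "bval I s (IndepQuery x) \<longleftrightarrow> set_of_array I s x \<in> indep_sets I"
| "bval I s (BNot b) \<longleftrightarrow> \<not> bval I s b"
| "bval I s (BAnd a b) \<longleftrightarrow> bval I s a \<and> bval I s b"

definition nat_update :: "string \<Rightarrow> nat \<Rightarrow> nat \<Rightarrow> state \<Rightarrow> state" where
  "nat_update x i v s = s\<lparr>nats := (nats s)(x := (nats s x)(i := v))\<rparr>"

definition real_update :: "string \<Rightarrow> nat \<Rightarrow> real \<Rightarrow> state \<Rightarrow> state" where
  "real_update x i v s = s\<lparr>reals := (reals s)(x := (reals s x)(i := v))\<rparr>"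

text \<open>One step evaluates at most as many operators and oracle queries as occur in the program
  text, i.e. a number independent of the input. A halted configuration \<open>(Skip, s)\<close> is
  stationary.\<close>

fun step :: "mpc_input \<Rightarrow> com \<times> state \<Rightarrow> (com \<times> state) pmf" where
  "step I (Skip, s) = return_pmf (Skip, s)"
| "step I (NAssign x i a, s) = return_pmf (Skip, nat_update x (nval I s i) (nval I s a) s)"
| "step I (RAssign x i a, s) = return_pmf (Skip, real_update x (nval I s i) (rval I s a) s)"
| "step I (CoinFlip x i, s) =
     map_pmf (\<lambda>b. (Skip, nat_update x (nval I s i) (of_bool b) s)) (bernoulli_pmf (1/2))"
| "step I (Seq c1 c2, s) =
     (if c1 = Skip then return_pmf (c2, s)
      else map_pmf (\<lambda>(c, t). (Seq c c2, t)) (step I (c1, s)))"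
| "step I (Cond b c1 c2, s) = return_pmf (if bval I s b then c1 else c2, s)"
| "step I (While b c, s) = return_pmf (if bval I s b then Seq c (While b c) else Skip, s)"

definition init_state :: state where
  "init_state = \<lparr>nats = (\<lambda>_ _. 0), reals = (\<lambda>_ _. 0)\<rparr>"

primrec run :: "mpc_input \<Rightarrow> com \<Rightarrow> nat \<Rightarrow> (com \<times> state) pmf" where
  "run I A 0 = return_pmf (A, init_state)"
| "run I A (Suc t) = bind_pmf (run I A t) (step I)"

definition halts_within :: "mpc_input \<Rightarrow> com \<Rightarrow> nat \<Rightarrow> bool" where
  "halts_within I A t \<longleftrightarrow> (\<forall>(c, s) \<in> set_pmf (run I A t). c = Skip)"

definition output_after :: "mpc_input \<Rightarrow> com \<Rightarrow> nat \<Rightarrow> nat set pmf" where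
  "output_after I A t = map_pmf (\<lambda>(_, s). set_of_array I s ''output'') (run I A t)"

text \<open>
  Polynomial time requires, besides a polynomial number of steps, that the numbers occurring in
  the computation on a rational input have polynomially bounded binary length, as in the
  definition of strongly polynomial algorithms by Groetschel, Lovasz and Schrijver. Without this,
  unit-cost multiplication could produce numbers of exponential length by repeated squaring.
\<close>

definition rational_of_length :: "nat \<Rightarrow> real \<Rightarrow> bool" where
  "rational_of_length L x \<longleftrightarrow>
     (\<exists>a d :: int. x = of_int a / of_int d \<and> \<bar>a\<bar> \<le> 2 ^ L \<and> 0 < d \<and> d \<le> 2 ^ L)"

definition input_of_length :: "nat \<Rightarrow> mpc_input \<Rightarrow> bool" where
  "input_of_length L I \<longleftrightarrow>
     (\<forall>S \<subseteq> ground I. rational_of_length L (objective I S)) \<and>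
     (\<forall>i < dim_row (packing I). \<forall>j < dim_col (packing I).
        rational_of_length L (packing I $$ (i, j))) \<and>
     (\<forall>i < dim_row (covering I). \<forall>j < dim_col (covering I).
        rational_of_length L (covering I $$ (i, j)))"

definition memory_of_length :: "nat \<Rightarrow> mpc_input \<Rightarrow> com \<Rightarrow> bool" where
  "memory_of_length L I A \<longleftrightarrow>
     (\<forall>t. \<forall>(c, s) \<in> set_pmf (run I A t). \<forall>x i. rational_of_length L (reals s x i))"

end

theory Submission
  imports Defs
begin

text \<open>
  The algorithm is a deterministic local search, so no sampling is needed. It keeps an independent set
  whose elements are distributed over \<open>\<nu>\<close> layers, and moves by exchanging one element and choosing
  the layer of the new one. The potential is a weighted sum of the values of all unions of layers minus
  a quadratic penalty for the violated constraints. Summing the local optimality conditions over the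
  exchanges towards an independent set \<open>Y\<close>, averaged over the layers, the layered values give
  \<open>(1 - (1 + 1/\<nu>)\<^bsup>-\<nu>\<^esup>) f Y - f X\<close>. The penalty is convex and nearly linear along a single small
  element, so it behaves like a Lagrangian term evaluated at the multipliers given by its own gradient.
  Mixing the exchanges towards \<open>Y\<close> with a small weight of pure deletions compares \<open>X\<close> with a slightly
  scaled down solution that satisfies the packing constraints with slack and has no penalty. As
  the objective is truncated at the guessed optimum, both the loss in value and the violation of \<open>X\<close>
  are small, and the slack turns approximate into exact packing feasibility.

  Elements must be small for this. The search therefore enumerates a set \<open>A\<close> of constant size that is
  contained in the optimum and contains its elements of large marginal value or coverage. Elements that are large
  for the residual packing constraints are few, and by the choice of \<open>A\<close> they can be dropped from the
  optimum at small cost.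
\<close>

section \<open>Matroids and monotone submodular functions\<close>

text \<open>The limit 1 - 1/e arises from \<open>(1 + 1/\<nu>)^\<nu>\<close> in the layer weights.
  Hence \<nu> depends only on \<epsilon>, and all 2^\<nu> unions of layers can be evaluated in each
  move. Local search stops after polynomially many moves only with an absolute improvement
  threshold; truncation at the guessed optimum and division by it bring the potential into a range
  that depends on \<nu>, \<open>m\<close> and \<open>c\<close> alone. The guess is a multiple of the
  value of a single element, since the optimum exceeds its best element at most by a factor
  \<open>n\<close> and reals cannot be rounded by the machine. All losses are counted in units of
  1/m: four in the value of a local optimum and one for the guessed value; in the coverage one each
  for dropped elements, for scaling and for the remaining violation. On the side of the machine the
  obstacle is the bound on binary lengths. Real cells therefore only collect sums of terms that read
  no real cell, and the squares of the penalty occur in comparisons only.\<close>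

lemma matroid_finite: "matroid E \<I> \<Longrightarrow> A \<in> \<I> \<Longrightarrow> finite A"
  unfolding matroid_def by (meson PowD finite_subset subsetD)

lemma matroid_downward: "matroid E \<I> \<Longrightarrow> B \<in> \<I> \<Longrightarrow> A \<subseteq> B \<Longrightarrow> A \<in> \<I>"
  unfolding matroid_def by blast

lemma matroid_augment1:
  assumes "matroid E \<I>" "A \<in> \<I>" "B \<in> \<I>" "card A < card B"
  obtains x where "x \<in> B - A" "insert x A \<in> \<I>"
  using assms unfolding matroid_def by blast

lemma matroid_augment:
  assumes M: "matroid E \<I>" and "A \<in> \<I>" "B \<in> \<I>" "card A \<le> card B"
  shows "\<exists>C \<in> \<I>. A \<subseteq> C \<and> C \<subseteq> A \<union> B \<and> card C = card B"
  using assms(2-4)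
proof (induction "card B - card A" arbitrary: A)
  case 0
  then show ?case by (intro bexI[of _ A]) auto
next
  case (Suc k)
  then have "card A < card B" by simp
  then obtain x where x: "x \<in> B - A" "insert x A \<in> \<I>"
    using matroid_augment1[OF M Suc.prems(1,2)] by metis
  have "finite A" using matroid_finite[OF M Suc.prems(1)] .
  then have card: "card (insert x A) = Suc (card A)" using x by simp
  then have "k = card B - card (insert x A)" "card (insert x A) \<le> card B"
    using Suc.hyps(2) \<open>card A < card B\<close> by simp_all
  from Suc.hyps(1)[OF this(1) x(2) Suc.prems(2) this(2)]
  obtain C where "C \<in> \<I>" "insert x A \<subseteq> C" "C \<subseteq> insert x A \<union> B" "card C = card B" by metis
  then show ?case using x(1) by (intro bexI[of _ C]) auto
qed

text \<open>\<open>K\<close> is the set of elements of \<open>X\<close> whose removal makes room for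
  \<open>b\<close>, so \<open>K\<close> together with \<open>b\<close> is dependent. If the claim
  failed, \<open>Y - {b}\<close> would be a largest independent set inside
  \<open>K \<union> (Y - {b})\<close>. Grow \<open>K\<close> to that cardinality inside this union
  and augment the result from \<open>Y\<close>: the new element cannot be \<open>b\<close>, by the
  dependence, and cannot be another one, by maximality.\<close>

lemma matroid_symmetric_exchange:
  assumes M: "matroid E \<I>" and X: "X \<in> \<I>" and Y: "Y \<in> \<I>" and b: "b \<in> Y - X" "insert b X \<notin> \<I>"
  shows "\<exists>a \<in> X - Y. insert b (X - {a}) \<in> \<I> \<and> insert a (Y - {b}) \<in> \<I>"
proof (rule ccontr)
  assume no: "\<not> ?thesis"
  have down: "B \<in> \<I> \<Longrightarrow> A \<subseteq> B \<Longrightarrow> A \<in> \<I>" for A B using matroid_downward[OF M] .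
  have fin: "A \<in> \<I> \<Longrightarrow> finite A" for A using matroid_finite[OF M] .
  define K where "K = {a \<in> X. insert b (X - {a}) \<in> \<I>}"
  define Y0 where "Y0 = Y - {b}"
  have Y0: "Y0 \<in> \<I>" "card Y = Suc (card Y0)" "finite Y0"
    using Y b fin[OF Y] down[OF Y, of Y0] by (auto simp: Y0_def card.remove simp del: card_Diff_insert)
  have K: "K \<in> \<I>" using down[OF X] K_def by auto
  \<comment> \<open>Otherwise it extends to an independent \<open>C\<close> of size
    \<open>card X\<close> inside \<open>insert b X\<close>. The single element \<open>x\<close> that
    \<open>C\<close> misses then belongs to \<open>K\<close>, and so to \<open>C\<close>.\<close>
  have Kb: "insert b K \<notin> \<I>"
  proof
    assume ind: "insert b K \<in> \<I>"
    have "K \<noteq> X" using ind b by auto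
    then have "K \<subset> X" by (auto simp: K_def)
    then have "card K < card X" using fin[OF X] by (simp add: psubset_card_mono)
    moreover have "card (insert b K) = Suc (card K)" using b fin[OF K] by (subst card_insert_disjoint) (auto simp: K_def)
    ultimately have "card (insert b K) \<le> card X" by simp
    from matroid_augment[OF M ind X this] obtain C where C: "C \<in> \<I>" "insert b K \<subseteq> C" "C \<subseteq> insert b K \<union> X" "card C = card X"
      by blast
    have CX: "C \<subseteq> insert b X" using C K_def by auto
    have "card (insert b X - C) = card (insert b X) - card C"
      using CX fin[OF X] fin[OF C(1)] by (intro card_Diff_subset) auto
    also have "\<dots> = 1" using fin[OF X] b C by simp
    finally obtain x where x: "insert b X - C = {x}" by (auto simp: card_1_singleton_iff)
    then have "x \<in> X" "x \<notin> C" using C b by auto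
    have "C = insert b (X - {x})" using x CX C(2) by blast
    then have "x \<in> K" using \<open>x \<in> X\<close> C(1) by (simp add: K_def)
    then show False using C \<open>x \<notin> C\<close> by auto
  qed
  have noK: "insert a Y0 \<notin> \<I>" if "a \<in> K - Y0" for a
  proof -
    have "a \<noteq> b" using that b by (auto simp: K_def)
    then have "a \<in> X - Y" using that by (auto simp: K_def Y0_def)
    then show ?thesis using no that by (auto simp: K_def Y0_def)
  qed
  have max: "card Z \<le> card Y0" if "Z \<in> \<I>" "Z \<subseteq> K \<union> Y0" for Z
  proof (rule ccontr)
    assume "\<not> ?thesis"
    then obtain x where "x \<in> Z - Y0" "insert x Y0 \<in> \<I>"
      using matroid_augment1[OF M Y0(1) \<open>Z \<in> \<I>\<close>] by (metis not_le)
    then show False using noK that by blast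
  qed
  obtain Z where Z: "Z \<in> \<I>" "K \<subseteq> Z" "Z \<subseteq> K \<union> Y0" "card Z = card Y0"
    using matroid_augment[OF M K Y0(1) max[OF K]] by auto
  then obtain x where x: "x \<in> Y - Z" "insert x Z \<in> \<I>"
    using matroid_augment1[OF M Z(1) Y] Y0(2) by (metis lessI)
  have "x \<noteq> b" using x Z Kb down by (metis insert_mono)
  then have "insert x Z \<subseteq> K \<union> Y0" using x Z by (auto simp: Y0_def)
  from max[OF x(2) this] show False using x Z fin[OF Z(1)] by simp
qed

text \<open>Symmetric exchange is iterated with \<open>X\<close> fixed: a partner \<open>a\<close>
  replaces \<open>b\<close> in \<open>Y\<close>, so \<open>Y - X\<close> shrinks, and
  \<open>a\<close>, now in both sets, is never chosen again. This gives injectivity. Elements that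
  can be added freely get the dummy as partner. Common elements are their own partners, which later
  amounts to changing only the layer.\<close>

lemma matroid_exchange_map:
  assumes M: "matroid E \<I>" and X: "X \<in> \<I>" and Y: "Y \<in> \<I>" and nul: "nul \<notin> E"
  shows "\<exists>\<pi>. (\<forall>y \<in> Y. \<pi> y \<in> insert nul X \<and> insert y (X - {\<pi> y}) \<in> \<I>) \<and>
    (\<forall>y \<in> Y \<inter> X. \<pi> y = y) \<and> (\<forall>y \<in> Y - X. \<pi> y \<notin> Y) \<and>
    inj_on \<pi> {y \<in> Y. \<pi> y \<noteq> nul}"
proof -
  have "\<exists>\<pi>. (\<forall>y \<in> Y - X. \<pi> y \<in> insert nul (X - Y) \<and> insert y (X - {\<pi> y}) \<in> \<I>) \<and>
    inj_on \<pi> {y \<in> Y - X. \<pi> y \<noteq> nul}"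
    using Y
  proof (induction "card (Y - X)" arbitrary: Y)
    case 0
    then have "finite Y" using matroid_finite[OF M] by simp
    then have "Y - X = {}" using 0 by simp
    then show ?case by auto
  next
    case (Suc k)
    have fin: "finite Y" using matroid_finite[OF M Suc.prems] .
    obtain b where b: "b \<in> Y - X" using Suc.hyps(2) by (metis card.empty ex_in_conv nat.distinct(1))
    have YE: "Y \<subseteq> E" "X \<subseteq> E" using M Suc.prems X by (auto simp: matroid_def)
    show ?case
    proof (cases "insert b X \<in> \<I>")
      case True
      have "Y - {b} - X = (Y - X) - {b}" by auto
      then have "k = card (Y - {b} - X)" using Suc.hyps(2) b fin by simp
      moreover have "Y - {b} \<in> \<I>" using matroid_downward[OF M Suc.prems] by blast
      ultimately obtain \<pi> where p: "\<forall>y \<in> Y - {b} - X. \<pi> y \<in> insert nul (X - (Y - {b})) \<and> insert y (X - {\<pi> y}) \<in> \<I>"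
        "inj_on \<pi> {y \<in> Y - {b} - X. \<pi> y \<noteq> nul}" using Suc.hyps(1) by blast
      have n: "nul \<notin> X" using nul YE by auto
      have e: "{y \<in> Y - X. (\<pi>(b := nul)) y \<noteq> nul} = {y \<in> Y - {b} - X. \<pi> y \<noteq> nul}" by auto
      have "\<forall>y \<in> Y - X. (\<pi>(b := nul)) y \<in> insert nul (X - Y) \<and> insert y (X - {(\<pi>(b := nul)) y}) \<in> \<I>"
      proof
        fix y assume y: "y \<in> Y - X"
        show "(\<pi>(b := nul)) y \<in> insert nul (X - Y) \<and> insert y (X - {(\<pi>(b := nul)) y}) \<in> \<I>"
        proof (cases "y = b")
          case True
          then show ?thesis using \<open>insert b X \<in> \<I>\<close> n by simp
        next
          case False
          then have "y \<in> Y - {b} - X" using y by simp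
          from bspec[OF p(1) this] show ?thesis using False b by auto
        qed
      qed
      moreover have "inj_on (\<pi>(b := nul)) {y \<in> Y - X. (\<pi>(b := nul)) y \<noteq> nul}"
        unfolding e using p(2) by (subst inj_on_cong[of _ _ \<pi>]) auto
      ultimately show ?thesis by blast
    next
      case False
      obtain a where a: "a \<in> X - Y" "insert b (X - {a}) \<in> \<I>" "insert a (Y - {b}) \<in> \<I>"
        using matroid_symmetric_exchange[OF M X Suc.prems b False] by blast
      have "insert a (Y - {b}) - X = (Y - X) - {b}" using a by auto
      then have "k = card (insert a (Y - {b}) - X)" using Suc.hyps(2) b fin by simp
      then obtain \<pi> where p: "\<forall>y \<in> insert a (Y - {b}) - X. \<pi> y \<in> insert nul (X - (insert a (Y - {b}))) \<and> insert y (X - {\<pi> y}) \<in> \<I>"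
        "inj_on \<pi> {y \<in> insert a (Y - {b}) - X. \<pi> y \<noteq> nul}" using Suc.hyps(1) a(3) by blast
      have n: "a \<noteq> nul" using nul YE a by auto
      have e: "{y \<in> Y - X. (\<pi>(b := a)) y \<noteq> nul} = insert b {y \<in> insert a (Y - {b}) - X. \<pi> y \<noteq> nul}"
        using a b n by auto
      have q: "\<pi> y \<noteq> a" if "y \<in> Y - {b} - X" for y using p(1) that n by auto
      have "\<forall>y \<in> Y - X. (\<pi>(b := a)) y \<in> insert nul (X - Y) \<and> insert y (X - {(\<pi>(b := a)) y}) \<in> \<I>"
      proof
        fix y assume y: "y \<in> Y - X"
        show "(\<pi>(b := a)) y \<in> insert nul (X - Y) \<and> insert y (X - {(\<pi>(b := a)) y}) \<in> \<I>"
        proof (cases "y = b")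
          case True
          then show ?thesis using a by simp
        next
          case False
          then have "y \<in> insert a (Y - {b}) - X" using y by simp
          from bspec[OF p(1) this] show ?thesis using False b by auto
        qed
      qed
      moreover have "inj_on (\<pi>(b := a)) {y \<in> Y - X. (\<pi>(b := a)) y \<noteq> nul}"
      proof -
        let ?S = "{y \<in> insert a (Y - {b}) - X. \<pi> y \<noteq> nul}"
        have "inj_on (\<pi>(b := a)) ?S = inj_on \<pi> ?S" using b a(1) by (intro inj_on_cong) auto
        moreover have "(\<pi>(b := a)) b \<notin> (\<pi>(b := a)) ` (?S - {b})"
        proof
          assume "(\<pi>(b := a)) b \<in> (\<pi>(b := a)) ` (?S - {b})"
          then obtain y where "y \<in> ?S - {b}" "\<pi> y = a" by auto
          then show False using q[of y] a(1) by auto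
        qed
        ultimately show ?thesis unfolding e inj_on_insert using p(2) by simp
      qed
      ultimately show ?thesis by blast
    qed
  qed
  then obtain \<pi> where p: "\<forall>y \<in> Y - X. \<pi> y \<in> insert nul (X - Y) \<and> insert y (X - {\<pi> y}) \<in> \<I>"
    "inj_on \<pi> {y \<in> Y - X. \<pi> y \<noteq> nul}" by blast
  have n: "nul \<notin> Y" using nul Y M by (auto simp: matroid_def)
  define \<sigma> where "\<sigma> y = (if y \<in> X then y else \<pi> y)" for y
  have out: "\<pi> y \<in> insert nul (X - Y)" "insert y (X - {\<pi> y}) \<in> \<I>" if "y \<in> Y" "y \<notin> X" for y
    using p(1) that by simp_all
  have "\<sigma> y \<in> insert nul X \<and> insert y (X - {\<sigma> y}) \<in> \<I>" if "y \<in> Y" for y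
    using out[of y] that X by (cases "y \<in> X") (auto simp: \<sigma>_def insert_absorb)
  moreover have "\<sigma> y \<notin> Y" if "y \<in> Y - X" for y
    using out(1)[of y] that n by (auto simp: \<sigma>_def)
  moreover have "inj_on \<sigma> {y \<in> Y. \<sigma> y \<noteq> nul}"
  proof (rule inj_onI)
    fix x y assume xy: "x \<in> {y \<in> Y. \<sigma> y \<noteq> nul}" "y \<in> {y \<in> Y. \<sigma> y \<noteq> nul}" "\<sigma> x = \<sigma> y"
    show "x = y"
    proof (cases "x \<in> X"; cases "y \<in> X")
      assume "x \<in> X" "y \<in> X" then show ?thesis using xy by (simp add: \<sigma>_def)
    next
      assume "x \<in> X" "y \<notin> X" then show ?thesis using xy out(1)[of y] by (simp add: \<sigma>_def)
    next
      assume "x \<notin> X" "y \<in> X" then show ?thesis using xy out(1)[of x] by (simp add: \<sigma>_def)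
    next
      assume "x \<notin> X" "y \<notin> X" then show ?thesis using xy p(2) by (simp add: \<sigma>_def inj_on_def)
    qed
  qed
  ultimately show ?thesis by (intro exI[of _ \<sigma>]) (simp add: \<sigma>_def)
qed

section \<open>Monotone submodular functions and their truncation\<close>

definition mono_submodular_on :: "'a set \<Rightarrow> ('a set \<Rightarrow> real) \<Rightarrow> bool" where
  "mono_submodular_on E \<phi> \<longleftrightarrow> mono_on (Pow E) \<phi> \<and> submodular_on E \<phi>"

lemma mono_submodular_onI:
  assumes "\<And>A B. A \<subseteq> B \<Longrightarrow> B \<subseteq> E \<Longrightarrow> \<phi> A \<le> \<phi> B"
    and "\<And>A B. A \<subseteq> E \<Longrightarrow> B \<subseteq> E \<Longrightarrow> \<phi> (A \<union> B) + \<phi> (A \<inter> B) \<le> \<phi> A + \<phi> B"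
  shows "mono_submodular_on E \<phi>"
  using assms unfolding mono_submodular_on_def mono_on_def submodular_on_def by blast

lemma mono_submodular_onD:
  assumes "mono_submodular_on E \<phi>"
  shows mono_submodular_on_mono: "A \<subseteq> B \<Longrightarrow> B \<subseteq> E \<Longrightarrow> \<phi> A \<le> \<phi> B"
    and mono_submodular_on_Un_Int:
      "A \<subseteq> E \<Longrightarrow> B \<subseteq> E \<Longrightarrow> \<phi> (A \<union> B) + \<phi> (A \<inter> B) \<le> \<phi> A + \<phi> B"
  using assms unfolding mono_submodular_on_def mono_on_def submodular_on_def
  by (meson PowI order_trans, meson)

lemma submodular_insert_union:
  assumes "mono_submodular_on E \<phi>" "U \<subseteq> E" "V \<subseteq> E" "x \<in> E" "U \<subseteq> V"
  shows "\<phi> (insert x V) - \<phi> V \<le> \<phi> (insert x U) - \<phi> U"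
proof (cases "x \<in> V")
  case True
  then have "insert x V = V" by auto
  moreover have "\<phi> U \<le> \<phi> (insert x U)"
    using assms by (intro mono_submodular_on_mono[OF assms(1)]) auto
  ultimately show ?thesis by simp
next
  case False
  have "insert x U \<union> V = insert x V" "insert x U \<inter> V = U" using assms False by auto
  moreover have "\<phi> (insert x U \<union> V) + \<phi> (insert x U \<inter> V) \<le> \<phi> (insert x U) + \<phi> V"
    using assms by (intro mono_submodular_on_Un_Int[OF assms(1)]) auto
  ultimately show ?thesis by simp
qed

lemma sum_marginals_ge:
  assumes f: "mono_submodular_on E \<phi>" and "U \<subseteq> E" "finite Q" "Q \<subseteq> E"
  shows "\<phi> (U \<union> Q) - \<phi> U \<le> (\<Sum>x\<in>Q. \<phi> (insert x U) - \<phi> U)"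
  using assms(3,4)
proof (induction Q)
  case (insert x Q)
  have "\<phi> (insert x (U \<union> Q)) - \<phi> (U \<union> Q) \<le> \<phi> (insert x U) - \<phi> U"
    using insert assms by (intro submodular_insert_union[OF f]) auto
  then show ?case using insert by simp
qed simp

lemma sum_removals_le:
  assumes f: "mono_submodular_on E \<phi>" and "U \<subseteq> E" "finite B" "B \<subseteq> U"
  shows "(\<Sum>x\<in>B. \<phi> U - \<phi> (U - {x})) \<le> \<phi> U - \<phi> (U - B)"
  using assms(3,4)
proof (induction B)
  case (insert x B)
  have "\<phi> (insert x (U - {x})) - \<phi> (U - {x}) \<le> \<phi> (insert x (U - insert x B)) - \<phi> (U - insert x B)"
    using insert assms by (intro submodular_insert_union[OF f]) auto
  moreover have "insert x (U - {x}) = U" "insert x (U - insert x B) = U - B" using insert by auto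
  ultimately show ?case using insert by simp
qed simp

text \<open>Removal and insertion are both priced at \<open>U\<close>, which decouples them: gains
  and losses of all exchanges can be summed separately. If \<open>x = a\<close>, the intersection
  may be larger than \<open>U - {a}\<close>, and monotonicity takes over.\<close>

lemma submodular_swap:
  assumes f: "mono_submodular_on E \<phi>" and "U \<subseteq> E" "x \<in> E"
  shows "(\<phi> (insert x U) - \<phi> U) - (\<phi> U - \<phi> (U - {a})) \<le> \<phi> (insert x (U - {a})) - \<phi> U"
proof -
  have "insert x (U - {a}) \<subseteq> E" using assms by auto
  then have "\<phi> (insert x (U - {a}) \<union> U) + \<phi> (insert x (U - {a}) \<inter> U) \<le> \<phi> (insert x (U - {a})) + \<phi> U"
    using assms by (intro mono_submodular_on_Un_Int[OF f]) auto
  moreover have "insert x (U - {a}) \<union> U = insert x U" by auto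
  moreover have "\<phi> (U - {a}) \<le> \<phi> (insert x (U - {a}) \<inter> U)"
    using assms by (intro mono_submodular_on_mono[OF f]) auto
  ultimately show ?thesis by simp
qed

text \<open>Without truncation, a set that violates the constraints could pay for the penalty with its value.
  For \<open>v = 0\<close> and nonnegative \<open>f\<close> this is the constant \<open>1\<close>.\<close>

definition truncate_at :: "real \<Rightarrow> ('a set \<Rightarrow> real) \<Rightarrow> 'a set \<Rightarrow> real" where
  "truncate_at v f S = (if f S < v then f S / v else 1)"

lemma truncate_at_bounds:
  assumes "0 \<le> f S"
  shows "0 \<le> truncate_at v f S" "truncate_at v f S \<le> 1" "0 \<le> v \<Longrightarrow> v * truncate_at v f S \<le> f S"
  using assms by (auto simp: truncate_at_def divide_simps split: if_splits)

text \<open>Monotonicity is essential for a minimum with a constant: \<open>f A\<close> and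
  \<open>f B\<close> lie between \<open>f (A \<inter> B)\<close> and
  \<open>f (A \<union> B)\<close>, which leaves only cases on the position of
  \<open>v\<close>.\<close>

lemma mono_submodular_truncate_at:
  assumes f: "mono_submodular_on E f" and nn: "\<And>S. S \<subseteq> E \<Longrightarrow> 0 \<le> f S" and v: "0 \<le> v"
  shows "mono_submodular_on E (truncate_at v f)"
proof (cases "v = 0")
  case True
  then have "truncate_at v f S = 1" if "S \<subseteq> E" for S using nn[OF that] by (simp add: truncate_at_def)
  then show ?thesis by (intro mono_submodular_onI) (simp_all add: le_infI1)
next
  case False
  then have v: "v > 0" using v by simp
  have eq: "truncate_at v f S = min (f S) v / v" for S using v by (simp add: truncate_at_def min_def)
  have mono: "f S \<le> f T" if "S \<subseteq> T" "T \<subseteq> E" for S T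
    using mono_submodular_on_mono[OF f that] .
  have "min (f (A \<union> B)) v + min (f (A \<inter> B)) v \<le> min (f A) v + min (f B) v" if "A \<subseteq> E" "B \<subseteq> E" for A B
  proof -
    have "f (A \<union> B) + f (A \<inter> B) \<le> f A + f B"
      using mono_submodular_on_Un_Int[OF f that] .
    moreover have "f A \<le> f (A \<union> B)" "f B \<le> f (A \<union> B)" "f (A \<inter> B) \<le> f A" "f (A \<inter> B) \<le> f B"
      using that by (auto intro!: mono)
    ultimately show ?thesis by (auto simp: min_def)
  qed
  then have "truncate_at v f (A \<union> B) + truncate_at v f (A \<inter> B) \<le> truncate_at v f A + truncate_at v f B"
    if "A \<subseteq> E" "B \<subseteq> E" for A B
    using that v unfolding eq add_divide_distrib[symmetric] by (intro divide_right_mono) auto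
  moreover have "truncate_at v f A \<le> truncate_at v f B" if "A \<subseteq> B" "B \<subseteq> E" for A B
    using mono[OF that] v unfolding eq by (intro divide_right_mono) auto
  ultimately show ?thesis by (rule mono_submodular_onI[rotated])
qed

section \<open>The layered potential\<close>

text \<open>The weights are determined, up to scaling, by the requirement that in the sum over all exchanges
  every intermediate value cancels, so that only the empty and the full set of layers remain
  (\<open>layer_weight_identity\<close>). The scaling makes the full set count once.\<close>

definition layer_weight :: "nat \<Rightarrow> nat \<Rightarrow> real" where
  "layer_weight \<nu> k = (1 + 1 / real \<nu>) ^ k / ((1 + 1 / real \<nu>) ^ (\<nu> + 1) * real k * real (\<nu> choose k))"

lemma layer_weight_0 [simp]: "layer_weight \<nu> 0 = 0"
  by (simp add: layer_weight_def)

lemma layer_weight_nonneg: "0 \<le> layer_weight \<nu> k"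
  by (simp add: layer_weight_def)

text \<open>In the sum over all exchanges a set of \<open>k\<close> layers enters with its own
  weight times \<open>k + k / \<nu>\<close>, and negatively once for each of the
  \<open>\<nu> - k\<close> sets with one more layer. The recursion makes these contributions
  cancel.\<close>

lemma layer_weight_Suc:
  assumes "1 \<le> k" "k < \<nu>"
  shows "real (\<nu> - k) * layer_weight \<nu> (Suc k) = (real k + real k / real \<nu>) * layer_weight \<nu> k"
proof -
  define q :: real where "q = 1 + 1 / real \<nu>"
  have q: "q > 0" by (simp add: q_def add_pos_nonneg)
  have "Suc k * (\<nu> choose Suc k) = (\<nu> - k) * (\<nu> choose k)"
    using binomial_absorb_comp[of \<nu> k] binomial_absorption[of k "\<nu>"] assms
    by (metis Suc_diff_Suc binomial_absorption diff_Suc_1 Suc_pred' gr_implies_not0 mult.commute not_gr_zero)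
  then have b: "real (Suc k) * real (\<nu> choose Suc k) = real (\<nu> - k) * real (\<nu> choose k)"
    by (metis of_nat_mult)
  have pos: "real (\<nu> choose k) > 0" "real (\<nu> - k) > 0" "real k > 0" using assms by auto
  have "layer_weight \<nu> (Suc k) = q ^ Suc k / (q ^ (\<nu> + 1) * (real (\<nu> - k) * real (\<nu> choose k)))"
    unfolding layer_weight_def q_def[symmetric] b[symmetric] by (simp add: mult.assoc)
  then have "real (\<nu> - k) * layer_weight \<nu> (Suc k) = q ^ Suc k / (q ^ (\<nu> + 1) * real (\<nu> choose k))"
    using pos by (simp add: field_simps)
  also have "\<dots> = real k * q * (q ^ k / (q ^ (\<nu> + 1) * real k * real (\<nu> choose k)))"
    using pos q by (simp add: field_simps)
  also have "\<dots> = (real k + real k / real \<nu>) * layer_weight \<nu> k"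
    unfolding layer_weight_def q_def[symmetric] by (simp add: q_def algebra_simps)
  finally show ?thesis .
qed

lemma layer_weight_last:
  assumes "1 \<le> \<nu>"
  shows "(real \<nu> + 1) * layer_weight \<nu> \<nu> = 1"
proof -
  define q :: real where "q = 1 + 1 / real \<nu>"
  have q: "q > 0" "q * real \<nu> = real \<nu> + 1" using assms by (simp_all add: q_def add_pos_nonneg field_simps)
  have "layer_weight \<nu> \<nu> = 1 / (q * real \<nu>)"
    unfolding layer_weight_def q_def[symmetric] using q by simp
  then show ?thesis using q assms by simp
qed

text \<open>This is the coefficient left at the empty set of layers, and the source of 1/e.\<close>

lemma layer_weight_1:
  assumes "1 \<le> \<nu>"
  shows "real \<nu> * layer_weight \<nu> 1 = 1 / (1 + 1 / real \<nu>) ^ \<nu>"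
proof -
  have "(1 + 1 / real \<nu>) > 0" by (simp add: add_pos_nonneg)
  then show ?thesis using assms by (simp add: layer_weight_def)
qed

text \<open>The bracket is what the exchanges do to the union of the layers \<open>J\<close>:
  \<open>card J / \<nu>\<close> is the probability that a new element lands in \<open>J\<close>, and
  each layer of \<open>J\<close> is emptied once. Reindexing the pairs of \<open>J\<close> and a
  removed layer by the smaller set collects the coefficient of each \<open>F J\<close>, which
  vanishes unless \<open>J\<close> is empty or full.\<close>

lemma layer_weight_identity:
  fixes F :: "nat set \<Rightarrow> real"
  assumes "1 \<le> \<nu>"
  shows "(\<Sum>J\<in>Pow {1..\<nu>}. layer_weight \<nu> (card J) *
            (real (card J) / real \<nu> * F J + (\<Sum>r\<in>J. F J - F (J - {r}))))
    = F {1..\<nu>} - real \<nu> * layer_weight \<nu> 1 * F {}"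
proof -
  let ?w = "layer_weight \<nu>" and ?P = "Pow {1..\<nu>}"
  have finP: "finite J" if "J \<in> ?P" for J using that finite_subset[of J "{1..\<nu>}"] by auto
  have "(\<Sum>J\<in>?P. \<Sum>r\<in>J. ?w (card J) * F (J - {r}))
      = (\<Sum>(J, r)\<in>Sigma ?P (\<lambda>J. J). ?w (card J) * F (J - {r}))"
    by (subst sum.Sigma) (auto intro: finite_subset)
  also have "\<dots> = (\<Sum>(J, r)\<in>Sigma ?P (\<lambda>J. {1..\<nu>} - J). ?w (Suc (card J)) * F J)"
  proof (rule sum.reindex_bij_witness[where i = "\<lambda>(J, r). (insert r J, r)" and j = "\<lambda>(J, r). (J - {r}, r)"])
    fix a assume a: "a \<in> Sigma ?P (\<lambda>J. J)"
    then obtain J r where Jr: "a = (J, r)" "J \<in> ?P" "r \<in> J" by auto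
    have "Suc (card (J - {r})) = card J" using Jr(3) finP[OF Jr(2)] by (rule card_Suc_Diff1[rotated])
    then show "(case (case a of (J, r) \<Rightarrow> (J - {r}, r)) of (J, r) \<Rightarrow> ?w (Suc (card J)) * F J)
        = (case a of (J, r) \<Rightarrow> ?w (card J) * F (J - {r}))" using Jr by simp
  qed auto
  also have "\<dots> = (\<Sum>J\<in>?P. real (\<nu> - card J) * ?w (Suc (card J)) * F J)"
    by (subst sum.Sigma[symmetric]) (auto simp: card_Diff_subset finP intro!: sum.cong)
  finally have shift: "(\<Sum>J\<in>?P. \<Sum>r\<in>J. ?w (card J) * F (J - {r}))
      = (\<Sum>J\<in>?P. real (\<nu> - card J) * ?w (Suc (card J)) * F J)" .
  have "(\<Sum>J\<in>?P. ?w (card J) * (real (card J) / real \<nu> * F J + (\<Sum>r\<in>J. F J - F (J - {r}))))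
     = (\<Sum>J\<in>?P. ?w (card J) * (real (card J) / real \<nu> + real (card J)) * F J)
       - (\<Sum>J\<in>?P. \<Sum>r\<in>J. ?w (card J) * F (J - {r}))"
  proof -
    have "?w (card J) * (real (card J) / real \<nu> * F J + (\<Sum>r\<in>J. F J - F (J - {r})))
      = ?w (card J) * (real (card J) / real \<nu> + real (card J)) * F J - (\<Sum>r\<in>J. ?w (card J) * F (J - {r}))" for J
      by (simp add: sum_subtractf sum_distrib_left[symmetric] algebra_simps)
    then show ?thesis by (simp add: sum_subtractf)
  qed
  also have "\<dots> = (\<Sum>J\<in>?P. (?w (card J) * (real (card J) / real \<nu> + real (card J))
       - real (\<nu> - card J) * ?w (Suc (card J))) * F J)"
    unfolding shift by (simp add: sum_subtractf[symmetric] algebra_simps)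
  also have "\<dots> = (\<Sum>J\<in>?P. (if J = {1..\<nu>} then F J else 0) - (if J = {} then real \<nu> * ?w 1 * F J else 0))"
  proof (rule sum.cong[OF refl])
    fix J assume J: "J \<in> ?P"
    have le: "card J \<le> \<nu>" using card_mono[of "{1..\<nu>}" J] J by auto
    have full: "card J = \<nu> \<longleftrightarrow> J = {1..\<nu>}" using J card_subset_eq[of "{1..\<nu>}" J] by auto
    have empty: "card J = 0 \<longleftrightarrow> J = {}" using J finP by simp
    consider "J = {}" | "J = {1..\<nu>}" "J \<noteq> {}" | "1 \<le> card J" "card J < \<nu>"
      using le full empty by linarith
    then show "(?w (card J) * (real (card J) / real \<nu> + real (card J))
       - real (\<nu> - card J) * ?w (Suc (card J))) * F J
       = (if J = {1..\<nu>} then F J else 0) - (if J = {} then real \<nu> * ?w 1 * F J else 0)"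
    proof cases
      case 1
      then show ?thesis using assms by auto
    next
      case 2
      then have "card J = \<nu>" by simp
      then show ?thesis using 2 layer_weight_last[OF assms] assms by (simp add: algebra_simps)
    next
      case 3
      then have "J \<noteq> {}" "J \<noteq> {1..\<nu>}" using full empty by auto
      then show ?thesis using layer_weight_Suc[OF 3] by (simp add: algebra_simps)
    qed
  qed
  also have "\<dots> = F {1..\<nu>} - real \<nu> * ?w 1 * F {}"
    by (simp add: sum_subtractf)
  finally show ?thesis .
qed

definition layer_ratio :: "nat \<Rightarrow> real" where
  "layer_ratio \<nu> = 1 - 1 / (1 + 1 / real \<nu>) ^ \<nu>"

text \<open>The identity for a constant function. The sum is the factor that the value of the target
  set receives.\<close>

lemma layer_weight_card_sum:
  assumes "1 \<le> \<nu>"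
  shows "(\<Sum>J\<in>Pow {1..\<nu>}. layer_weight \<nu> (card J) * (real (card J) / real \<nu>)) = layer_ratio \<nu>"
  using layer_weight_identity[OF assms, of "\<lambda>_. 1"] layer_weight_1[OF assms]
  by (simp add: layer_ratio_def)

lemma layer_ratio_bounds:
  assumes "1 \<le> \<nu>"
  shows "0 \<le> layer_ratio \<nu>" "layer_ratio \<nu> \<le> 1"
proof -
  have "1 \<le> (1 + 1 / real \<nu>) ^ \<nu>" by (intro one_le_power) simp
  then have "1 / (1 + 1 / real \<nu>) ^ \<nu> \<le> 1" "0 \<le> 1 / (1 + 1 / real \<nu>) ^ \<nu>"
    by (simp_all add: divide_le_eq_1_pos less_le_trans[of 0 1])
  then show "0 \<le> layer_ratio \<nu>" "layer_ratio \<nu> \<le> 1" by (auto simp: layer_ratio_def divide_le_eq_1)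
qed

text \<open>Bounds the layered part of the potential from above, and thereby the number of passes of
  the search.\<close>

lemma layer_weight_sum_le:
  assumes "1 \<le> \<nu>"
  shows "(\<Sum>J\<in>Pow {1..\<nu>}. layer_weight \<nu> (card J)) \<le> real \<nu>"
proof -
  have "(\<Sum>J\<in>Pow {1..\<nu>}. layer_weight \<nu> (card J))
      \<le> (\<Sum>J\<in>Pow {1..\<nu>}. real \<nu> * (layer_weight \<nu> (card J) * (real (card J) / real \<nu>)))"
  proof (rule sum_mono)
    fix J :: "nat set"
    show "layer_weight \<nu> (card J) \<le> real \<nu> * (layer_weight \<nu> (card J) * (real (card J) / real \<nu>))"
    proof (cases "card J = 0")
      case False
      then have "layer_weight \<nu> (card J) * 1 \<le> layer_weight \<nu> (card J) * real (card J)"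
        by (intro mult_left_mono layer_weight_nonneg) auto
      then show ?thesis using assms by simp
    qed simp
  qed
  also have "\<dots> = real \<nu> * layer_ratio \<nu>"
    by (simp only: sum_distrib_left[symmetric] layer_weight_card_sum[OF assms])
  also have "\<dots> \<le> real \<nu>" using layer_ratio_bounds[OF assms] by (simp add: mult_left_le)
  finally show ?thesis .
qed

lemma layer_ratio_tendsto: "layer_ratio \<longlonglongrightarrow> 1 - 1 / exp 1"
  unfolding layer_ratio_def
  using tendsto_exp_limit_sequentially[of 1] by (intro tendsto_intros) auto

text \<open>Layer 0 stands for absence, which is why sets of layers are taken inside
  \<open>{1..\<nu>}\<close>. The guessed set belongs to every union, so no move removes it.\<close>

definition covered :: "'a set \<Rightarrow> 'a set \<Rightarrow> ('a \<Rightarrow> nat) \<Rightarrow> nat set \<Rightarrow> 'a set" where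
  "covered E A L J = A \<union> {e \<in> E. L e \<in> J}"

definition layered_value :: "'a set \<Rightarrow> 'a set \<Rightarrow> nat \<Rightarrow> ('a set \<Rightarrow> real) \<Rightarrow> ('a \<Rightarrow> nat) \<Rightarrow> real" where
  "layered_value E A \<nu> \<phi> L = (\<Sum>J\<in>Pow {1..\<nu>}. layer_weight \<nu> (card J) * \<phi> (covered E A L J))"

text \<open>The dummy element \<open>nul\<close> outside the ground set stands for removing or inserting nothing.\<close>

locale exchange =
  fixes E A X Q :: "'a set" and \<pi> :: "'a \<Rightarrow> 'a" and nul :: 'a
  assumes fin: "finite E" and nul: "nul \<notin> E" and AX: "A \<subseteq> X" and XE: "X \<subseteq> E" and QE: "Q \<subseteq> E - A"
    and pi_range: "\<And>y. y \<in> Q \<Longrightarrow> \<pi> y \<in> insert nul (X - A)"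
    and pi_fix: "\<And>y. y \<in> Q \<Longrightarrow> y \<in> X \<Longrightarrow> \<pi> y = y"
    and pi_inj: "inj_on \<pi> {y \<in> Q. \<pi> y \<noteq> nul}"
begin

lemma finQ: "finite Q" and finX: "finite X"
  using finite_subset[OF _ fin] QE XE by blast+

lemma sum_removed:
  fixes R :: "'a \<Rightarrow> real"
  assumes "R nul = 0"
  shows "(\<Sum>y\<in>Q. R (\<pi> y)) + (\<Sum>a\<in>X - A - \<pi> ` Q. R a) = (\<Sum>a\<in>X - A. R a)"
proof -
  let ?Q = "{y \<in> Q. \<pi> y \<noteq> nul}"
  have "(\<Sum>y\<in>Q. R (\<pi> y)) = (\<Sum>y\<in>?Q. R (\<pi> y))"
    using assms finQ by (intro sum.mono_neutral_right) auto
  also have "\<dots> = (\<Sum>a\<in>\<pi> ` ?Q. R a)" by (simp add: sum.reindex[OF pi_inj])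
  also have "\<pi> ` ?Q = (X - A) \<inter> \<pi> ` Q" using pi_range nul XE by fastforce
  finally show ?thesis
    using sum.Int_Diff[of "X - A" R "\<pi> ` Q"] finX by simp
qed

text \<open>Each element of \<open>Q\<close> enters once, with its layer averaged; the pure
  deletions complete the removals so that every element of \<open>X - A\<close> leaves exactly once
  (\<open>sum_removed\<close>). A deletion is written as an exchange with the dummy. In
  \<open>L(\<pi> y := 0, y := l)\<close> the insertion comes last, so \<open>\<pi> y = y\<close>
  only moves \<open>y\<close> to another layer.\<close>

definition exchange_sum :: "nat \<Rightarrow> (('a \<Rightarrow> nat) \<Rightarrow> real) \<Rightarrow> ('a \<Rightarrow> nat) \<Rightarrow> real" where
  "exchange_sum \<nu> H L =
     (\<Sum>y\<in>Q. (\<Sum>l\<in>{1..\<nu>}. H (L(\<pi> y := 0, y := l)) - H L) / real \<nu>) +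
     (\<Sum>a\<in>X - A - \<pi> ` Q. H (L(a := 0, nul := 0)) - H L)"

lemma exchange_sum_diff:
  "exchange_sum \<nu> (\<lambda>L. F L - b * G L) L = exchange_sum \<nu> F L - b * exchange_sum \<nu> G L"
proof -
  have "(\<Sum>l\<in>S. f l - b * g l - (x - b * y)) / r = (\<Sum>l\<in>S. f l - x) / r - b * ((\<Sum>l\<in>S. g l - y) / r)"
    for S :: "nat set" and f g :: "nat \<Rightarrow> real" and x y r
    by (simp add: sum_subtractf sum_distrib_left[symmetric] diff_divide_distrib) (simp add: algebra_simps diff_divide_distrib)
  moreover have "(\<Sum>l\<in>S. f l - b * g l - (x - b * y)) = (\<Sum>l\<in>S. f l - x) - b * (\<Sum>l\<in>S. g l - y)"
    for S :: "'a set" and f g :: "'a \<Rightarrow> real" and x y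
    by (simp add: sum_subtractf sum_distrib_left[symmetric]) (simp add: algebra_simps)
  moreover have "(\<Sum>l\<in>S. f l - b * g l) = (\<Sum>l\<in>S. f l) - b * (\<Sum>l\<in>S. g l)"
    for S :: "'a set" and f g :: "'a \<Rightarrow> real"
    by (simp add: sum_subtractf sum_distrib_left)
  ultimately show ?thesis
    unfolding exchange_sum_def by (simp only: distrib_left)
qed

lemma exchange_sum_add:
  "exchange_sum \<nu> (\<lambda>L. F L + G L) L = exchange_sum \<nu> F L + exchange_sum \<nu> G L"
  using exchange_sum_diff[of \<nu> F "-1" G L] by simp

lemma exchange_sum_sum:
  "finite I \<Longrightarrow> exchange_sum \<nu> (\<lambda>L. \<Sum>i\<in>I. F i L) L = (\<Sum>i\<in>I. exchange_sum \<nu> (F i) L)"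
  by (induction I rule: finite_induct) (simp_all add: exchange_sum_add, simp add: exchange_sum_def)

lemma exchange_sum_cmult:
  "exchange_sum \<nu> (\<lambda>L. b * G L) L = b * exchange_sum \<nu> G L"
  using exchange_sum_diff[of \<nu> "\<lambda>_. 0" "- b" G L] by (simp add: exchange_sum_def)

lemma exchange_sum_le:
  assumes "1 \<le> \<nu>" "0 \<le> \<theta>"
    and "\<And>y l. y \<in> Q \<Longrightarrow> l \<in> {1..\<nu>} \<Longrightarrow> H (L(\<pi> y := 0, y := l)) - H L \<le> \<theta>"
    and "\<And>a. a \<in> X - A \<Longrightarrow> H (L(a := 0, nul := 0)) - H L \<le> \<theta>"
  shows "exchange_sum \<nu> H L \<le> 2 * real (card E) * \<theta>"
proof -
  have "(\<Sum>l\<in>{1..\<nu>}. H (L(\<pi> y := 0, y := l)) - H L) / real \<nu> \<le> \<theta>" if "y \<in> Q" for y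
    using sum_bounded_above[of "{1..\<nu>}" "\<lambda>l. H (L(\<pi> y := 0, y := l)) - H L" \<theta>] assms(1,3) that
    by (simp add: field_simps)
  then have "(\<Sum>y\<in>Q. (\<Sum>l\<in>{1..\<nu>}. H (L(\<pi> y := 0, y := l)) - H L) / real \<nu>) \<le> real (card Q) * \<theta>"
    by (intro sum_bounded_above) auto
  also have "\<dots> \<le> real (card E) * \<theta>"
    using QE fin assms(2) by (intro mult_right_mono of_nat_mono card_mono) auto
  finally have 1: "(\<Sum>y\<in>Q. (\<Sum>l\<in>{1..\<nu>}. H (L(\<pi> y := 0, y := l)) - H L) / real \<nu>) \<le> real (card E) * \<theta>" .
  have "(\<Sum>a\<in>X - A - \<pi> ` Q. H (L(a := 0, nul := 0)) - H L) \<le> real (card (X - A - \<pi> ` Q)) * \<theta>"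
    using assms(4) by (intro sum_bounded_above) auto
  also have "\<dots> \<le> real (card E) * \<theta>"
    using XE fin assms(2) by (intro mult_right_mono of_nat_mono card_mono) auto
  finally show ?thesis using 1 by (simp add: exchange_sum_def)
qed

text \<open>If \<open>y\<close> already lies in a layer of \<open>J\<close>, it is its own partner
  and is taken out before it is put into layer \<open>l\<close>; hence \<open>y\<close> counts only
  through \<open>l\<close>.\<close>

lemma covered_insert:
  assumes y: "y \<in> Q" and X: "X = covered E A L {1..\<nu>}" and J: "J \<subseteq> {1..\<nu>}"
  shows "covered E A (L(\<pi> y := 0, y := l)) J =
    (if l \<in> J then insert y (covered E A L J - {\<pi> y}) else covered E A L J - {\<pi> y})"
proof -
  have "y \<in> E - A" "\<pi> y \<notin> A" using y QE pi_range[OF y] nul AX XE by auto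
  moreover have "\<pi> y = y" if "L y \<in> J"
  proof (rule pi_fix[OF y])
    show "y \<in> X" using that J y QE unfolding X covered_def by auto
  qed
  moreover have "0 \<notin> J" using J by auto
  ultimately show ?thesis by (auto simp: covered_def)
qed

lemma covered_remove:
  assumes "a \<in> X - A" and "J \<subseteq> {1..\<nu>}"
  shows "covered E A (L(a := 0, nul := 0)) J = covered E A L J - {a}"
  using assms nul by (auto simp: covered_def)

text \<open>For one set \<open>J\<close> of layers the insertions gain in total at least
  \<open>card J / \<nu>\<close> times the marginal value of the target over the union, and the
  removals inside one layer cost no more than emptying this layer. The weighted sum over
  \<open>J\<close> then collapses by \<open>layer_weight_identity\<close>.\<close>

lemma exchange_sum_layered_value:
  assumes f: "mono_submodular_on E \<phi>" and nn: "\<And>S. S \<subseteq> E \<Longrightarrow> 0 \<le> \<phi> S" and l1: "1 \<le> \<nu>"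
    and X: "X = covered E A L {1..\<nu>}"
  shows "layer_ratio \<nu> * \<phi> (A \<union> Q) - \<phi> X \<le> exchange_sum \<nu> (layered_value E A \<nu> \<phi>) L"
proof -
  let ?w = "\<lambda>J. layer_weight \<nu> (card J)" and ?P = "Pow {1..\<nu>}" and ?U = "covered E A L"
  let ?R = "\<lambda>J a. \<phi> (?U J) - \<phi> (?U J - {a})"
  have UE: "?U J \<subseteq> E" for J using AX XE by (auto simp: covered_def)
  have mono: "\<phi> S \<le> \<phi> T" if "S \<subseteq> T" "T \<subseteq> E" for S T
    using mono_submodular_on_mono[OF f that] .
  have finJ: "finite J" if "J \<in> ?P" for J using that finite_subset by auto
  have perJ: "real (card J) / real \<nu> * (\<phi> (A \<union> Q) - \<phi> (?U J)) - (\<Sum>r\<in>J. \<phi> (?U J) - \<phi> (?U (J - {r})))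
     \<le> exchange_sum \<nu> (\<lambda>L. \<phi> (covered E A L J)) L" if J: "J \<in> ?P" for J
  proof -
    have ins: "real (card J) / real \<nu> * (\<phi> (insert y (?U J)) - \<phi> (?U J)) - ?R J (\<pi> y)
      \<le> (\<Sum>l\<in>{1..\<nu>}. \<phi> (covered E A (L(\<pi> y := 0, y := l)) J) - \<phi> (?U J)) / real \<nu>" if y: "y \<in> Q" for y
    proof -
      have yE: "y \<in> E" using y QE by auto
      have "(if l \<in> J then \<phi> (insert y (?U J)) - \<phi> (?U J) else 0) - ?R J (\<pi> y)
        \<le> \<phi> (covered E A (L(\<pi> y := 0, y := l)) J) - \<phi> (?U J)" for l
        using submodular_swap[OF f UE yE, of J "\<pi> y"] J
        by (subst covered_insert[OF y X]) auto
      then have "(\<Sum>l\<in>{1..\<nu>}. (if l \<in> J then \<phi> (insert y (?U J)) - \<phi> (?U J) else 0) - ?R J (\<pi> y))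
        \<le> (\<Sum>l\<in>{1..\<nu>}. \<phi> (covered E A (L(\<pi> y := 0, y := l)) J) - \<phi> (?U J))" by (intro sum_mono)
      moreover have "(\<Sum>l\<in>{1..\<nu>}. (if l \<in> J then \<phi> (insert y (?U J)) - \<phi> (?U J) else 0) - ?R J (\<pi> y))
         = real (card J) * (\<phi> (insert y (?U J)) - \<phi> (?U J)) - real \<nu> * ?R J (\<pi> y)"
      proof -
        have "{1..\<nu>} \<inter> J = J" using J by auto
        then show ?thesis by (simp add: sum_subtractf sum.If_cases Int_def[symmetric] Collect_conj_eq)
      qed
      ultimately have "(real (card J) * (\<phi> (insert y (?U J)) - \<phi> (?U J)) - real \<nu> * ?R J (\<pi> y)) / real \<nu>
        \<le> (\<Sum>l\<in>{1..\<nu>}. \<phi> (covered E A (L(\<pi> y := 0, y := l)) J) - \<phi> (?U J)) / real \<nu>"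
        by (intro divide_right_mono) simp_all
      moreover have "(real (card J) * (\<phi> (insert y (?U J)) - \<phi> (?U J)) - real \<nu> * ?R J (\<pi> y)) / real \<nu>
        = real (card J) / real \<nu> * (\<phi> (insert y (?U J)) - \<phi> (?U J)) - ?R J (\<pi> y)"
        using l1 by (simp add: diff_divide_distrib)
      ultimately show ?thesis by simp
    qed
    have del: "- ?R J a \<le> \<phi> (covered E A (L(a := 0, nul := 0)) J) - \<phi> (?U J)" if "a \<in> X - A" for a
      using covered_remove[OF that, of J] J by auto
    have "real (card J) / real \<nu> * (\<Sum>y\<in>Q. \<phi> (insert y (?U J)) - \<phi> (?U J)) - (\<Sum>a\<in>X - A. ?R J a)
       = (\<Sum>y\<in>Q. real (card J) / real \<nu> * (\<phi> (insert y (?U J)) - \<phi> (?U J)) - ?R J (\<pi> y)) +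
         (\<Sum>a\<in>X - A - \<pi> ` Q. - ?R J a)"
    proof -
      have "?U J - {nul} = ?U J" using nul UE[of J] by auto
      then have "(\<Sum>y\<in>Q. ?R J (\<pi> y)) + (\<Sum>a\<in>X - A - \<pi> ` Q. ?R J a) = (\<Sum>a\<in>X - A. ?R J a)"
        by (intro sum_removed) simp
      moreover have "(\<Sum>y\<in>Q. real (card J) / real \<nu> * (\<phi> (insert y (?U J)) - \<phi> (?U J)) - ?R J (\<pi> y))
        = real (card J) / real \<nu> * (\<Sum>y\<in>Q. \<phi> (insert y (?U J)) - \<phi> (?U J)) - (\<Sum>y\<in>Q. ?R J (\<pi> y))"
        by (subst sum_subtractf, subst sum_distrib_left, rule refl)
      ultimately show ?thesis by (simp only: sum_negf)
    qed
    also have "\<dots> \<le> exchange_sum \<nu> (\<lambda>L. \<phi> (covered E A L J)) L"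
      unfolding exchange_sum_def using ins del by (intro add_mono sum_mono) auto
    finally have 1: "real (card J) / real \<nu> * (\<Sum>y\<in>Q. \<phi> (insert y (?U J)) - \<phi> (?U J)) - (\<Sum>a\<in>X - A. ?R J a)
      \<le> exchange_sum \<nu> (\<lambda>L. \<phi> (covered E A L J)) L" .
    have "\<phi> (A \<union> Q) \<le> \<phi> (?U J \<union> Q)" using UE QE by (intro mono) (auto simp: covered_def)
    also have "\<dots> - \<phi> (?U J) \<le> (\<Sum>y\<in>Q. \<phi> (insert y (?U J)) - \<phi> (?U J))"
      using finQ QE UE by (intro sum_marginals_ge[OF f]) auto
    finally have "\<phi> (A \<union> Q) - \<phi> (?U J) \<le> (\<Sum>y\<in>Q. \<phi> (insert y (?U J)) - \<phi> (?U J))" by simp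
    then have 2: "real (card J) / real \<nu> * (\<phi> (A \<union> Q) - \<phi> (?U J))
      \<le> real (card J) / real \<nu> * (\<Sum>y\<in>Q. \<phi> (insert y (?U J)) - \<phi> (?U J))"
      by (rule mult_left_mono) auto
    have "(\<Sum>a\<in>X - A. ?R J a) = (\<Sum>a\<in>{a \<in> X - A. L a \<in> J}. ?R J a)"
    proof (rule sum.mono_neutral_right)
      show "\<forall>i\<in>X - A - {a \<in> X - A. L a \<in> J}. ?R J i = 0"
      proof
        fix i assume "i \<in> X - A - {a \<in> X - A. L a \<in> J}"
        then have "?U J - {i} = ?U J" by (auto simp: covered_def)
        then show "?R J i = 0" by simp
      qed
    qed (use finX in auto)
    also have "{a \<in> X - A. L a \<in> J} = (\<Union>r\<in>J. {a \<in> X - A. L a = r})" by auto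
    also have "(\<Sum>a\<in>\<dots>. ?R J a) = (\<Sum>r\<in>J. \<Sum>a\<in>{a \<in> X - A. L a = r}. ?R J a)"
      using finJ[OF J] finX by (intro sum.UNION_disjoint) auto
    also have "\<dots> \<le> (\<Sum>r\<in>J. \<phi> (?U J) - \<phi> (?U (J - {r})))"
    proof (rule sum_mono)
      fix r assume r: "r \<in> J"
      have "(\<Sum>a\<in>{a \<in> X - A. L a = r}. ?R J a) \<le> \<phi> (?U J) - \<phi> (?U J - {a \<in> X - A. L a = r})"
        using r finX XE by (intro sum_removals_le[OF f UE]) (auto simp: covered_def)
      moreover have "?U J - {a \<in> X - A. L a = r} = ?U (J - {r})"
        using r J X by (auto simp: covered_def)
      ultimately show "(\<Sum>a\<in>{a \<in> X - A. L a = r}. ?R J a) \<le> \<phi> (?U J) - \<phi> (?U (J - {r}))" by simp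
    qed
    finally show ?thesis using 1 2 by linarith
  qed
  \<comment> \<open>The empty set of layers contributes the nonnegative term
    \<open>real \<nu> * layer_weight \<nu> 1 * \<phi> A\<close>, which is dropped.\<close>
  have "layer_ratio \<nu> * \<phi> (A \<union> Q) - \<phi> X \<le>
     (\<Sum>J\<in>?P. ?w J * (real (card J) / real \<nu>)) * \<phi> (A \<union> Q)
       - (\<Sum>J\<in>?P. ?w J * (real (card J) / real \<nu> * \<phi> (?U J) + (\<Sum>r\<in>J. \<phi> (?U J) - \<phi> (?U (J - {r})))))"
    using layer_weight_identity[OF l1, of "\<lambda>J. \<phi> (?U J)"] layer_weight_card_sum[OF l1] X nn[OF UE]
      layer_weight_nonneg[of \<nu> 1] by simp
  also have "\<dots> = (\<Sum>J\<in>?P. ?w J * (real (card J) / real \<nu> * (\<phi> (A \<union> Q) - \<phi> (?U J)) - (\<Sum>r\<in>J. \<phi> (?U J) - \<phi> (?U (J - {r})))))"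
    unfolding sum_distrib_right sum_subtractf[symmetric]
    by (intro sum.cong refl) (simp only: algebra_simps)
  also have "\<dots> \<le> (\<Sum>J\<in>?P. ?w J * exchange_sum \<nu> (\<lambda>L. \<phi> (covered E A L J)) L)"
    using perJ by (intro sum_mono mult_left_mono layer_weight_nonneg) auto
  also have "\<dots> = exchange_sum \<nu> (layered_value E A \<nu> \<phi>) L"
    unfolding layered_value_def by (simp add: exchange_sum_sum exchange_sum_cmult)
  finally show ?thesis .
qed

end

section \<open>First-order estimates for the quadratic penalty\<close>

lemma square_excess_step:
  fixes x a b \<gamma> :: real
  assumes "0 \<le> a" "a \<le> \<gamma>" "0 \<le> b" "b \<le> \<gamma>"
  shows "(max 0 (x - a + b))\<^sup>2 - (max 0 x)\<^sup>2 \<le> (2 * max 0 x + \<gamma>) * b - max 0 (2 * max 0 x - \<gamma>) * a"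
proof -
  define w where "w = max 0 x"
  define u where "u = max 0 (x - a)"
  have up: "(max 0 (x - a + b))\<^sup>2 \<le> (u + b)\<^sup>2" using assms by (intro power_mono) (auto simp: u_def)
  have "b * b \<le> \<gamma> * b" "u * b \<le> w * b" using assms by (auto intro!: mult_right_mono simp: u_def w_def)
  then have 1: "(u + b)\<^sup>2 \<le> u\<^sup>2 + (2 * w + \<gamma>) * b" by (simp add: power2_eq_square algebra_simps)
  \<comment> \<open>A removal is credited with the slope \<open>2 * w - \<gamma>\<close> only where
    this is positive: at the kink \<open>w = 0\<close> it does not lower the square at all.\<close>
  have "u\<^sup>2 - w\<^sup>2 \<le> - max 0 (2 * w - \<gamma>) * a"
  proof (cases "w \<le> a")
    case True
    then have u: "u = 0" by (auto simp: u_def w_def)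
    have "max 0 (2 * w - \<gamma>) * a \<le> max 0 (2 * w - \<gamma>) * \<gamma>" using assms by (intro mult_left_mono) auto
    also have "\<dots> \<le> w\<^sup>2"
    proof -
      have "0 \<le> (w - \<gamma>)\<^sup>2" by simp
      then show ?thesis by (auto simp: max_def power2_eq_square algebra_simps)
    qed
    finally show ?thesis using u by simp
  next
    case False
    then have u: "u = w - a" using assms by (auto simp: u_def w_def)
    have "a * a \<le> \<gamma> * a" using assms by (intro mult_right_mono) auto
    moreover have "max 0 (2 * w - \<gamma>) * a \<le> 2 * w * a - a * a"
    proof (cases "2 * w \<le> \<gamma>")
      case True
      then show ?thesis using False assms mult_right_mono[of a "2*w" a] by (auto simp: max_def)
    next
      case f: False
      then show ?thesis using \<open>a * a \<le> \<gamma> * a\<close> by (simp add: max_def algebra_simps)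
    qed
    moreover define c where "c = max 0 (2 * w - \<gamma>)"
    ultimately have "c * a \<le> 2 * w * a - a * a" by simp
    then have "a * c + a * a \<le> 2 * (a * (u + a))" using u by (simp add: algebra_simps)
    moreover have w: "w = u + a" using u by simp
    ultimately have "u\<^sup>2 - w\<^sup>2 \<le> - c * a" unfolding w by (simp add: power2_eq_square algebra_simps)
    then show ?thesis by (simp add: c_def)
  qed
  then show ?thesis using up 1 by (simp add: w_def)
qed

context exchange
begin

lemma exchange_sum_covered:
  assumes "1 \<le> \<nu>" and X: "X = covered E A L {1..\<nu>}"
  shows "exchange_sum \<nu> (\<lambda>L. h (covered E A L {1..\<nu>})) L =
    (\<Sum>y\<in>Q. h (insert y (X - {\<pi> y})) - h X) + (\<Sum>a\<in>X - A - \<pi> ` Q. h (X - {a}) - h X)"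
proof -
  have "(\<Sum>l\<in>{1..\<nu>}. h (covered E A (L(\<pi> y := 0, y := l)) {1..\<nu>}) - h (covered E A L {1..\<nu>})) / real \<nu>
    = h (insert y (X - {\<pi> y})) - h X" if "y \<in> Q" for y
  proof -
    have "(\<Sum>l\<in>{1..\<nu>}. h (covered E A (L(\<pi> y := 0, y := l)) {1..\<nu>}) - h (covered E A L {1..\<nu>}))
      = (\<Sum>l\<in>{1..\<nu>}. h (insert y (X - {\<pi> y})) - h X)"
    proof (intro sum.cong refl)
      fix l assume "l \<in> {1..\<nu>}"
      then have "covered E A (L(\<pi> y := 0, y := l)) {1..\<nu>} = insert y (X - {\<pi> y})"
        using covered_insert[OF that X order.refl, of l] X by simp
      then show "h (covered E A (L(\<pi> y := 0, y := l)) {1..\<nu>}) - h (covered E A L {1..\<nu>})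
        = h (insert y (X - {\<pi> y})) - h X" using X by simp
    qed
    then show ?thesis using assms(1) by simp
  qed
  moreover have "h (covered E A (L(a := 0, nul := 0)) {1..\<nu>}) - h (covered E A L {1..\<nu>}) = h (X - {a}) - h X"
    if "a \<in> X - A - \<pi> ` Q" for a
    using covered_remove[of a "{1..\<nu>}" \<nu> L] that X by simp
  ultimately show ?thesis unfolding exchange_sum_def by simp
qed

lemma sum_exchanged:
  fixes w :: "'a \<Rightarrow> real"
  assumes "w nul = 0" "y \<in> Q"
  shows "sum w (insert y (X - {\<pi> y})) = sum w X + w y - w (\<pi> y)"
proof (cases "y \<in> X")
  case True
  then show ?thesis using pi_fix[OF assms(2)] by (simp add: insert_absorb)
next
  case False
  then have "sum w (insert y (X - {\<pi> y})) = w y + sum w (X - {\<pi> y})" using finX by simp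
  moreover have "sum w (X - {\<pi> y}) = sum w X - w (\<pi> y)"
  proof (cases "\<pi> y = nul")
    case True
    moreover have "nul \<notin> X" using nul XE by auto
    ultimately show ?thesis using assms(1) by simp
  next
    case False
    then have "\<pi> y \<in> X" using pi_range[OF assms(2)] by auto
    then show ?thesis using finX by (simp add: sum_diff1)
  qed
  ultimately show ?thesis by simp
qed

text \<open>Summing \<open>square_excess_step\<close> turns the square into linear terms in the
  loads, with \<open>2 * w\<close> as multiplier up to an error \<open>\<gamma>\<close>. Since all
  of \<open>X - A\<close> is removed exactly once, its whole load appears however the exchanges pair
  the elements.\<close>

lemma exchange_sum_square_excess:
  fixes z :: "'a \<Rightarrow> real"
  assumes "1 \<le> \<nu>" and X: "X = covered E A L {1..\<nu>}" and z: "z nul = 0" "\<And>e. e \<in> Q \<union> (X - A) \<Longrightarrow> 0 \<le> z e \<and> z e \<le> \<gamma>"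
    and g: "0 \<le> \<gamma>" and w: "w = max 0 (b + sum z X)"
  shows "exchange_sum \<nu> (\<lambda>L. (max 0 (b + sum z (covered E A L {1..\<nu>})))\<^sup>2) L
    \<le> (2 * w + \<gamma>) * sum z Q - max 0 (2 * w - \<gamma>) * sum z (X - A)"
proof -
  have zp: "0 \<le> z (\<pi> y) \<and> z (\<pi> y) \<le> \<gamma>" if "y \<in> Q" for y
    using pi_range[OF that] z g by auto
  have "exchange_sum \<nu> (\<lambda>L. (max 0 (b + sum z (covered E A L {1..\<nu>})))\<^sup>2) L
    \<le> (\<Sum>y\<in>Q. (2 * w + \<gamma>) * z y - max 0 (2 * w - \<gamma>) * z (\<pi> y)) + (\<Sum>a\<in>X - A - \<pi> ` Q. - (max 0 (2 * w - \<gamma>) * z a))"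
    unfolding exchange_sum_covered[OF assms(1) X, of "\<lambda>X. (max 0 (b + sum z X))\<^sup>2"]
  proof (intro add_mono sum_mono)
    fix y assume y: "y \<in> Q"
    show "(max 0 (b + sum z (insert y (X - {\<pi> y}))))\<^sup>2 - (max 0 (b + sum z X))\<^sup>2
      \<le> (2 * w + \<gamma>) * z y - max 0 (2 * w - \<gamma>) * z (\<pi> y)"
      using square_excess_step[of "z (\<pi> y)" \<gamma> "z y" "b + sum z X"] zp[OF y] z(2)[of y] y
      by (simp add: sum_exchanged[of z, OF z(1) y] w algebra_simps)
  next
    fix a assume a: "a \<in> X - A - \<pi> ` Q"
    then have s: "sum z (X - {a}) = sum z X - z a" using finX by (simp add: sum_diff1)
    show "(max 0 (b + sum z (X - {a})))\<^sup>2 - (max 0 (b + sum z X))\<^sup>2 \<le> - (max 0 (2 * w - \<gamma>) * z a)"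
      using square_excess_step[of "z a" \<gamma> 0 "b + sum z X"] z(2)[of a] a g
      unfolding s by (simp add: w algebra_simps)
  qed
  also have "\<dots> = (2 * w + \<gamma>) * sum z Q - max 0 (2 * w - \<gamma>) * ((\<Sum>y\<in>Q. z (\<pi> y)) + (\<Sum>a\<in>X - A - \<pi> ` Q. z a))"
    by (simp add: sum_subtractf sum_distrib_left[symmetric] sum_negf distrib_left)
  finally show ?thesis unfolding sum_removed[of z, OF z(1)] .
qed

text \<open>The same estimate with the roles of inserted and removed elements swapped, as a deficit
  grows by removals.\<close>

lemma exchange_sum_square_deficit:
  fixes z :: "'a \<Rightarrow> real"
  assumes "1 \<le> \<nu>" and X: "X = covered E A L {1..\<nu>}" and z: "z nul = 0" "\<And>e. e \<in> Q \<union> (X - A) \<Longrightarrow> 0 \<le> z e \<and> z e \<le> \<gamma>"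
    and g: "0 \<le> \<gamma>" and w: "w = max 0 (b - sum z X)"
  shows "exchange_sum \<nu> (\<lambda>L. (max 0 (b - sum z (covered E A L {1..\<nu>})))\<^sup>2) L
    \<le> (2 * w + \<gamma>) * sum z (X - A) - max 0 (2 * w - \<gamma>) * sum z Q"
proof -
  have zp: "0 \<le> z (\<pi> y) \<and> z (\<pi> y) \<le> \<gamma>" if "y \<in> Q" for y
    using pi_range[OF that] z g by auto
  have "exchange_sum \<nu> (\<lambda>L. (max 0 (b - sum z (covered E A L {1..\<nu>})))\<^sup>2) L
    \<le> (\<Sum>y\<in>Q. (2 * w + \<gamma>) * z (\<pi> y) - max 0 (2 * w - \<gamma>) * z y) + (\<Sum>a\<in>X - A - \<pi> ` Q. (2 * w + \<gamma>) * z a)"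
    unfolding exchange_sum_covered[OF assms(1) X, of "\<lambda>X. (max 0 (b - sum z X))\<^sup>2"]
  proof (intro add_mono sum_mono)
    fix y assume y: "y \<in> Q"
    show "(max 0 (b - sum z (insert y (X - {\<pi> y}))))\<^sup>2 - (max 0 (b - sum z X))\<^sup>2
      \<le> (2 * w + \<gamma>) * z (\<pi> y) - max 0 (2 * w - \<gamma>) * z y"
      using square_excess_step[of "z y" \<gamma> "z (\<pi> y)" "b - sum z X"] zp[OF y] z(2)[of y] y
      by (simp add: sum_exchanged[of z, OF z(1) y] w algebra_simps)
  next
    fix a assume a: "a \<in> X - A - \<pi> ` Q"
    then have s: "sum z (X - {a}) = sum z X - z a" using finX by (simp add: sum_diff1)
    show "(max 0 (b - sum z (X - {a})))\<^sup>2 - (max 0 (b - sum z X))\<^sup>2 \<le> (2 * w + \<gamma>) * z a"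
      using square_excess_step[of 0 \<gamma> "z a" "b - sum z X"] z(2)[of a] a g
      unfolding s by (simp add: w algebra_simps)
  qed
  also have "\<dots> = (2 * w + \<gamma>) * ((\<Sum>y\<in>Q. z (\<pi> y)) + (\<Sum>a\<in>X - A - \<pi> ` Q. z a)) - max 0 (2 * w - \<gamma>) * sum z Q"
    by (simp add: sum_subtractf sum_distrib_left[symmetric] distrib_left)
  finally show ?thesis unfolding sum_removed[of z, OF z(1)] .
qed

lemma exchange_sum_zero:
  assumes "1 \<le> \<nu>" and X: "X = covered E A L {1..\<nu>}" and "h X = 0"
    and "\<And>y. y \<in> Q \<Longrightarrow> h (insert y (X - {\<pi> y})) = 0" and "\<And>a. a \<in> X - A \<Longrightarrow> h (X - {a}) = 0"
  shows "exchange_sum \<nu> (\<lambda>L. h (covered E A L {1..\<nu>})) L = 0"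
  unfolding exchange_sum_covered[OF assms(1) X] using assms by simp

end

text \<open>With weight \<open>1 - \<eta>\<close> for the exchanges and \<open>\<eta>\<close> for
  the deletions, removals have full weight and insertions weight \<open>1 - \<eta>\<close>. The
  target thus loads the constraint by at most \<open>1 - \<eta>\<close>, exactly where the excess
  starts. For \<open>w > 0\<close> outside the kink the multiplier terms give
  \<open>- 2 * w\<^sup>2\<close> up to errors in \<open>\<gamma>\<close>; half of it pays for the
  error \<open>\<gamma> * w\<close>.\<close>

lemma excess_balance:
  fixes w \<gamma> \<eta> q d :: real
  assumes w: "w = max 0 (d - (1 - \<eta>))" and "0 \<le> q" "q \<le> 1" "0 \<le> d" "0 \<le> \<gamma>" "\<gamma> \<le> 1" "0 \<le> \<eta>" "\<eta> \<le> 1"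
  shows "(1 - \<eta>) * ((2 * w + \<gamma>) * q - max 0 (2 * w - \<gamma>) * d) + \<eta> * (- (max 0 (2 * w - \<gamma>) * d)) \<le> - w\<^sup>2 + 3 * \<gamma>"
proof -
  define x where "x = max 0 (2 * w - \<gamma>)"
  have "0 \<le> w" by (simp add: w)
  have eq: "(1 - \<eta>) * ((2 * w + \<gamma>) * q - x * d) + \<eta> * (- (x * d)) = (1 - \<eta>) * ((2 * w + \<gamma>) * q) - x * d"
    by (simp add: algebra_simps)
  have "(1 - \<eta>) * ((2 * w + \<gamma>) * q) \<le> (1 - \<eta>) * (2 * w + \<gamma>)"
    using assms \<open>0 \<le> w\<close> by (intro mult_left_mono mult_left_le) auto
  moreover have "(1 - \<eta>) * (2 * w + \<gamma>) - x * d \<le> - w\<^sup>2 + 3 * \<gamma>"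
  proof (cases "2 * w < \<gamma>")
    case True
    have "(1 - \<eta>) * (2 * w + \<gamma>) \<le> 1 * (2 * w + \<gamma>)" using assms \<open>0 \<le> w\<close> by (intro mult_right_mono) auto
    moreover have "w * w \<le> 1 * \<gamma>" using True \<open>0 \<le> w\<close> \<open>0 \<le> \<gamma>\<close> \<open>\<gamma> \<le> 1\<close> by (intro mult_mono) linarith+
    ultimately show ?thesis using True by (simp add: x_def power2_eq_square)
  next
    case False
    show ?thesis
    proof (cases "w = 0")
      case True
      then show ?thesis using False assms by (simp add: x_def)
    next
      case w0: False
      then have d: "d = 1 - \<eta> + w" using w by (auto simp: max_def split: if_splits)
      have x: "x = 2 * w - \<gamma>" using False by (simp add: x_def)
      have "(1 - \<eta>) * \<gamma> \<le> 1 * \<gamma>" using assms by (intro mult_right_mono) auto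
      moreover have "\<gamma> * w \<le> w\<^sup>2 + \<gamma>"
      proof -
        have "0 \<le> (w - \<gamma> / 2)\<^sup>2" by simp
        moreover have "\<gamma> * \<gamma> \<le> 1 * \<gamma>" using assms by (intro mult_right_mono) auto
        moreover note \<open>0 \<le> \<gamma>\<close>
        ultimately show ?thesis unfolding power2_eq_square by (simp add: algebra_simps)
      qed
      ultimately show ?thesis unfolding d x by (simp add: power2_eq_square algebra_simps)
    qed
  qed
  ultimately show ?thesis using eq unfolding x_def[symmetric] by linarith
qed

text \<open>The target scaled by \<open>1 - \<eta>\<close> still reaches the demand
  \<open>\<tau>\<close>, so the multiplier terms again give \<open>- 2 * w\<^sup>2\<close> up to
  errors in \<open>\<gamma>\<close>. The bound \<open>d \<le> 2\<close> controls the error term when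
  nothing is violated.\<close>

lemma deficit_balance:
  fixes w \<gamma> \<eta> q d :: real
  assumes w: "w = max 0 (\<tau> - d)" and "\<tau> \<le> (1 - \<eta>) * q" "\<tau> \<le> 1" "0 \<le> d" "d \<le> 2" "0 \<le> \<gamma>" "\<gamma> \<le> 1"
  shows "(1 - \<eta>) * ((2 * w + \<gamma>) * d - max 0 (2 * w - \<gamma>) * q) + \<eta> * ((2 * w + \<gamma>) * d) \<le> - w\<^sup>2 + 3 * \<gamma>"
proof -
  define x where "x = max 0 (2 * w - \<gamma>)"
  have "0 \<le> w" by (simp add: w)
  have "(1 - \<eta>) * ((2 * w + \<gamma>) * d - x * q) + \<eta> * ((2 * w + \<gamma>) * d) = (2 * w + \<gamma>) * d - x * ((1 - \<eta>) * q)"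
    by (simp add: algebra_simps)
  also have "\<dots> \<le> (2 * w + \<gamma>) * d - x * \<tau>"
    using assms by (intro diff_left_mono mult_left_mono) (auto simp: x_def)
  also have "\<dots> \<le> - w\<^sup>2 + 3 * \<gamma>"
  proof (cases "w = 0")
    case True
    have "\<gamma> * d \<le> \<gamma> * 2" using assms by (intro mult_left_mono) auto
    then show ?thesis using True assms by (simp add: x_def)
  next
    case w0: False
    then have t: "\<tau> = w + d" using w by (auto simp: max_def split: if_splits)
    have "\<gamma> * d \<le> \<gamma> * 1" using assms t \<open>0 \<le> w\<close> by (intro mult_left_mono) auto
    show ?thesis
    proof (cases "2 * w < \<gamma>")
      case True
      have "(2 * w) * d \<le> (2 * w) * 1" using assms t \<open>0 \<le> w\<close> by (intro mult_left_mono) auto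
      moreover have "w * w \<le> 1 * \<gamma>" using True \<open>0 \<le> w\<close> \<open>0 \<le> \<gamma>\<close> \<open>\<gamma> \<le> 1\<close> by (intro mult_mono) linarith+
      ultimately show ?thesis using True \<open>\<gamma> * d \<le> \<gamma> * 1\<close> by (simp add: x_def power2_eq_square algebra_simps)
    next
      case False
      then have x: "x = 2 * w - \<gamma>" by (simp add: x_def)
      have "\<gamma> * w \<le> w\<^sup>2 + \<gamma>"
      proof -
        have "0 \<le> (w - \<gamma> / 2)\<^sup>2" by simp
        moreover have "\<gamma> * \<gamma> \<le> 1 * \<gamma>" using assms by (intro mult_right_mono) auto
        moreover note \<open>0 \<le> \<gamma>\<close>
        ultimately show ?thesis unfolding power2_eq_square by (simp add: algebra_simps)
      qed
      then show ?thesis using \<open>\<gamma> * d \<le> \<gamma> * 1\<close> unfolding t x by (simp add: power2_eq_square algebra_simps)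
    qed
  qed
  finally show ?thesis unfolding x_def .
qed

section \<open>Local optima for packing and covering constraints\<close>

text \<open>The load is measured in units of the capacity that \<open>A\<close> leaves, so that
  small means small compared to this rest. The penalty starts \<open>1 / m\<close> below full
  capacity: an excess of at most \<open>1 / m\<close> is still exact feasibility.\<close>

definition excess :: "nat \<Rightarrow> ('a \<Rightarrow> real) \<Rightarrow> 'a set \<Rightarrow> 'a set \<Rightarrow> real" where
  "excess m w A X = (sum w X - sum w A) / (1 - sum w A) - (1 - 1 / real m)"

text \<open>Of the \<open>2 / m\<close>, one half covers the coverage lost with dropped elements,
  the other half the scaling of the target by \<open>1 - 1 / m\<close>.\<close>

definition deficit :: "nat \<Rightarrow> ('a \<Rightarrow> real) \<Rightarrow> 'a set \<Rightarrow> real" where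
  "deficit m w X = 1 - 2 / real m - sum w X"

text \<open>Chosen so that the linearisation error of the weighted penalty,
  \<open>4 * m\<^sup>2\<close> times \<open>3 / coarse_scale\<close> for each of \<open>k\<close>
  constraints, is at most \<open>1 / m\<close>.\<close>

definition coarse_scale :: "nat \<Rightarrow> nat \<Rightarrow> nat" where
  "coarse_scale m k = 12 * m ^ 3 * (k + 1)"

text \<open>At most \<open>p * coarse_scale\<close> elements are dropped from the optimum, each at a
  cost of at most \<open>1 / fine_scale\<close>, in total at most \<open>1 / m\<close>.\<close>

definition fine_scale :: "nat \<Rightarrow> nat \<Rightarrow> nat \<Rightarrow> nat" where
  "fine_scale m p c = coarse_scale m (p + c) * (p + 1) * m"

text \<open>The parameter \<open>m\<close> is the inverse of the accuracy. The junk value \<open>x / 0 = 0\<close> in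
  \<^const>\<open>excess\<close> is harmless: if the guessed set \<open>A\<close> exhausts a packing constraint, then admissible
  elements have weight \<open>0\<close> in it.\<close>

locale packing_covering =
  fixes E :: "'a set" and \<I> :: "'a set set" and P C :: "nat \<Rightarrow> 'a \<Rightarrow> real" and nul :: 'a
    and p c m \<nu> :: nat and \<phi> :: "'a set \<Rightarrow> real"
  assumes M: "matroid E \<I>" and nulE: "nul \<notin> E"
    and P_nonneg: "\<And>i e. 0 \<le> P i e" and C_nonneg: "\<And>i e. 0 \<le> C i e"
    and P_nul: "\<And>i. P i nul = 0" and C_nul: "\<And>i. C i nul = 0"
    and m1: "1 \<le> m" and nu1: "1 \<le> \<nu>"
    and phi: "mono_submodular_on E \<phi>"
    and phi_nonneg: "\<And>S. S \<subseteq> E \<Longrightarrow> 0 \<le> \<phi> S" and phi_le_1: "\<And>S. S \<subseteq> E \<Longrightarrow> \<phi> S \<le> 1"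
begin

lemma finE: "finite E" using M by (simp add: matroid_def)

definition penalty :: "'a set \<Rightarrow> 'a set \<Rightarrow> real" where
  "penalty A X = (\<Sum>i<p. (max 0 (excess m (P i) A X))\<^sup>2) + (\<Sum>i<c. (max 0 (deficit m (C i) X))\<^sup>2)"

definition admissible :: "'a set \<Rightarrow> 'a \<Rightarrow> bool" where
  "admissible A e \<longleftrightarrow> (\<forall>i<p. P i e * real (coarse_scale m (p + c)) \<le> 1 - sum (P i) A) \<and>
     (\<forall>i<c. 1 \<le> sum (C i) A \<or> C i e * real (fine_scale m p c) \<le> 1)"

text \<open>Local optimality will leave a weighted penalty of at most 3, whereas with the factor
  \<open>4 * m\<^sup>2\<close> a single violation by more than \<open>1 / m\<close> costs at least
  4.\<close>

definition local_value :: "'a set \<Rightarrow> ('a \<Rightarrow> nat) \<Rightarrow> real" where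
  "local_value A L = layered_value E A \<nu> \<phi> L - 4 * real m ^ 2 * penalty A (covered E A L {1..\<nu>})"

text \<open>An exchange sum has at most \<open>2 * card E\<close> terms, so moves that gain at most
  this much add up to at most \<open>1 / m\<close>.\<close>

definition threshold :: real where
  "threshold = 1 / (2 * real m * (real (card E) + 1))"

text \<open>One kind of move covers swaps, insertions, deletions and changes of layer:
  \<open>x\<close> or \<open>y\<close> may be the dummy, and \<open>l = 0\<close> is
  allowed.\<close>

definition local_optimum :: "'a set \<Rightarrow> ('a \<Rightarrow> nat) \<Rightarrow> bool" where
  "local_optimum A L \<longleftrightarrow> (\<forall>x \<in> insert nul E. \<forall>y \<in> insert nul E. \<forall>l \<le> \<nu>.
     admissible A y \<longrightarrow> covered E A (L(x := 0, y := l)) {1..\<nu>} \<in> \<I> \<longrightarrow>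
     local_value A (L(x := 0, y := l)) \<le> local_value A L + threshold)"

lemma local_optimumD:
  assumes "local_optimum A L" "x \<in> insert nul E" "y \<in> insert nul E" "l \<le> \<nu>" "admissible A y"
    "covered E A (L(x := 0, y := l)) {1..\<nu>} \<in> \<I>"
  shows "local_value A (L(x := 0, y := l)) - local_value A L \<le> threshold"
proof -
  have "local_value A (L(x := 0, y := l)) \<le> local_value A L + threshold"
    using assms unfolding local_optimum_def by blast
  then show ?thesis by simp
qed

lemma coarse_pos: "0 < coarse_scale m (p + c)" and fine_pos: "0 < fine_scale m p c"
  using m1 by (auto simp: coarse_scale_def fine_scale_def)

text \<open>The guess \<open>A\<close> maximises \<open>\<phi> A + \<Sum>\<^sub>i min 2 (C\<^sub>i A) - card A / fine_scale\<close>. The cap is \<open>2\<close> and not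
  \<open>1\<close> because a large element must gain in full even if the constraint is almost covered.\<close>

lemma guess_exists:
  assumes Opt: "Opt \<subseteq> E"
  shows "\<exists>A \<subseteq> Opt. card A \<le> (1 + 2 * c) * fine_scale m p c \<and>
    (\<forall>e \<in> Opt - A. \<phi> (insert e A) - \<phi> A \<le> 1 / real (fine_scale m p c) \<and>
      (\<forall>i<c. 1 \<le> sum (C i) A \<or> C i e * real (fine_scale m p c) \<le> 1))"
proof -
  let ?\<gamma> = "1 / real (fine_scale m p c)"
  define W where "W A = \<phi> A + (\<Sum>i<c. min 2 (sum (C i) A))" for A
  have finO: "finite Opt" using Opt finE finite_subset by auto
  have g: "0 < ?\<gamma>" "?\<gamma> \<le> 1" using fine_pos by auto
  obtain A where A: "A \<subseteq> Opt" and max: "\<And>B. B \<subseteq> Opt \<Longrightarrow> W B - ?\<gamma> * card B \<le> W A - ?\<gamma> * card A"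
  proof -
    let ?f = "\<lambda>B. W B - ?\<gamma> * card B"
    have fin: "finite (?f ` Pow Opt)" "?f ` Pow Opt \<noteq> {}" using finO by auto
    from Max_in[OF fin] obtain A where "A \<in> Pow Opt" "?f A = Max (?f ` Pow Opt)" by auto
    then show ?thesis using that[of A] Max_ge[OF fin(1)] by auto
  qed
  have finA: "finite A" using A finO finite_subset by auto
  have W0: "0 \<le> W {}" using phi_nonneg[of "{}"] by (simp add: W_def)
  have W1: "W A \<le> 1 + 2 * real c"
  proof -
    have "(\<Sum>i<c. min 2 (sum (C i) A)) \<le> of_nat (card {..<c}) * (2::real)" by (intro sum_bounded_above) auto
    then show ?thesis using phi_le_1[of A] order_trans[OF A Opt] by (simp add: W_def)
  qed
  have "?\<gamma> * card A \<le> 1 + 2 * real c" using max[of "{}"] W0 W1 by simp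
  then have "real (card A) \<le> (1 + 2 * real c) * real (fine_scale m p c)" using fine_pos by (simp add: field_simps)
  also have "\<dots> = real ((1 + 2 * c) * fine_scale m p c)" by (simp add: algebra_simps)
  finally have card: "card A \<le> (1 + 2 * c) * fine_scale m p c" by (simp only: of_nat_le_iff)
  \<comment> \<open>Maximality bounds the total increment of \<open>W\<close> by
    \<open>?\<gamma>\<close>; as all its summands are nonnegative, each one obeys the same
    bound.\<close>
  have step: "\<phi> (insert e A) - \<phi> A \<le> ?\<gamma> \<and> (\<forall>i<c. min 2 (sum (C i) A + C i e) - min 2 (sum (C i) A) \<le> ?\<gamma>)"
    if e: "e \<in> Opt - A" for e
  proof -
    have d: "W (insert e A) - W A \<le> ?\<gamma>"
      using max[of "insert e A"] e A finA g by (auto simp: algebra_simps add_divide_distrib)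
    have ins: "sum (C i) (insert e A) = sum (C i) A + C i e" for i using e finA by simp
    let ?d = "\<lambda>i. min 2 (sum (C i) A + C i e) - min 2 (sum (C i) A)"
    have W: "W (insert e A) - W A = (\<phi> (insert e A) - \<phi> A) + (\<Sum>i<c. ?d i)"
      by (simp add: W_def ins sum_subtractf)
    have nn: "0 \<le> ?d i" for i
      using C_nonneg[of i e] by (auto simp: min_def)
    have phi_nn: "0 \<le> \<phi> (insert e A) - \<phi> A"
      using mono_submodular_on_mono[OF phi, of A "insert e A"] e A Opt by auto
    have "?d i \<le> ?\<gamma>" if "i < c" for i
    proof -
      have "?d i \<le> (\<Sum>i<c. ?d i)" using nn that by (intro member_le_sum) auto
      then show ?thesis using W d phi_nn by linarith
    qed
    moreover have "0 \<le> (\<Sum>i<c. ?d i)" using nn by (intro sum_nonneg) auto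
    ultimately show ?thesis using W d by auto
  qed
  have "1 \<le> sum (C i) A \<or> C i e * real (fine_scale m p c) \<le> 1" if "e \<in> Opt - A" "i < c" for e i
  proof (rule ccontr)
    assume n: "\<not> ?thesis"
    then have "?\<gamma> < C i e" "sum (C i) A < 1" using fine_pos by (simp_all add: field_simps)
    moreover have "min 2 (sum (C i) A + C i e) - min 2 (sum (C i) A) \<le> ?\<gamma>" using step that by blast
    ultimately show False using g(2) by (simp add: min_def split: if_splits)
  qed
  then show ?thesis using A card step by blast
qed

text \<open>Elements that are large for a residual packing constraint each use more than a
  \<open>1 / coarse_scale\<close> part of the capacity that \<open>A\<close> leaves to the optimum,
  hence are few. By submodularity their marginal values are no larger than those over
  \<open>A\<close>, which the guess has made small.\<close>

lemma drop_large:
  assumes A: "A \<subseteq> Opt" and Opt: "Opt \<in> \<I>" and PO: "\<And>i. i < p \<Longrightarrow> sum (P i) Opt \<le> 1"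
    and guess: "\<And>e. e \<in> Opt - A \<Longrightarrow> \<phi> (insert e A) - \<phi> A \<le> 1 / real (fine_scale m p c)"
      "\<And>e i. e \<in> Opt - A \<Longrightarrow> i < c \<Longrightarrow> 1 \<le> sum (C i) A \<or> C i e * real (fine_scale m p c) \<le> 1"
  shows "\<exists>Y. A \<subseteq> Y \<and> Y \<subseteq> Opt \<and> (\<forall>e \<in> Y - A. admissible A e) \<and> \<phi> Opt - 1 / real m \<le> \<phi> Y \<and>
    (\<forall>i<c. sum (C i) A < 1 \<longrightarrow> sum (C i) Opt - 1 / real m \<le> sum (C i) Y)"
proof -
  let ?g = "real (coarse_scale m (p + c))" and ?h = "real (fine_scale m p c)"
  define B where "B i = {e \<in> Opt - A. 1 - sum (P i) A < P i e * ?g}" for i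
  define D where "D = (\<Union>i<p. B i)"
  have OE: "Opt \<subseteq> E" using M Opt by (auto simp: matroid_def)
  have finO: "finite Opt" using OE finE finite_subset by auto
  have g: "?g > 0" and h: "?h > 0" using coarse_pos fine_pos by simp_all
  have cardB: "real (card (B i)) \<le> ?g" if i: "i < p" for i
  proof (cases "B i = {}")
    case True
    then show ?thesis using g by simp
  next
    case False
    have finB: "finite (B i)" using finO by (auto simp: B_def)
    have "sum (P i) A + sum (P i) (Opt - A) = sum (P i) Opt" using sum.subset_diff[OF A finO, of "P i"] by simp
    moreover have "sum (P i) (B i) \<le> sum (P i) (Opt - A)"
      using finO P_nonneg by (intro sum_mono2) (auto simp: B_def)
    ultimately have le: "sum (P i) (B i) \<le> 1 - sum (P i) A" using PO[OF i] by simp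
    \<comment> \<open>The strict inequality also settles zero residual capacity, where it leads to
      \<open>0 < 0\<close>.\<close>
    have "(\<Sum>e\<in>B i. (1 - sum (P i) A)) < (\<Sum>e\<in>B i. P i e * ?g)"
      using finB False by (intro sum_strict_mono) (auto simp: B_def)
    then have lt: "real (card (B i)) * (1 - sum (P i) A) < ?g * sum (P i) (B i)"
      by (simp add: sum_distrib_right[symmetric] mult.commute)
    also have "\<dots> \<le> ?g * (1 - sum (P i) A)" using le g by (intro mult_left_mono) auto
    finally have "real (card (B i)) * (1 - sum (P i) A) < ?g * (1 - sum (P i) A)" .
    moreover have "0 \<le> 1 - sum (P i) A" using le sum_nonneg[of "B i" "P i"] P_nonneg by auto
    ultimately show ?thesis by (smt (verit) mult_right_mono)
  qed
  have finD: "finite D" "D \<subseteq> Opt - A" using finO by (auto simp: D_def B_def)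
  have "real (card D) \<le> (\<Sum>i<p. real (card (B i)))"
    unfolding D_def of_nat_sum[symmetric] of_nat_le_iff by (intro card_UN_le) auto
  also have "\<dots> \<le> real (card {..<p}) * ?g" using cardB by (intro sum_bounded_above) auto
  finally have cardD: "real (card D) \<le> real p * ?g" by simp
  have small: "real (card D) * (1 / ?h) \<le> 1 / real m"
  proof -
    have "real (card D) * (1 / ?h) \<le> real p * ?g * (1 / ?h)" using cardD h by (intro mult_right_mono) auto
    also have "\<dots> = real p / (real (p + 1) * real m)" 
    proof -
      have "?h = ?g * (real (p + 1) * real m)" by (simp add: fine_scale_def algebra_simps)
      then show ?thesis using g by simp
    qed
    also have "\<dots> \<le> real (p + 1) / (real (p + 1) * real m)" by (intro divide_right_mono) auto
    also have "\<dots> = 1 / real m" by simp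
    finally show ?thesis .
  qed
  let ?Y = "Opt - D"
  have "\<phi> Opt - \<phi> ?Y \<le> (\<Sum>e\<in>D. \<phi> (insert e ?Y) - \<phi> ?Y)"
  proof -
    have "?Y \<union> D = Opt" using finD by auto
    then show ?thesis using sum_marginals_ge[OF phi, of ?Y D] finD OE by auto
  qed
  also have "\<dots> \<le> (\<Sum>e\<in>D. 1 / ?h)"
  proof (rule sum_mono)
    fix e assume e: "e \<in> D"
    have "\<phi> (insert e ?Y) - \<phi> ?Y \<le> \<phi> (insert e A) - \<phi> A"
      using e finD OE A by (intro submodular_insert_union[OF phi]) auto
    then show "\<phi> (insert e ?Y) - \<phi> ?Y \<le> 1 / ?h" using guess(1)[of e] e finD by auto
  qed
  finally have v: "\<phi> Opt - 1 / real m \<le> \<phi> ?Y" using small by simp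
  have cc: "sum (C i) Opt - 1 / real m \<le> sum (C i) ?Y" if i: "i < c" "sum (C i) A < 1" for i
  proof -
    have "sum (C i) D \<le> (\<Sum>e\<in>D. 1 / ?h)"
    proof (rule sum_mono)
      fix e assume "e \<in> D"
      then show "C i e \<le> 1 / ?h" using guess(2)[of e i] finD i h by (auto simp: field_simps)
    qed
    moreover have "sum (C i) Opt = sum (C i) ?Y + sum (C i) D"
      using finD finO by (intro sum.subset_diff) auto
    ultimately show ?thesis using small by simp
  qed
  have "admissible A e" if "e \<in> ?Y - A" for e
    using that guess(2)[of e] by (auto simp: admissible_def D_def B_def not_less)
  then show ?thesis using v cc finD A by (intro exI[of _ ?Y]) auto
qed


text \<open>The value loses \<open>1 / m\<close> four times: by dropping large elements, by the
  weight of the pure deletions, by the thresholds and by the linearisation errors. The main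
  inequality bounds the penalty and the loss of value together, since both stand on its left
  side.\<close>

lemma local_optimum_approx:
  assumes A: "A \<subseteq> Opt" and Opt: "Opt \<in> \<I>"
    and PO: "\<And>i. i < p \<Longrightarrow> sum (P i) Opt \<le> 1" and CO: "\<And>i. i < c \<Longrightarrow> 1 \<le> sum (C i) Opt"
    and phiO: "\<phi> Opt = 1"
    and guess: "\<And>e. e \<in> Opt - A \<Longrightarrow> \<phi> (insert e A) - \<phi> A \<le> 1 / real (fine_scale m p c)"
      "\<And>e i. e \<in> Opt - A \<Longrightarrow> i < c \<Longrightarrow> 1 \<le> sum (C i) A \<or> C i e * real (fine_scale m p c) \<le> 1"
    and X: "X = covered E A L {1..\<nu>}" and XI: "X \<in> \<I>"
    and adm: "\<And>e. e \<in> X - A \<Longrightarrow> admissible A e" and opt: "local_optimum A L"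
  shows "(\<forall>i<p. sum (P i) X \<le> 1) \<and> (\<forall>i<c. 1 - 3 / real m \<le> sum (C i) X) \<and>
    layer_ratio \<nu> - 4 / real m \<le> \<phi> X"
proof -
  obtain Y where Y: "A \<subseteq> Y" "Y \<subseteq> Opt" "\<And>e. e \<in> Y - A \<Longrightarrow> admissible A e" "\<phi> Opt - 1 / real m \<le> \<phi> Y"
    "\<And>i. i < c \<Longrightarrow> sum (C i) A < 1 \<Longrightarrow> sum (C i) Opt - 1 / real m \<le> sum (C i) Y"
    using drop_large[OF A Opt PO guess] by blast
  have YI: "Y \<in> \<I>" using matroid_downward[OF M Opt Y(2)] .
  have OE: "Opt \<subseteq> E" and XE: "X \<subseteq> E" using M Opt XI by (auto simp: matroid_def)
  have AX: "A \<subseteq> X" by (auto simp: X covered_def)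
  have fin: "finite Opt" "finite X" "finite A" "finite Y"
    using OE XE A Y finE by (meson finite_subset)+
  obtain \<pi> where pi: "\<And>y. y \<in> Y \<Longrightarrow> \<pi> y \<in> insert nul X \<and> insert y (X - {\<pi> y}) \<in> \<I>"
    "\<And>y. y \<in> Y \<inter> X \<Longrightarrow> \<pi> y = y" "\<And>y. y \<in> Y - X \<Longrightarrow> \<pi> y \<notin> Y" "inj_on \<pi> {y \<in> Y. \<pi> y \<noteq> nul}"
    using matroid_exchange_map[OF M XI YI nulE] by blast
  define Q where "Q = Y - A"
  interpret X1: exchange E A X Q \<pi> nul
  proof
    show "inj_on \<pi> {y \<in> Q. \<pi> y \<noteq> nul}" using pi(4) by (rule inj_on_subset) (auto simp: Q_def)
    show "\<pi> y \<in> insert nul (X - A)" if "y \<in> Q" for y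
    proof (cases "y \<in> X")
      case True
      then show ?thesis using pi(2)[of y] that by (auto simp: Q_def)
    next
      case False
      then show ?thesis using pi(1)[of y] pi(3)[of y] that Y(1) by (auto simp: Q_def)
    qed
  qed (use finE nulE AX XE OE Y pi in \<open>auto simp: Q_def\<close>)
  \<comment> \<open>With an empty target the exchange sum consists of pure deletions, one for each
    element of \<open>X - A\<close>.\<close>
  interpret X0: exchange E A X "{}" \<pi> nul
    by unfold_locales (use finE nulE AX XE in auto)
  define \<eta> \<gamma> where "\<eta> = 1 / real m" and "\<gamma> = 1 / real (coarse_scale m (p + c))"
  \<comment> \<open>The combination counts insertions with weight \<open>1 - \<eta>\<close> and
    removals fully: it compares \<open>X\<close> with a target scaled by
    \<open>1 - \<eta>\<close>.\<close>
  define bal where "bal F = (1 - \<eta>) * X1.exchange_sum \<nu> F L + \<eta> * X0.exchange_sum \<nu> F L" for F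
  have eta: "0 \<le> \<eta>" "\<eta> \<le> 1" using m1 by (auto simp: \<eta>_def)
  have gam: "0 \<le> \<gamma>" "\<gamma> \<le> 1" using coarse_pos by (auto simp: \<gamma>_def)
  let ?exc = "\<lambda>i L. (max 0 (excess m (P i) A (covered E A L {1..\<nu>})))\<^sup>2"
  let ?def = "\<lambda>i L. (max 0 (deficit m (C i) (covered E A L {1..\<nu>})))\<^sup>2"
  let ?u = "\<lambda>i. max 0 (excess m (P i) A X)" and ?w = "\<lambda>i. max 0 (deficit m (C i) X)"
  have bal_value: "bal (local_value A) = bal (layered_value E A \<nu> \<phi>)
    - 4 * real m ^ 2 * ((\<Sum>i<p. bal (?exc i)) + (\<Sum>i<c. bal (?def i)))"
  proof -
    have "local_value A = (\<lambda>L. layered_value E A \<nu> \<phi> L - 4 * real m ^ 2 * ((\<Sum>i<p. ?exc i L) + (\<Sum>i<c. ?def i L)))"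
      by (simp add: local_value_def penalty_def fun_eq_iff)
    then show ?thesis unfolding bal_def
      by (simp only: X1.exchange_sum_diff X0.exchange_sum_diff X1.exchange_sum_add X0.exchange_sum_add
          X1.exchange_sum_sum X0.exchange_sum_sum finite_lessThan sum.distrib sum_distrib_left[symmetric])
        (simp add: algebra_simps)
  qed
  have admQ: "admissible A e" if "e \<in> Q \<union> (X - A)" for e
    using that Y(3) adm by (auto simp: Q_def)
  have exc: "bal (?exc i) \<le> - (?u i)\<^sup>2 + 3 * \<gamma>" if i: "i < p" for i
  proof -
    define r where "r = 1 - sum (P i) A"
    \<comment> \<open>For \<open>r = 0\<close> the division yields \<open>z e = 0\<close>, so an
      exhausted constraint never shows an excess.\<close>
    define z where "z e = P i e / r" for e
    have "sum (P i) A \<le> sum (P i) Opt" using A fin P_nonneg by (intro sum_mono2) auto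
    then have r: "0 \<le> r" using PO[OF i] by (simp add: r_def)
    define b where "b = - sum (P i) A / r - (1 - \<eta>)"
    have eq: "excess m (P i) A S = b + sum z S" for S
      by (simp add: excess_def b_def z_def r_def \<eta>_def sum_divide_distrib[symmetric] diff_divide_distrib)
    have z: "z nul = 0" "\<And>e. e \<in> Q \<union> (X - A) \<Longrightarrow> 0 \<le> z e \<and> z e \<le> \<gamma>"
    proof -
      fix e assume "e \<in> Q \<union> (X - A)"
      then have le: "P i e * real (coarse_scale m (p + c)) \<le> r" using admQ i by (simp add: admissible_def r_def)
      have "z e \<le> \<gamma>"
      proof (cases "r = 0")
        case False
        then show ?thesis using le r coarse_pos by (simp add: z_def \<gamma>_def field_simps)
      qed (use gam in \<open>simp add: z_def\<close>)
      then show "0 \<le> z e \<and> z e \<le> \<gamma>" using P_nonneg r by (simp add: z_def)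
    qed (simp add: z_def P_nul)
    define d where "d = sum z (X - A)"
    have u: "?u i = max 0 (d - (1 - \<eta>))"
      using sum.subset_diff[OF AX fin(2), of z]
      by (simp add: eq b_def d_def z_def sum_divide_distrib[symmetric])
    have q: "sum z Q \<le> 1"
    proof -
      have "sum (P i) Q + sum (P i) A = sum (P i) Y"
        using sum.subset_diff[OF Y(1) fin(4), of "P i"] by (simp add: Q_def)
      moreover have "sum (P i) Y \<le> sum (P i) Opt" using Y fin P_nonneg by (intro sum_mono2) auto
      ultimately have "sum (P i) Q \<le> r" using PO[OF i] by (simp add: r_def)
      then show ?thesis using r by (cases "r = 0") (simp_all add: z_def sum_divide_distrib[symmetric])
    qed
    have nn: "0 \<le> sum z Q" "0 \<le> d" using z(2) by (auto simp: d_def intro!: sum_nonneg)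
    have u2: "?u i = max 0 (b + sum z X)" by (simp add: eq)
    have "X1.exchange_sum \<nu> (?exc i) L \<le> (2 * ?u i + \<gamma>) * sum z Q - max 0 (2 * ?u i - \<gamma>) * d"
      using X1.exchange_sum_square_excess[OF nu1 X z(1) z(2) gam(1) u2] by (simp add: eq d_def)
    moreover have "X0.exchange_sum \<nu> (?exc i) L \<le> - (max 0 (2 * ?u i - \<gamma>) * d)"
      using X0.exchange_sum_square_excess[OF nu1 X z(1) _ gam(1) u2] z(2) by (simp add: eq d_def)
    ultimately have "bal (?exc i) \<le> (1 - \<eta>) * ((2 * ?u i + \<gamma>) * sum z Q - max 0 (2 * ?u i - \<gamma>) * d)
      + \<eta> * (- (max 0 (2 * ?u i - \<gamma>) * d))"
      unfolding bal_def using eta by (intro add_mono mult_left_mono) auto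
    also have "\<dots> \<le> - (?u i)\<^sup>2 + 3 * \<gamma>"
      by (rule excess_balance[OF u nn(1) q nn(2) gam eta])
    finally show ?thesis .
  qed
  have def: "bal (?def i) \<le> - (?w i)\<^sup>2 + 3 * \<gamma>" if i: "i < c" for i
  proof -
    let ?h = "\<lambda>S. (max 0 (deficit m (C i) S))\<^sup>2"
    have fine_le: "1 / real (fine_scale m p c) \<le> \<gamma>"
    proof -
      have "coarse_scale m (p + c) * 1 * 1 \<le> fine_scale m p c"
        unfolding fine_scale_def using m1 by (intro mult_le_mono) auto
      then show ?thesis using coarse_pos fine_pos unfolding \<gamma>_def by (intro divide_left_mono) auto
    qed
    have zeroI: "?h S = 0" if "1 \<le> sum (C i) S" for S
    proof -
      have "0 \<le> 2 / real m" by simp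
      then have "deficit m (C i) S \<le> 0" using that unfolding deficit_def by linarith
      then show ?thesis by simp
    qed
    define d where "d = sum (C i) (X - A)"
    have dX: "sum (C i) X = d + sum (C i) A" using sum.subset_diff[OF AX fin(2), of "C i"] by (simp add: d_def)
    show ?thesis
    \<comment> \<open>If \<open>A\<close> covers the constraint, or if the load of
      \<open>X - A\<close> exceeds 2 while its elements weigh at most 1, no move brings the load
      below 1. The squared deficit is then 0 before and after each move.\<close>
    proof (cases "1 \<le> sum (C i) A \<or> d > 2")
      case True
      have mono: "1 \<le> sum (C i) S" if "1 \<le> sum (C i) A" "A \<subseteq> S" "finite S" for S
        using sum_mono2[of S A "C i"] that C_nonneg by (meson order_trans)
      have small: "C i e \<le> 1" if "e \<in> X - A" "\<not> 1 \<le> sum (C i) A" for e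
      proof -
        have "C i e \<le> 1 / real (fine_scale m p c)"
          using admQ[of e] that i fine_pos by (auto simp: admissible_def field_simps)
        then show ?thesis using fine_le gam by simp
      qed
      have CA: "0 \<le> sum (C i) A" using C_nonneg by (intro sum_nonneg) auto
      have X1: "1 \<le> sum (C i) X"
      proof (cases "1 \<le> sum (C i) A")
        case True
        then show ?thesis using mono[OF _ AX fin(2)] by simp
      next
        case False
        then have "d > 2" using True by simp
        then show ?thesis using dX CA by linarith
      qed
      have hX: "?h X = 0" using X1 by (rule zeroI)
      have del1: "1 \<le> sum (C i) (X - {a})" if a: "a \<in> X - A" for a
      proof (cases "1 \<le> sum (C i) A")
        case True
        then show ?thesis using mono[of "X - {a}"] AX a fin by auto
      next
        case False
        then have "d > 2" using True by simp
        moreover have "sum (C i) (X - {a}) = sum (C i) X - C i a" using a fin by (simp add: sum_diff1)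
        ultimately show ?thesis using dX CA small[OF a False] by linarith
      qed
      have hdel: "?h (X - {a}) = 0" if a: "a \<in> X - A" for a
        using del1[OF a] by (rule zeroI)
      have hins: "?h (insert y (X - {\<pi> y})) = 0" if y: "y \<in> Q" for y
      proof (cases "\<pi> y \<in> X - A")
        case t: True
        have "1 \<le> sum (C i) (X - {\<pi> y})" by (rule del1[OF t])
        also have "\<dots> \<le> sum (C i) (insert y (X - {\<pi> y}))" using fin C_nonneg by (intro sum_mono2) auto
        finally show ?thesis by (rule zeroI)
      next
        case f: False
        then have "\<pi> y = nul" using X1.pi_range[OF y] by auto
        then have "X - {\<pi> y} = X" using nulE XE by auto
        moreover note X1
        moreover have "sum (C i) X \<le> sum (C i) (insert y X)" using fin C_nonneg by (intro sum_mono2) auto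
        ultimately show ?thesis by (intro zeroI) simp
      qed
      have "bal (?def i) = 0" unfolding bal_def
        using X1.exchange_sum_zero[OF nu1 X, of ?h] X0.exchange_sum_zero[OF nu1 X, of ?h] hX hdel hins by simp
      then show ?thesis using hX gam by simp
    next
      case False
      have z: "C i nul = 0" "\<And>e. e \<in> Q \<union> (X - A) \<Longrightarrow> 0 \<le> C i e \<and> C i e \<le> \<gamma>"
      proof -
        fix e assume "e \<in> Q \<union> (X - A)"
        then have "C i e * real (fine_scale m p c) \<le> 1" using admQ i False by (auto simp: admissible_def)
        then have "C i e \<le> 1 / real (fine_scale m p c)" using fine_pos by (simp add: field_simps)
        then show "0 \<le> C i e \<and> C i e \<le> \<gamma>" using C_nonneg fine_le by auto
      qed (simp add: C_nul)
      define q where "q = sum (C i) Q"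
      define \<tau> where "\<tau> = 1 - 2 / real m - sum (C i) A"
      have w: "?w i = max 0 (\<tau> - d)" by (simp add: deficit_def dX \<tau>_def algebra_simps)
      have w2: "?w i = max 0 (1 - 2 / real m - sum (C i) X)" by (simp add: deficit_def)
      have CA: "0 \<le> sum (C i) A" using C_nonneg by (intro sum_nonneg) auto
      have "q + sum (C i) A = sum (C i) Y" using sum.subset_diff[OF Y(1) fin(4), of "C i"] by (simp add: Q_def q_def)
      then have "1 - \<eta> - sum (C i) A \<le> q" using Y(5)[OF i] CO[OF i] False by (simp add: \<eta>_def)
      then have "(1 - \<eta>) * (1 - \<eta> - sum (C i) A) \<le> (1 - \<eta>) * q" using eta by (intro mult_left_mono) auto
      \<comment> \<open>Both losses of \<open>\<eta>\<close>, from the dropped elements and from the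
        scaling, meet here: this is the origin of \<open>2 / m\<close> in
        \<open>deficit\<close>.\<close>
      moreover have "\<tau> \<le> (1 - \<eta>) * (1 - \<eta> - sum (C i) A)"
      proof -
        have "0 \<le> \<eta> * \<eta>" "0 \<le> \<eta> * sum (C i) A" using eta CA by auto
        then show ?thesis by (simp add: \<tau>_def \<eta>_def[symmetric] algebra_simps) (simp add: \<eta>_def)
      qed
      ultimately have tq: "\<tau> \<le> (1 - \<eta>) * q" by simp
      have "0 \<le> 2 / real m" by simp
      then have t1: "\<tau> \<le> 1" using CA unfolding \<tau>_def by linarith
      have d: "0 \<le> d" "d \<le> 2" using False C_nonneg by (auto simp: d_def intro!: sum_nonneg)
      have "X1.exchange_sum \<nu> (?def i) L \<le> (2 * ?w i + \<gamma>) * d - max 0 (2 * ?w i - \<gamma>) * q"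
        using X1.exchange_sum_square_deficit[OF nu1 X z(1) z(2) gam(1) w2] by (simp add: deficit_def d_def q_def)
      moreover have "X0.exchange_sum \<nu> (?def i) L \<le> (2 * ?w i + \<gamma>) * d"
        using X0.exchange_sum_square_deficit[OF nu1 X z(1) _ gam(1) w2] z(2) by (simp add: deficit_def d_def)
      ultimately have "bal (?def i) \<le> (1 - \<eta>) * ((2 * ?w i + \<gamma>) * d - max 0 (2 * ?w i - \<gamma>) * q)
        + \<eta> * ((2 * ?w i + \<gamma>) * d)"
        unfolding bal_def using eta by (intro add_mono mult_left_mono) auto
      also have "\<dots> \<le> - (?w i)\<^sup>2 + 3 * \<gamma>"
        by (rule deficit_balance[OF w tq t1 d gam])
      finally show ?thesis .
    qed
  qed
  have th: "0 \<le> threshold" "2 * real (card E) * threshold \<le> \<eta>"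
  proof -
    have "2 * real (card E) * threshold = real (card E) / (real (card E) + 1) * \<eta>"
      by (simp add: threshold_def \<eta>_def)
    also have "\<dots> \<le> 1 * \<eta>" using eta by (intro mult_right_mono) auto
    finally show "2 * real (card E) * threshold \<le> \<eta>" by simp
  qed (simp add: threshold_def)
  have move_del: "local_value A (L(a := 0, nul := 0)) - local_value A L \<le> threshold" if a: "a \<in> X - A" for a
  proof -
    have "covered E A (L(a := 0, nul := 0)) {1..\<nu>} = X - {a}"
      using X1.covered_remove[OF a order.refl] X by simp
    moreover have "X - {a} \<in> \<I>" using matroid_downward[OF M XI] by blast
    \<comment> \<open>A deletion is a move that inserts the dummy, so the dummy has to pass the
      test; its weights are 0, and \<open>A\<close> does not overload the packing
      constraints.\<close>
    moreover have "admissible A nul"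
    proof -
      have "sum (P i) A \<le> sum (P i) Opt" for i using A fin P_nonneg by (intro sum_mono2) auto
      then show ?thesis using PO by (auto simp: admissible_def P_nul C_nul intro: order_trans)
    qed
    ultimately show ?thesis using a XE by (intro local_optimumD[OF opt]) auto
  qed
  have move_ins: "local_value A (L(\<pi> y := 0, y := l)) - local_value A L \<le> threshold"
    if y: "y \<in> Q" and l: "l \<in> {1..\<nu>}" for y l
  proof -
    have "covered E A (L(\<pi> y := 0, y := l)) {1..\<nu>} = insert y (X - {\<pi> y})"
      using X1.covered_insert[OF y X order.refl, of l] X l by simp
    moreover have "insert y (X - {\<pi> y}) \<in> \<I>" using pi(1)[of y] y by (auto simp: Q_def)
    moreover have "admissible A y" "\<pi> y \<in> insert nul E" "y \<in> insert nul E"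
      using admQ[of y] X1.pi_range[OF y] XE X1.QE y by auto
    ultimately show ?thesis using l by (intro local_optimumD[OF opt]) simp_all
  qed
  have "X1.exchange_sum \<nu> (local_value A) L \<le> \<eta>"
    using X1.exchange_sum_le[OF nu1 th(1), of "local_value A" L] move_ins move_del th(2) by auto
  moreover have "X0.exchange_sum \<nu> (local_value A) L \<le> \<eta>"
    using X0.exchange_sum_le[OF nu1 th(1), of "local_value A" L] move_del th(2) by auto
  ultimately have "bal (local_value A) \<le> (1 - \<eta>) * \<eta> + \<eta> * \<eta>"
    unfolding bal_def using eta by (intro add_mono mult_left_mono) auto
  then have up: "bal (local_value A) \<le> \<eta>" by (simp add: algebra_simps)
  define \<rho> where "\<rho> = layer_ratio \<nu>"
  have rho: "0 \<le> \<rho>" "\<rho> \<le> 1" using layer_ratio_bounds[OF nu1] by (auto simp: \<rho>_def)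
  have phiA: "0 \<le> \<phi> A" using phi_nonneg A OE by auto
  have "A \<union> Q = Y" using Y(1) by (auto simp: Q_def)
  then have "(1 - \<eta>) * (\<rho> * \<phi> Y - \<phi> X) + \<eta> * (\<rho> * \<phi> A - \<phi> X) \<le> bal (layered_value E A \<nu> \<phi>)"
    unfolding bal_def \<rho>_def
    using X1.exchange_sum_layered_value[OF phi phi_nonneg nu1 X] X0.exchange_sum_layered_value[OF phi phi_nonneg nu1 X] eta
    by (intro add_mono mult_left_mono) auto
  moreover have "0 \<le> \<eta> * (\<rho> * \<phi> A)" using eta rho phiA by simp
  moreover have "(1 - \<eta>) * (\<rho> * \<phi> Y - \<phi> X) + \<eta> * (\<rho> * \<phi> A - \<phi> X) = (1 - \<eta>) * (\<rho> * \<phi> Y) + \<eta> * (\<rho> * \<phi> A) - \<phi> X"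
    by (simp add: algebra_simps)
  ultimately have low: "(1 - \<eta>) * (\<rho> * \<phi> Y) - \<phi> X \<le> bal (layered_value E A \<nu> \<phi>)" by linarith
  define S where "S = (\<Sum>i<p. (?u i)\<^sup>2) + (\<Sum>i<c. (?w i)\<^sup>2)"
  have "(\<Sum>i<p. bal (?exc i)) + (\<Sum>i<c. bal (?def i)) \<le> (\<Sum>i<p. - (?u i)\<^sup>2 + 3 * \<gamma>) + (\<Sum>i<c. - (?w i)\<^sup>2 + 3 * \<gamma>)"
    using exc def by (intro add_mono sum_mono) auto
  also have "\<dots> = - S + real (p + c) * (3 * \<gamma>)"
    by (simp add: S_def sum_subtractf algebra_simps)
  finally have "4 * real m ^ 2 * ((\<Sum>i<p. bal (?exc i)) + (\<Sum>i<c. bal (?def i)))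
    \<le> 4 * real m ^ 2 * (- S + real (p + c) * (3 * \<gamma>))"
    by (intro mult_left_mono) auto
  also have "\<dots> = - (4 * real m ^ 2 * S) + 12 * real m ^ 2 * real (p + c) * \<gamma>" by (simp add: algebra_simps)
  also have "12 * real m ^ 2 * real (p + c) * \<gamma> \<le> \<eta>"
  proof -
    have "real (coarse_scale m (p + c)) = 12 * real m ^ 2 * (real m * (real (p + c) + 1))"
      by (simp add: coarse_scale_def power2_eq_square power3_eq_cube algebra_simps)
    then have "12 * real m ^ 2 * real (p + c) * \<gamma> = real (p + c) / (real (p + c) + 1) * \<eta>"
      using m1 by (simp add: \<gamma>_def \<eta>_def)
    also have "\<dots> \<le> 1 * \<eta>" using eta by (intro mult_right_mono) auto
    finally show ?thesis by simp
  qed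
  finally have main: "(1 - \<eta>) * (\<rho> * \<phi> Y) - \<phi> X + 4 * real m ^ 2 * S \<le> 2 * \<eta>"
    using low up bal_value by linarith
  have Snn: "0 \<le> S" by (auto simp: S_def intro!: add_nonneg_nonneg sum_nonneg)
  have phiY: "1 - \<eta> \<le> \<phi> Y" using Y(4) phiO by (simp add: \<eta>_def)
  have val: "layer_ratio \<nu> - 4 / real m \<le> \<phi> X"
  proof -
    have "(1 - \<eta>) * (\<rho> * (1 - \<eta>)) \<le> (1 - \<eta>) * (\<rho> * \<phi> Y)"
      using phiY eta rho by (intro mult_left_mono) auto
    moreover have "\<rho> - 2 * \<eta> \<le> (1 - \<eta>) * (\<rho> * (1 - \<eta>))"
    proof -
      have "\<rho> * \<eta> \<le> 1 * \<eta>" using rho eta by (intro mult_right_mono) auto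
      moreover have "0 \<le> \<rho> * \<eta> * \<eta>" using rho eta by simp
      ultimately show ?thesis by (simp add: algebra_simps)
    qed
    moreover have "0 \<le> 4 * real m ^ 2 * S" using Snn by simp
    ultimately have "\<rho> - 4 * \<eta> \<le> \<phi> X" using main by linarith
    then show ?thesis by (simp add: \<rho>_def \<eta>_def)
  qed
  \<comment> \<open>In the main inequality \<open>\<phi> X\<close> and \<open>\<eta>\<close> are at
    most 1 and the value of the target is nonnegative, which leaves
    \<open>2 * \<eta> + \<phi> X \<le> 3\<close>.\<close>
  have S3: "4 * real m ^ 2 * S \<le> 3"
  proof -
    have "0 \<le> (1 - \<eta>) * (\<rho> * \<phi> Y)" using eta rho phiY by simp
    then show ?thesis using main phi_le_1[OF XE] eta by linarith
  qed
  have viol: "x \<le> \<eta>" if "(max 0 x)\<^sup>2 \<le> S" for x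
  proof (rule ccontr)
    assume n: "\<not> x \<le> \<eta>"
    then have "\<eta>\<^sup>2 \<le> (max 0 x)\<^sup>2" using eta by (intro power_mono) auto
    then have "4 * real m ^ 2 * \<eta>\<^sup>2 \<le> 4 * real m ^ 2 * S" using that by (intro mult_left_mono) auto
    moreover have "4 * real m ^ 2 * \<eta>\<^sup>2 = 4" using m1 by (simp add: \<eta>_def power_divide)
    ultimately show False using S3 by simp
  qed
  have "sum (P i) X \<le> 1" if i: "i < p" for i
  proof -
    have "(?u i)\<^sup>2 \<le> (\<Sum>i<p. (?u i)\<^sup>2)" using i by (intro member_le_sum) auto
    also have "\<dots> \<le> S" unfolding S_def by (simp add: sum_nonneg)
    finally have "excess m (P i) A X \<le> \<eta>" by (rule viol)
    then have le: "(sum (P i) X - sum (P i) A) / (1 - sum (P i) A) \<le> 1" by (simp add: excess_def \<eta>_def)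
    have "sum (P i) A \<le> sum (P i) Opt" using A fin P_nonneg by (intro sum_mono2) auto
    then have PA: "sum (P i) A \<le> 1" using PO[OF i] by simp
    show ?thesis
    proof (cases "sum (P i) A = 1")
      \<comment> \<open>Here \<open>excess\<close> divides by zero and says nothing about the load;
        instead admissibility forces the elements of \<open>X - A\<close> to weigh nothing.\<close>
      case True
      have "P i e = 0" if "e \<in> X - A" for e
        using adm[OF that] i True P_nonneg[of i e] coarse_pos
        by (auto simp: admissible_def mult_le_0_iff dest!: spec[of _ i])
      then have "sum (P i) (X - A) = 0" by simp
      then show ?thesis using sum.subset_diff[OF AX fin(2), of "P i"] True by simp
    next
      case False
      then show ?thesis using le PA by (simp add: field_simps)
    qed
  qed
  moreover have "1 - 3 / real m \<le> sum (C i) X" if i: "i < c" for i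
  proof -
    have "(?w i)\<^sup>2 \<le> (\<Sum>i<c. (?w i)\<^sup>2)" using i by (intro member_le_sum) auto
    also have "\<dots> \<le> S" unfolding S_def by (simp add: sum_nonneg)
    finally have "deficit m (C i) X \<le> \<eta>" by (rule viol)
    then show ?thesis by (simp add: deficit_def \<eta>_def)
  qed
  ultimately show ?thesis using val by blast
qed

end

section \<open>Compiling loop programs\<close>

text \<open>With bounded loops and without coin flips, termination, running time and determinism
  become syntactic. Correctness is proved for the denotation \<open>den\<close> and transferred once
  by \<open>compile_correct\<close>.\<close>

datatype prog =
    Nop
  | NSet string nexp nexp
  | RSet string nexp rexp
  | Block prog prog
  | Branch bexp prog prog
  | For string nexp prog

text \<open>\<open>For\<close> sets its counter in every round and leaves it at the bound, as the
  compiled \<open>While\<close> does, so that both end in the same memory.\<close>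

primrec den :: "mpc_input \<Rightarrow> prog \<Rightarrow> state \<Rightarrow> state" where
  "den I Nop s = s"
| "den I (NSet x i a) s = nat_update x (nval I s i) (nval I s a) s"
| "den I (RSet x i a) s = real_update x (nval I s i) (rval I s a) s"
| "den I (Block p q) s = den I q (den I p s)"
| "den I (Branch b p q) s = (if bval I s b then den I p s else den I q s)"
| "den I (For x b p) s = nat_update x 0 (nval I s b)
     (fold (\<lambda>i s. den I p (nat_update x 0 i s)) [0..<nval I s b] s)"

primrec compile :: "prog \<Rightarrow> com" where
  "compile Nop = Skip"
| "compile (NSet x i a) = NAssign x i a"
| "compile (RSet x i a) = RAssign x i a"
| "compile (Block p q) = Seq (compile p) (compile q)"
| "compile (Branch b p q) = Cond b (compile p) (compile q)"
| "compile (For x b p) = Seq (NAssign x (NConst 0) (NConst 0))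
     (While (NLess (NCell x (NConst 0)) b)
       (Seq (compile p) (NAssign x (NConst 0) (NAdd (NCell x (NConst 0)) (NConst 1)))))"

text \<open>Loop bounds have to be constant during the loop and polynomial in the size of the ground
  set, which rules out memory cells and truncated subtraction.\<close>

primrec closed_nexp :: "nexp \<Rightarrow> bool" where
  "closed_nexp (NConst k) \<longleftrightarrow> True"
| "closed_nexp GroundSize \<longleftrightarrow> True"
| "closed_nexp (NCell x a) \<longleftrightarrow> False"
| "closed_nexp (NAdd a b) \<longleftrightarrow> closed_nexp a \<and> closed_nexp b"
| "closed_nexp (NSub a b) \<longleftrightarrow> False"

primrec nexp_poly :: "nexp \<Rightarrow> nat poly" where
  "nexp_poly (NConst k) = [:k:]"
| "nexp_poly GroundSize = [:0, 1:]"
| "nexp_poly (NCell x a) = 0"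
| "nexp_poly (NAdd a b) = nexp_poly a + nexp_poly b"
| "nexp_poly (NSub a b) = 0"

lemma nval_closed: "closed_nexp a \<Longrightarrow> nval I s a = poly (nexp_poly a) (ground_size I)"
  by (induction a) auto

primrec nats_of :: "prog \<Rightarrow> string set" where
  "nats_of Nop = {}"
| "nats_of (NSet x i a) = {x}"
| "nats_of (RSet x i a) = {}"
| "nats_of (Block p q) = nats_of p \<union> nats_of q"
| "nats_of (Branch b p q) = nats_of p \<union> nats_of q"
| "nats_of (For x b p) = insert x (nats_of p)"

primrec reals_of :: "prog \<Rightarrow> string set" where
  "reals_of Nop = {}"
| "reals_of (NSet x i a) = {}"
| "reals_of (RSet x i a) = {x}"
| "reals_of (Block p q) = reals_of p \<union> reals_of q"
| "reals_of (Branch b p q) = reals_of p \<union> reals_of q"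
| "reals_of (For x b p) = reals_of p"

primrec well_formed :: "prog \<Rightarrow> bool" where
  "well_formed Nop \<longleftrightarrow> True"
| "well_formed (NSet x i a) \<longleftrightarrow> True"
| "well_formed (RSet x i a) \<longleftrightarrow> True"
| "well_formed (Block p q) \<longleftrightarrow> well_formed p \<and> well_formed q"
| "well_formed (Branch b p q) \<longleftrightarrow> well_formed p \<and> well_formed q"
| "well_formed (For x b p) \<longleftrightarrow> closed_nexp b \<and> x \<notin> nats_of p \<and> well_formed p"

lemma nats_nat_update: "nats (nat_update x i v s) y = (if y = x then (nats s x)(i := v) else nats s y)"
  by (simp add: nat_update_def)

lemma reals_nat_update [simp]: "reals (nat_update x i v s) = reals s"
  by (simp add: nat_update_def)

lemma reals_real_update: "reals (real_update x i v s) y = (if y = x then (reals s x)(i := v) else reals s y)"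
  by (simp add: real_update_def)

lemma nats_real_update [simp]: "nats (real_update x i v s) = nats s"
  by (simp add: real_update_def)

lemma nat_update_twice [simp]: "nat_update x i v (nat_update x i w s) = nat_update x i v s"
  by (simp add: nat_update_def)

lemma fold_invariant_upt:
  assumes "P 0 s" and "\<And>i s. i < n \<Longrightarrow> P i s \<Longrightarrow> P (Suc i) (f i s)"
  shows "P n (fold f [0..<n] s)"
  using assms by (induction n) auto

lemma nats_den: "x \<notin> nats_of p \<Longrightarrow> nats (den I p s) x = nats s x"
proof (induction p arbitrary: s)
  case (For y b p)
  have "nats (fold (\<lambda>i s. den I p (nat_update y 0 i s)) [0..<nval I s b] s) x = nats s x"
    using For by (intro fold_invariant_upt[where P = "\<lambda>_ t. nats t x = nats s x"]) (auto simp: nats_nat_update)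
  then show ?case using For by (simp add: nats_nat_update)
qed (auto simp: nats_nat_update)

lemma reals_den: "x \<notin> reals_of p \<Longrightarrow> reals (den I p s) x = reals s x"
proof (induction p arbitrary: s)
  case (For y b p)
  have "reals (fold (\<lambda>i s. den I p (nat_update y 0 i s)) [0..<nval I s b] s) x = reals s x"
    using For by (intro fold_invariant_upt[where P = "\<lambda>_ t. reals t x = reals s x"]) auto
  then show ?case using For by simp
qed (auto simp: reals_real_update)

section \<open>Deterministic execution and step counts\<close>

fun dstep :: "mpc_input \<Rightarrow> com \<times> state \<Rightarrow> com \<times> state" where
  "dstep I (Skip, s) = (Skip, s)"
| "dstep I (NAssign x i a, s) = (Skip, nat_update x (nval I s i) (nval I s a) s)"
| "dstep I (RAssign x i a, s) = (Skip, real_update x (nval I s i) (rval I s a) s)"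
| "dstep I (CoinFlip x i, s) = (Skip, s)"
| "dstep I (Seq c1 c2, s) =
     (if c1 = Skip then (c2, s) else (Seq (fst (dstep I (c1, s))) c2, snd (dstep I (c1, s))))"
| "dstep I (Cond b c1 c2, s) = (if bval I s b then c1 else c2, s)"
| "dstep I (While b c, s) = (if bval I s b then Seq c (While b c) else Skip, s)"

primrec coin_free :: "com \<Rightarrow> bool" where
  "coin_free Skip \<longleftrightarrow> True"
| "coin_free (NAssign x i a) \<longleftrightarrow> True"
| "coin_free (RAssign x i a) \<longleftrightarrow> True"
| "coin_free (CoinFlip x i) \<longleftrightarrow> False"
| "coin_free (Seq c1 c2) \<longleftrightarrow> coin_free c1 \<and> coin_free c2"
| "coin_free (Cond b c1 c2) \<longleftrightarrow> coin_free c1 \<and> coin_free c2"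
| "coin_free (While b c) \<longleftrightarrow> coin_free c"

lemma step_coin_free: "coin_free c \<Longrightarrow> step I (c, s) = return_pmf (dstep I (c, s))"
  by (induction c arbitrary: s) (auto simp: case_prod_beta)

lemma coin_free_dstep: "coin_free c \<Longrightarrow> coin_free (fst (dstep I (c, s)))"
  by (induction c arbitrary: s) auto

lemma coin_free_funpow: "coin_free (fst cs) \<Longrightarrow> coin_free (fst ((dstep I ^^ t) cs))"
proof (induction t)
  case (Suc t)
  then show ?case using coin_free_dstep[of "fst ((dstep I ^^ t) cs)" I "snd ((dstep I ^^ t) cs)"] by simp
qed simp

lemma run_coin_free: "coin_free c \<Longrightarrow> run I c t = return_pmf ((dstep I ^^ t) (c, init_state))"
proof (induction t)
  case (Suc t)
  have "step I ((dstep I ^^ t) (c, init_state)) = return_pmf (dstep I ((dstep I ^^ t) (c, init_state)))"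
    using coin_free_funpow[of "(c, init_state)" t I] Suc.prems
    by (cases "(dstep I ^^ t) (c, init_state)") (auto intro: step_coin_free)
  then show ?case using Suc by (simp add: bind_return_pmf)
qed simp

lemma coin_free_compile: "coin_free (compile p)"
  by (induction p) auto

text \<open>An upper bound in place of an exact count lets both branches of a conditional share one
  polynomial.\<close>

definition reaches_within :: "mpc_input \<Rightarrow> nat \<Rightarrow> com \<times> state \<Rightarrow> com \<times> state \<Rightarrow> bool" where
  "reaches_within I T cs ds \<longleftrightarrow> (\<exists>k \<le> T. (dstep I ^^ k) cs = ds)"

lemma reaches_within_0: "reaches_within I T cs cs"
  unfolding reaches_within_def by (intro exI[of _ 0]) simp

lemma reaches_within_step: "dstep I cs = ds \<Longrightarrow> reaches_within I 1 cs ds"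
  unfolding reaches_within_def by (intro exI[of _ 1]) simp

lemma reaches_within_trans:
  assumes "reaches_within I T cs ds" "reaches_within I U ds es"
  shows "reaches_within I (T + U) cs es"
proof -
  obtain k j where "k \<le> T" "(dstep I ^^ k) cs = ds" "j \<le> U" "(dstep I ^^ j) ds = es"
    using assms unfolding reaches_within_def by auto
  then show ?thesis unfolding reaches_within_def
    by (intro exI[of _ "j + k"]) (simp add: funpow_add)
qed

lemma reaches_within_mono: "reaches_within I T cs ds \<Longrightarrow> T \<le> U \<Longrightarrow> reaches_within I U cs ds"
  unfolding reaches_within_def using le_trans by blast

lemma funpow_dstep_Skip: "(dstep I ^^ k) (Skip, s) = (Skip, s)"
  by (induction k) auto

lemma reaches_within_Seq:
  assumes "reaches_within I T (c, s) (Skip, t)"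
  shows "reaches_within I (T + 1) (Seq c d, s) (d, t)"
proof -
  obtain k where k: "k \<le> T" "(dstep I ^^ k) (c, s) = (Skip, t)"
    using assms unfolding reaches_within_def by auto
  have "reaches_within I (k + 1) (Seq c d, s) (d, t)"
    using k(2)
  proof (induction k arbitrary: c s)
    case 0
    then show ?case using reaches_within_step[of I "(Seq c d, s)"] by simp
  next
    case (Suc k)
    show ?case
    proof (cases "c = Skip")
      case True
      then have "s = t" using Suc.prems funpow_dstep_Skip[of "Suc k" I s] by simp
      then show ?thesis using True reaches_within_mono[OF reaches_within_step[of I "(Seq c d, s)"]] by simp
    next
      case False
      obtain c' s' where cs: "dstep I (c, s) = (c', s')" by fastforce
      then have "(dstep I ^^ k) (c', s') = (Skip, t)" using Suc.prems by (simp add: funpow_Suc_right del: funpow.simps)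
      from Suc.IH[OF this] have "reaches_within I (k + 1) (Seq c' d, s') (d, t)" .
      moreover have "reaches_within I 1 (Seq c d, s) (Seq c' d, s')"
        using False cs by (intro reaches_within_step) simp
      ultimately show ?thesis using reaches_within_trans by fastforce
    qed
  qed
  then show ?thesis by (rule reaches_within_mono) (use k(1) in simp)
qed

text \<open>A conditional is charged with the sum of both branches, because the maximum of two
  polynomials is in general no polynomial. A round of a loop costs 4 extra steps: the test, the
  increment and two for sequencing.\<close>

primrec time_of :: "prog \<Rightarrow> nat poly" where
  "time_of Nop = 0"
| "time_of (NSet x i a) = 1"
| "time_of (RSet x i a) = 1"
| "time_of (Block p q) = time_of p + 1 + time_of q"
| "time_of (Branch b p q) = 1 + (time_of p + time_of q)"
| "time_of (For x b p) = 2 + nexp_poly b * (time_of p + 4) + 1"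

lemma compile_correct:
  "well_formed p \<Longrightarrow> reaches_within I (poly (time_of p) (ground_size I)) (compile p, s) (Skip, den I p s)"
proof (induction p arbitrary: s)
  case Nop
  then show ?case by (simp add: reaches_within_0)
next
  case (NSet x i a)
  then show ?case by (simp add: reaches_within_step del: One_nat_def)
next
  case (RSet x i a)
  then show ?case by (simp add: reaches_within_step del: One_nat_def)
next
  case (Block p q)
  have "reaches_within I (poly (time_of p) (ground_size I) + 1) (compile (Block p q), s) (compile q, den I p s)"
    using Block by (simp only: compile.simps) (intro reaches_within_Seq, simp)
  from reaches_within_trans[OF this Block.IH(2)] show ?case using Block.prems by simp
next
  case (Branch b p q)
  let ?n = "ground_size I"
  have "reaches_within I 1 (compile (Branch b p q), s) (if bval I s b then compile p else compile q, s)"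
    by (intro reaches_within_step) simp
  moreover have "reaches_within I (poly (time_of p) ?n + poly (time_of q) ?n)
    (if bval I s b then compile p else compile q, s) (Skip, den I (Branch b p q) s)"
    using Branch by (auto intro: reaches_within_mono[OF Branch.IH(1)] reaches_within_mono[OF Branch.IH(2)])
  ultimately have "reaches_within I (1 + (poly (time_of p) ?n + poly (time_of q) ?n))
    (compile (Branch b p q), s) (Skip, den I (Branch b p q) s)"
    by (rule reaches_within_trans)
  then show ?case by simp
next
  case (For x b p)
  let ?n = "ground_size I"
  let ?T = "poly (time_of p) ?n" and ?N = "poly (nexp_poly b) ?n"
  let ?inc = "NAssign x (NConst 0) (NAdd (NCell x (NConst 0)) (NConst 1))"
  let ?W = "While (NLess (NCell x (NConst 0)) b) (Seq (compile p) ?inc)"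
  let ?F = "\<lambda>j. fold (\<lambda>i s. den I p (nat_update x 0 i s)) [0..<j] s"
  \<comment> \<open>The compiled loop evaluates the bound anew in each memory; a closed bound always
    gives the same number.\<close>
  have b: "nval I t b = ?N" for t using For.prems nval_closed by simp
  have iter: "reaches_within I (?T + 4) (?W, nat_update x 0 j (?F j)) (?W, nat_update x 0 (Suc j) (?F (Suc j)))"
    if j: "j < ?N" for j
  proof -
    let ?s = "nat_update x 0 j (?F j)"
    have 1: "reaches_within I 1 (?W, ?s) (Seq (Seq (compile p) ?inc) ?W, ?s)"
      using j by (intro reaches_within_step) (simp add: b nats_nat_update)
    have "reaches_within I (?T + 1) (Seq (compile p) ?inc, ?s) (?inc, den I p ?s)"
      using For by (intro reaches_within_Seq) simp
    moreover have "reaches_within I 1 (?inc, den I p ?s) (Skip, nat_update x 0 (Suc j) (?F (Suc j)))"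
      using For.prems nats_den[of x p I ?s] by (intro reaches_within_step) (simp add: nats_nat_update)
    ultimately have "reaches_within I (?T + 1 + 1) (Seq (compile p) ?inc, ?s) (Skip, nat_update x 0 (Suc j) (?F (Suc j)))"
      by (rule reaches_within_trans)
    from reaches_within_trans[OF 1 reaches_within_Seq[OF this]] show ?thesis
      by (rule reaches_within_mono) simp
  qed
  have loop: "reaches_within I (j * (?T + 4)) (?W, nat_update x 0 0 s) (?W, nat_update x 0 j (?F j))" if "j \<le> ?N" for j
    using that
  proof (induction j)
    case 0
    then show ?case by (simp add: reaches_within_0)
  next
    case (Suc j)
    then have "reaches_within I (j * (?T + 4) + (?T + 4)) (?W, nat_update x 0 0 s) (?W, nat_update x 0 (Suc j) (?F (Suc j)))"
      by (intro reaches_within_trans[OF _ iter]) auto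
    then show ?case by (simp only: mult_Suc add.commute)
  qed
  have exit: "reaches_within I 1 (?W, nat_update x 0 ?N (?F ?N)) (Skip, den I (For x b p) s)"
    by (intro reaches_within_step) (simp add: b nats_nat_update)
  have "reaches_within I 1 (NAssign x (NConst 0) (NConst 0), s) (Skip, nat_update x 0 0 s)"
    by (intro reaches_within_step) simp
  from reaches_within_Seq[OF this]
  have "reaches_within I (1 + 1) (compile (For x b p), s) (?W, nat_update x 0 0 s)" by simp
  from reaches_within_trans[OF reaches_within_trans[OF this loop[OF order.refl]] exit]
  show ?case by (simp add: algebra_simps)
qed

section \<open>Binary length of the numbers in memory\<close>

lemma poly_nat_mono: "x \<le> y \<Longrightarrow> poly (q :: nat poly) x \<le> poly q y"
  by (induction q) (auto intro: add_mono mult_mono)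

lemma rational_of_lengthI:
  "x = of_int a / of_int d \<Longrightarrow> \<bar>a\<bar> \<le> 2 ^ L \<Longrightarrow> 0 < d \<Longrightarrow> d \<le> 2 ^ L \<Longrightarrow> rational_of_length L x"
  unfolding rational_of_length_def by blast

lemma rational_of_lengthE:
  assumes "rational_of_length L x"
  obtains a d :: int where "x = of_int a / of_int d" "\<bar>a\<bar> \<le> 2 ^ L" "0 < d" "d \<le> 2 ^ L"
  using assms unfolding rational_of_length_def by blast

lemma rational_of_length_mono:
  assumes "rational_of_length L x" "L \<le> K"
  shows "rational_of_length K x"
proof -
  obtain a d :: int where x: "x = of_int a / of_int d" "\<bar>a\<bar> \<le> 2 ^ L" "0 < d" "d \<le> 2 ^ L"
    using assms(1) by (rule rational_of_lengthE)
  have "(2::int) ^ L \<le> 2 ^ K" using assms(2) by (intro power_increasing) auto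
  then show ?thesis using x(1,3) order_trans[OF x(2)] order_trans[OF x(4)]
    by (intro rational_of_lengthI[of x a d])
qed

lemma rational_of_length_0 [simp]: "rational_of_length L 0"
  by (rule rational_of_lengthI[of _ 0 1]) simp_all

lemma rational_of_length_nat:
  assumes "k \<le> 2 ^ L"
  shows "rational_of_length L (real k)"
proof -
  have "int k \<le> int (2 ^ L)" using assms by (simp only: of_nat_le_iff)
  then show ?thesis by (intro rational_of_lengthI[of _ "int k" 1]) simp_all
qed

lemma rational_of_length_uminus:
  assumes "rational_of_length L x"
  shows "rational_of_length L (- x)"
proof -
  obtain a d :: int where x: "x = of_int a / of_int d" "\<bar>a\<bar> \<le> 2 ^ L" "0 < d" "d \<le> 2 ^ L"
    using assms by (rule rational_of_lengthE)
  then show ?thesis by (intro rational_of_lengthI[of _ "- a" d]) simp_all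
qed

lemma rational_of_length_add:
  assumes "rational_of_length K x" "rational_of_length L y"
  shows "rational_of_length (K + L + 1) (x + y)"
proof -
  obtain a b d e :: int where x: "x = of_int a / of_int d" "\<bar>a\<bar> \<le> 2 ^ K" "0 < d" "d \<le> 2 ^ K"
    and y: "y = of_int b / of_int e" "\<bar>b\<bar> \<le> 2 ^ L" "0 < e" "e \<le> 2 ^ L"
    using assms unfolding rational_of_length_def by blast
  have eq: "x + y = of_int (a * e + b * d) / of_int (d * e)" using x y by (simp add: field_simps)
  have "\<bar>a * e\<bar> \<le> 2 ^ K * 2 ^ L" "\<bar>d * b\<bar> \<le> 2 ^ K * 2 ^ L"
    unfolding abs_mult using x y by (auto intro!: mult_mono)
  then have "\<bar>a * e + b * d\<bar> \<le> 2 * (2 ^ K * 2 ^ L)"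
    using abs_triangle_ineq[of "a * e" "b * d"] by (simp add: mult.commute[of b d])
  then have num: "\<bar>a * e + b * d\<bar> \<le> 2 ^ (K + L + 1)" by (simp add: power_add)
  have "d * e \<le> 2 ^ K * 2 ^ L" using x y by (intro mult_mono) auto
  moreover have "(0::int) \<le> 2 ^ K * 2 ^ L" by simp
  ultimately have "d * e \<le> 2 * (2 ^ K * 2 ^ L)" by linarith
  then have "d * e \<le> 2 ^ (K + L + 1)" by (simp add: power_add)
  with eq num show ?thesis using x y unfolding rational_of_length_def
    by (intro exI[of _ "a * e + b * d"] exI[of _ "d * e"]) simp
qed

lemma rational_of_length_mult:
  assumes "rational_of_length K x" "rational_of_length L y"
  shows "rational_of_length (K + L) (x * y)"
proof -
  obtain a b d e :: int where x: "x = of_int a / of_int d" "\<bar>a\<bar> \<le> 2 ^ K" "0 < d" "d \<le> 2 ^ K"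
    and y: "y = of_int b / of_int e" "\<bar>b\<bar> \<le> 2 ^ L" "0 < e" "e \<le> 2 ^ L"
    using assms unfolding rational_of_length_def by blast
  have "\<bar>a * b\<bar> \<le> 2 ^ K * 2 ^ L" unfolding abs_mult using x y by (auto intro!: mult_mono)
  moreover have "d * e \<le> 2 ^ K * 2 ^ L" using x y by (intro mult_mono) auto
  ultimately show ?thesis using x y unfolding rational_of_length_def
    by (intro exI[of _ "a * b"] exI[of _ "d * e"]) (simp add: power_add)
qed

lemma rational_of_length_inverse:
  assumes "rational_of_length L x"
  shows "rational_of_length L (inverse x)"
proof -
  obtain a d :: int where x: "x = of_int a / of_int d" "\<bar>a\<bar> \<le> 2 ^ L" "0 < d" "d \<le> 2 ^ L"
    using assms unfolding rational_of_length_def by blast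
  show ?thesis
  proof (cases "a = 0")
    case False
    have "inverse x = of_int (sgn a * d) / of_int \<bar>a\<bar>" using x(1,3) False by (cases "a > 0") simp_all
    then show ?thesis using x False unfolding rational_of_length_def
      by (intro exI[of _ "sgn a * d"] exI[of _ "\<bar>a\<bar>"]) (auto simp: abs_mult)
  qed (simp add: x)
qed

primrec nat_width :: "nexp \<Rightarrow> nat" where
  "nat_width (NConst k) = k"
| "nat_width GroundSize = 0"
| "nat_width (NCell x a) = 0"
| "nat_width (NAdd a b) = nat_width a + nat_width b + 1"
| "nat_width (NSub a b) = nat_width a"

lemma nval_le:
  assumes "ground_size I \<le> 2 ^ B" "\<And>x i. nats s x i \<le> 2 ^ B"
  shows "nval I s a \<le> 2 ^ (nat_width a + B)"
proof (induction a)
  case (NConst k)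
  have "k \<le> 2 ^ k" by (simp add: less_imp_le)
  also have "\<dots> \<le> 2 ^ (k + B)" by (intro power_increasing) auto
  finally show ?case by simp
next
  case (NAdd a b)
  have "(2::nat) ^ (nat_width a + B) \<le> 2 ^ (nat_width a + nat_width b + B)"
    "(2::nat) ^ (nat_width b + B) \<le> 2 ^ (nat_width a + nat_width b + B)"
    by (intro power_increasing; simp)+
  with NAdd have "nval I s a + nval I s b \<le> 2 ^ (nat_width a + nat_width b + B) + 2 ^ (nat_width a + nat_width b + B)"
    by (meson add_mono order_trans)
  then show ?case by simp
next
  case (NSub a b)
  then show ?case by simp
qed (use assms in auto)

primrec cell_free :: "rexp \<Rightarrow> bool" where
  "cell_free (OfNat a) \<longleftrightarrow> True"
| "cell_free (RCell x a) \<longleftrightarrow> False"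
| "cell_free (PEntry a b) \<longleftrightarrow> True"
| "cell_free (CEntry a b) \<longleftrightarrow> True"
| "cell_free (ValueQuery x) \<longleftrightarrow> True"
| "cell_free (RAdd a b) \<longleftrightarrow> cell_free a \<and> cell_free b"
| "cell_free (RSub a b) \<longleftrightarrow> cell_free a \<and> cell_free b"
| "cell_free (RMul a b) \<longleftrightarrow> cell_free a \<and> cell_free b"
| "cell_free (RDiv a b) \<longleftrightarrow> cell_free a \<and> cell_free b"

text \<open>Counts multiples of \<open>B + L + 1\<close>, with \<open>B\<close> bits in the natural
  cells and \<open>L\<close> bits in the input. Both operands contribute their lengths to a sum or
  product because denominators multiply; a sum needs one further bit.\<close>

primrec real_width :: "rexp \<Rightarrow> nat" where
  "real_width (OfNat a) = nat_width a + 1"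
| "real_width (RCell x a) = 1"
| "real_width (PEntry a b) = 1"
| "real_width (CEntry a b) = 1"
| "real_width (ValueQuery x) = 1"
| "real_width (RAdd a b) = real_width a + real_width b + 1"
| "real_width (RSub a b) = real_width a + real_width b + 1"
| "real_width (RMul a b) = real_width a + real_width b"
| "real_width (RDiv a b) = real_width a + real_width b"

lemma rval_length:
  assumes len: "input_of_length L I" and B: "ground_size I \<le> 2 ^ B" "\<And>x i. nats s x i \<le> 2 ^ B"
  shows "cell_free a \<Longrightarrow> rational_of_length (real_width a * (B + L + 1)) (rval I s a)"
proof (induction a)
  case (OfNat a)
  have "rational_of_length (nat_width a + B) (real (nval I s a))"
    by (intro rational_of_length_nat nval_le B)
  then have "rational_of_length (real_width (OfNat a) * (B + L + 1)) (real (nval I s a))"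
    by (rule rational_of_length_mono) (simp add: algebra_simps)
  then show ?case by simp
next
  case (PEntry a b)
  have "rational_of_length L (rval I s (PEntry a b))" using len
    by (simp add: read_entry_def input_of_length_def)
  then show ?case by (rule rational_of_length_mono) simp
next
  case (CEntry a b)
  have "rational_of_length L (rval I s (CEntry a b))" using len
    by (simp add: read_entry_def input_of_length_def)
  then show ?case by (rule rational_of_length_mono) simp
next
  case (ValueQuery x)
  have "set_of_array I s x \<subseteq> ground I" by (auto simp: set_of_array_def)
  then have "rational_of_length L (rval I s (ValueQuery x))" using len
    by (simp add: input_of_length_def)
  then show ?case by (rule rational_of_length_mono) simp
next
  case (RAdd a b)
  then have "rational_of_length (real_width a * (B + L + 1) + real_width b * (B + L + 1) + 1) (rval I s a + rval I s b)"
    by (intro rational_of_length_add) auto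
  then have "rational_of_length (real_width (RAdd a b) * (B + L + 1)) (rval I s a + rval I s b)"
    by (rule rational_of_length_mono) (simp add: algebra_simps)
  then show ?case by simp
next
  case (RSub a b)
  then have "rational_of_length (real_width a * (B + L + 1) + real_width b * (B + L + 1) + 1) (rval I s a + - rval I s b)"
    by (intro rational_of_length_add rational_of_length_uminus) auto
  then have "rational_of_length (real_width (RSub a b) * (B + L + 1)) (rval I s a + - rval I s b)"
    by (rule rational_of_length_mono) (simp add: algebra_simps)
  then show ?case by simp
next
  case (RMul a b)
  then have "rational_of_length (real_width a * (B + L + 1) + real_width b * (B + L + 1)) (rval I s a * rval I s b)"
    by (intro rational_of_length_mult) auto
  then show ?case by (simp only: real_width.simps rval.simps distrib_right)
next
  case (RDiv a b)
  then have "rational_of_length (real_width a * (B + L + 1) + real_width b * (B + L + 1)) (rval I s a * inverse (rval I s b))"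
    by (intro rational_of_length_mult rational_of_length_inverse) auto
  then show ?case by (simp only: real_width.simps rval.simps distrib_right divide_inverse)
qed simp

text \<open>The length bound rests on real cells being only overwritten by, or increased by, expressions
  that read no real cell. Hence lengths grow additively with the number of steps.\<close>

primrec summing :: "rexp \<Rightarrow> bool" where
  "summing (OfNat a) \<longleftrightarrow> True"
| "summing (RCell x a) \<longleftrightarrow> False"
| "summing (PEntry a b) \<longleftrightarrow> True"
| "summing (CEntry a b) \<longleftrightarrow> True"
| "summing (ValueQuery x) \<longleftrightarrow> True"
| "summing (RAdd a b) \<longleftrightarrow> (cell_free a \<or> (\<exists>x i. a = RCell x i)) \<and> cell_free b"
| "summing (RSub a b) \<longleftrightarrow> cell_free a \<and> cell_free b"
| "summing (RMul a b) \<longleftrightarrow> cell_free a \<and> cell_free b"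
| "summing (RDiv a b) \<longleftrightarrow> cell_free a \<and> cell_free b"

lemma summing_length:
  assumes len: "input_of_length L I" and B: "ground_size I \<le> 2 ^ B" "\<And>x i. nats s x i \<le> 2 ^ B"
    and R: "\<And>x i. rational_of_length R (reals s x i)" and a: "summing a"
  shows "rational_of_length (R + real_width a * (B + L + 1) + 1) (rval I s a)"
proof (cases "cell_free a")
  case True
  then show ?thesis by (intro rational_of_length_mono[OF rval_length[OF len B]]) auto
next
  case False
  then obtain x i b where a: "a = RAdd (RCell x i) b" "cell_free b" using a by (cases a) auto
  then have "rational_of_length (R + real_width b * (B + L + 1) + 1) (rval I s a)"
    using rational_of_length_add[OF R rval_length[OF len B, of b]] by simp
  then show ?thesis by (rule rational_of_length_mono) (simp add: a)
qed

text \<open>Execution rewrites the program, but what remains is built from pieces of the original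
  text, so bounds on its assignments are invariant.\<close>

primrec bounded_widths :: "nat \<Rightarrow> nat \<Rightarrow> com \<Rightarrow> bool" where
  "bounded_widths K W Skip \<longleftrightarrow> True"
| "bounded_widths K W (NAssign x i a) \<longleftrightarrow> nat_width a \<le> K"
| "bounded_widths K W (RAssign x i a) \<longleftrightarrow> summing a \<and> real_width a \<le> W"
| "bounded_widths K W (CoinFlip x i) \<longleftrightarrow> False"
| "bounded_widths K W (Seq c d) \<longleftrightarrow> bounded_widths K W c \<and> bounded_widths K W d"
| "bounded_widths K W (Cond b c d) \<longleftrightarrow> bounded_widths K W c \<and> bounded_widths K W d"
| "bounded_widths K W (While b c) \<longleftrightarrow> bounded_widths K W c"

lemma bounded_widths_mono:
  "bounded_widths K W c \<Longrightarrow> K \<le> K' \<Longrightarrow> W \<le> W' \<Longrightarrow> bounded_widths K' W' c"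
  by (induction c) auto

lemma bounded_widths_dstep:
  assumes len: "input_of_length L I" and B: "ground_size I \<le> 2 ^ B" "\<And>x i. nats s x i \<le> 2 ^ B"
    and R: "\<And>x i. rational_of_length R (reals s x i)"
  shows "bounded_widths K W c \<Longrightarrow> dstep I (c, s) = (c', s') \<Longrightarrow>
    bounded_widths K W c' \<and> (\<forall>x i. nats s' x i \<le> 2 ^ (B + K)) \<and>
    (\<forall>x i. rational_of_length (R + W * (B + L + 1) + 1) (reals s' x i))"
proof -
  have keep_nat: "nats s x i \<le> 2 ^ (B + K)" for x i
    using B(2)[of x i] power_increasing[of B "B + K" "2::nat"] by (rule order_trans) simp_all
  have keep_real: "rational_of_length (R + W * (B + L + 1) + 1) (reals s x i)" for x i
    using R by (rule rational_of_length_mono) simp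
  show "bounded_widths K W c \<Longrightarrow> dstep I (c, s) = (c', s') \<Longrightarrow>
    bounded_widths K W c' \<and> (\<forall>x i. nats s' x i \<le> 2 ^ (B + K)) \<and>
    (\<forall>x i. rational_of_length (R + W * (B + L + 1) + 1) (reals s' x i))"
  proof (induction c arbitrary: c' s')
    case Skip
    then show ?case using keep_nat keep_real by simp
  next
    case (NAssign x i a)
    have "nval I s a \<le> 2 ^ (nat_width a + B)" using nval_le B by blast
    also have "\<dots> \<le> 2 ^ (B + K)" using NAssign by (intro power_increasing) auto
    finally have v: "nval I s a \<le> 2 ^ (B + K)" .
    have s': "c' = Skip" "s' = nat_update x (nval I s i) (nval I s a) s" using NAssign by auto
    show ?case unfolding s' using v keep_nat keep_real by (simp add: nats_nat_update)
  next
    case (RAssign x i a)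
    have "rational_of_length (R + real_width a * (B + L + 1) + 1) (rval I s a)"
      using summing_length[OF len B R] RAssign by simp
    moreover have "R + real_width a * (B + L + 1) + 1 \<le> R + W * (B + L + 1) + 1"
      using RAssign by (intro add_mono mult_le_mono) auto
    ultimately have v: "rational_of_length (R + W * (B + L + 1) + 1) (rval I s a)"
      by (rule rational_of_length_mono)
    have s': "c' = Skip" "s' = real_update x (nval I s i) (rval I s a) s" using RAssign by auto
    show ?case unfolding s' using v keep_nat keep_real by (simp add: reals_real_update)
  next
    case (CoinFlip x i)
    then show ?case by simp
  next
    case (Seq c d)
    show ?case
    proof (cases "c = Skip")
      case True
      then have "c' = d" "s' = s" using Seq.prems by auto
      then show ?thesis using Seq.prems keep_nat keep_real by simp
    next
      case False
      obtain c1 s1 where cs: "dstep I (c, s) = (c1, s1)" by fastforce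
      then have "c' = Seq c1 d" "s' = s1" using Seq.prems(2) False by auto
      moreover have "bounded_widths K W c" "bounded_widths K W d" using Seq.prems(1) by simp_all
      ultimately show ?thesis using Seq.IH(1)[OF \<open>bounded_widths K W c\<close> cs] by (simp only: bounded_widths.simps simp_thms)
    qed
  next
    case (Cond b c d)
    have "c' = c \<or> c' = d" "s' = s" using Cond.prems(2) by (auto split: if_splits)
    then show ?case using Cond.prems(1) keep_nat keep_real by auto
  next
    case (While b c)
    have "c' = Seq c (While b c) \<or> c' = Skip" "s' = s" using While.prems(2) by (auto split: if_splits)
    then show ?case using While.prems(1) keep_nat keep_real by auto
  qed
qed

text \<open>A step adds at most \<open>K\<close> bits to naturals and
  \<open>W * (B + L + 1) + 1\<close> bits to reals, where \<open>B\<close> has itself grown to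
  \<open>ground_size I + K * t\<close>. The total is quadratic in the number of steps.\<close>

lemma memory_bound:
  assumes len: "input_of_length L I" and c: "bounded_widths K W c"
  shows "bounded_widths K W (fst ((dstep I ^^ t) (c, init_state))) \<and>
    (\<forall>x i. nats (snd ((dstep I ^^ t) (c, init_state))) x i \<le> 2 ^ (ground_size I + K * t)) \<and>
    (\<forall>x i. rational_of_length (t * (W * (ground_size I + K * t + L + 1) + 1))
      (reals (snd ((dstep I ^^ t) (c, init_state))) x i))"
proof (induction t)
  case 0
  then show ?case using c by (simp add: init_state_def)
next
  case (Suc t)
  let ?n = "ground_size I"
  let ?B = "?n + K * t"
  obtain d s where ds: "(dstep I ^^ t) (c, init_state) = (d, s)" by fastforce
  obtain d' s' where ds': "dstep I (d, s) = (d', s')" by fastforce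
  have n: "?n \<le> 2 ^ ?B"
  proof -
    have "?n \<le> 2 ^ ?n" by (simp add: less_imp_le)
    also have "\<dots> \<le> 2 ^ ?B" by (intro power_increasing) auto
    finally show ?thesis .
  qed
  have step: "bounded_widths K W d' \<and> (\<forall>x i. nats s' x i \<le> 2 ^ (?B + K)) \<and>
    (\<forall>x i. rational_of_length (t * (W * (?B + L + 1) + 1) + W * (?B + L + 1) + 1) (reals s' x i))"
    using Suc ds by (intro bounded_widths_dstep[OF len n _ _ _ ds']) auto
  have le: "t * (W * (?B + L + 1) + 1) + W * (?B + L + 1) + 1 \<le> Suc t * (W * (?n + K * Suc t + L + 1) + 1)"
  proof -
    have "t * (W * (?B + L + 1) + 1) + W * (?B + L + 1) + 1 = Suc t * (W * (?B + L + 1) + 1)" by simp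
    also have "\<dots> \<le> Suc t * (W * (?n + K * Suc t + L + 1) + 1)" by (intro mult_le_mono add_mono) auto
    finally show ?thesis .
  qed
  have B: "?B + K = ?n + K * Suc t" by simp
  have st: "(dstep I ^^ Suc t) (c, init_state) = (d', s')" using ds ds' by simp
  have "rational_of_length (Suc t * (W * (?n + K * Suc t + L + 1) + 1)) (reals s' x i)" for x i
    using step le by (blast intro: rational_of_length_mono)
  then show ?case using step unfolding st fst_conv snd_conv B by blast
qed

primrec accumulating :: "prog \<Rightarrow> bool" where
  "accumulating Nop \<longleftrightarrow> True"
| "accumulating (NSet x i a) \<longleftrightarrow> True"
| "accumulating (RSet x i a) \<longleftrightarrow> summing a"
| "accumulating (Block p q) \<longleftrightarrow> accumulating p \<and> accumulating q"
| "accumulating (Branch b p q) \<longleftrightarrow> accumulating p \<and> accumulating q"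
| "accumulating (For x b p) \<longleftrightarrow> accumulating p"

lemma accumulating_bounded_widths: "accumulating p \<Longrightarrow> \<exists>K W. bounded_widths K W (compile p)"
proof (induction p)
  case (Block p q)
  then obtain K W K' W' where "bounded_widths K W (compile p)" "bounded_widths K' W' (compile q)" by auto
  then show ?case
    by (intro exI[of _ "max K K'"] exI[of _ "max W W'"]) (auto intro: bounded_widths_mono)
next
  case (Branch b p q)
  then obtain K W K' W' where "bounded_widths K W (compile p)" "bounded_widths K' W' (compile q)" by auto
  then show ?case
    by (intro exI[of _ "max K K'"] exI[of _ "max W W'"]) (auto intro: bounded_widths_mono)
next
  case (For x b p)
  then obtain K W where "bounded_widths K W (compile p)" by auto
  then show ?case
    by (intro exI[of _ "max K 2"] exI[of _ "W"]) (auto intro: bounded_widths_mono)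
qed auto

lemma compile_polynomial:
  assumes "well_formed p" "accumulating p"
  shows "\<exists>time space. \<forall>I. halts_within I (compile p) (poly time (ground_size I)) \<and>
    (\<forall>L. input_of_length L I \<longrightarrow> memory_of_length (poly space (ground_size I + L)) I (compile p)) \<and>
    output_after I (compile p) (poly time (ground_size I)) =
      return_pmf (set_of_array I (den I p init_state) ''output'')"
proof -
  obtain K W where KW: "bounded_widths K W (compile p)" using accumulating_bounded_widths assms(2) by blast
  define time where "time = time_of p"
  define space where "space = time * ([:W:] * ([:1, 1:] + [:K:] * time) + 1)"
  note run = run_coin_free[OF coin_free_compile, of _ p]
  have stop: "(dstep I ^^ t) (compile p, init_state) = (Skip, den I p init_state)"
    if "poly time (ground_size I) \<le> t" for t I
  proof -
    obtain k where k: "k \<le> poly time (ground_size I)"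
      "(dstep I ^^ k) (compile p, init_state) = (Skip, den I p init_state)"
      using compile_correct[OF assms(1), of I init_state] unfolding reaches_within_def time_def by auto
    have "(dstep I ^^ ((t - k) + k)) (compile p, init_state) = (Skip, den I p init_state)"
      unfolding funpow_add using k(2) by (simp add: funpow_dstep_Skip)
    then show ?thesis using k(1) that by simp
  qed
  have "memory_of_length (poly space (ground_size I + L)) I (compile p)" if len: "input_of_length L I" for I L
    unfolding memory_of_length_def run
  proof (simp add: case_prod_beta, intro allI)
    fix t x i
    let ?n = "ground_size I"
    define T where "T = poly time ?n"
    \<comment> \<open>After halting the memory is stationary, so times beyond \<open>T\<close> need
      no larger bound.\<close>
    define u where "u = min t T"
    have u: "(dstep I ^^ t) (compile p, init_state) = (dstep I ^^ u) (compile p, init_state)"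
    proof (cases "t \<le> T")
      case False
      then have "u = T" "T \<le> t" by (auto simp: u_def)
      then show ?thesis using stop[of I t] stop[of I T] by (simp add: T_def)
    qed (simp add: u_def)
    have "rational_of_length (u * (W * (?n + K * u + L + 1) + 1))
        (reals (snd ((dstep I ^^ u) (compile p, init_state))) x i)"
      using memory_bound[OF len KW] by blast
    moreover have "u * (W * (?n + K * u + L + 1) + 1) \<le> poly space (?n + L)"
    proof -
      \<comment> \<open>\<open>time\<close> is evaluated at \<open>?n + L\<close> so that a single
        polynomial in this sum results; natural coefficients make it monotone.\<close>
      define T' where "T' = poly time (?n + L)"
      have "u \<le> T'" using poly_nat_mono[of ?n "?n + L" time] by (simp add: u_def T_def T'_def)
      then have "u * (W * (?n + K * u + L + 1) + 1) \<le> T' * (W * (?n + K * T' + L + 1) + 1)"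
        by (intro mult_le_mono add_mono) auto
      also have "\<dots> = poly space (?n + L)" by (simp add: space_def T'_def algebra_simps)
      finally show ?thesis .
    qed
    ultimately show "rational_of_length (poly space (?n + L))
        (reals (snd ((dstep I ^^ t) (compile p, init_state))) x i)"
      unfolding u by (rule rational_of_length_mono)
  qed
  moreover have "halts_within I (compile p) (poly time (ground_size I))" for I
    unfolding halts_within_def run using stop by simp
  moreover have "output_after I (compile p) (poly time (ground_size I)) =
      return_pmf (set_of_array I (den I p init_state) ''output'')" for I
    unfolding output_after_def run using stop by simp
  ultimately show ?thesis by blast
qed

section \<open>The local search program\<close>

definition blocks :: "prog list \<Rightarrow> prog" where
  "blocks ps = foldr Block ps Nop"

lemma den_blocks: "den I (blocks ps) s = fold (den I) ps s"
  by (induction ps arbitrary: s) (simp_all add: blocks_def)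

lemma blocks_simps [simp]:
  "nats_of (blocks ps) = (\<Union>p\<in>set ps. nats_of p)"
  "reals_of (blocks ps) = (\<Union>p\<in>set ps. reals_of p)"
  "well_formed (blocks ps) \<longleftrightarrow> (\<forall>p\<in>set ps. well_formed p)"
  "accumulating (blocks ps) \<longleftrightarrow> (\<forall>p\<in>set ps. accumulating p)"
  by (induction ps) (simp_all add: blocks_def)

definition scalar :: "string \<Rightarrow> nexp" where
  "scalar x = NCell x (NConst 0)"

lemma nval_scalar [simp]: "nval I s (scalar x) = nats s x 0"
  by (simp add: scalar_def)

definition real_const :: "nat \<Rightarrow> rexp" where
  "real_const k = OfNat (NConst k)"

lemma rval_real_const [simp]: "rval I s (real_const k) = real k"
  by (simp add: real_const_def)

lemma real_const_simps [simp]: "cell_free (real_const k)" "summing (real_const k)"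
  by (simp_all add: real_const_def)

definition sum_exp :: "rexp list \<Rightarrow> rexp" where
  "sum_exp es = foldr RAdd es (real_const 0)"

lemma rval_sum_exp [simp]: "rval I s (sum_exp es) = (\<Sum>e\<leftarrow>es. rval I s e)"
  by (induction es) (simp_all add: sum_exp_def)

definition conj_exp :: "bexp list \<Rightarrow> bexp" where
  "conj_exp bs = foldr BAnd bs (NLess (NConst 0) (NConst 1))"

lemma bval_conj_exp [simp]: "bval I s (conj_exp bs) \<longleftrightarrow> (\<forall>b\<in>set bs. bval I s b)"
  by (induction bs) (simp_all add: conj_exp_def)

primrec times_nexp :: "nat \<Rightarrow> nexp \<Rightarrow> nexp" where
  "times_nexp 0 a = NConst 0"
| "times_nexp (Suc k) a = NAdd a (times_nexp k a)"

lemma times_nexp_simps [simp]: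
  "nval I s (times_nexp k a) = k * nval I s a" "closed_nexp a \<Longrightarrow> closed_nexp (times_nexp k a)"
  by (induction k) simp_all

lemma den_set_cells:
  "nats (den I (blocks (map (\<lambda>r. NSet z (NConst r) (NConst (h r))) [0..<k])) s) z =
    (\<lambda>r. if r < k then h r else nats s z r)"
proof (induction k)
  case (Suc k)
  then show ?case by (auto simp: den_blocks nats_nat_update fun_eq_iff less_Suc_eq)
qed (simp add: den_blocks)

lemma den_flag_cells:
  assumes "\<And>t i. reals t = reals s \<Longrightarrow> i < k \<Longrightarrow> rval I t (e i) = h i"
  shows "i < k \<Longrightarrow> nats (den I (blocks (map (\<lambda>i. Branch (RLess (real_const 0) (e i))
      (NSet y (NConst i) (NConst 1)) (NSet y (NConst i) (NConst 0))) [0..<k])) s) y i = of_bool (0 < h i)"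
proof -
  let ?p = "\<lambda>i. Branch (RLess (real_const 0) (e i)) (NSet y (NConst i) (NConst 1)) (NSet y (NConst i) (NConst 0))"
  have "j \<le> k \<Longrightarrow> reals (fold (den I) (map ?p [0..<j]) s) = reals s \<and>
    (\<forall>i<j. nats (fold (den I) (map ?p [0..<j]) s) y i = of_bool (0 < h i))" for j
  proof (induction j)
    case (Suc j)
    then have IH: "reals (fold (den I) (map ?p [0..<j]) s) = reals s"
      "\<forall>i<j. nats (fold (den I) (map ?p [0..<j]) s) y i = of_bool (0 < h i)" by auto
    have "rval I (fold (den I) (map ?p [0..<j]) s) (e j) = h j" using assms[OF IH(1)] Suc.prems by simp
    then show ?case using IH by (auto simp: nats_nat_update less_Suc_eq)
  qed simp
  then show "i < k \<Longrightarrow> nats (den I (blocks (map ?p [0..<k])) s) y i = of_bool (0 < h i)"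
    by (simp add: den_blocks)
qed

lemma den_zero_cells:
  "i < k \<Longrightarrow> reals (den I (blocks (map (\<lambda>i. RSet y (NConst (Suc i)) (real_const 0)) [0..<k])) s) y (Suc i) = 0"
proof (induction k)
  case (Suc k)
  then show ?case by (auto simp: den_blocks reals_real_update less_Suc_eq)
qed simp

lemma den_add_cells:
  fixes y :: string and e :: "nat \<Rightarrow> rexp"
  assumes "\<And>t i. nats t = nats s \<Longrightarrow> rval I t (e i) = h i"
  defines "p \<equiv> \<lambda>k. blocks (map (\<lambda>i. RSet y (NConst (Suc i)) (RAdd (RCell y (NConst (Suc i))) (e i))) [0..<k])"
  shows "nats (den I (p k) s) = nats s \<and> (\<forall>i. reals (den I (p k) s) y (Suc i) = reals s y (Suc i) + (if i < k then h i else 0))"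
proof (induction k)
  case (Suc k)
  have "rval I (den I (p k) s) (e k) = h k" using Suc assms(1) by blast
  then show ?case using Suc unfolding p_def den_blocks
    by (auto simp: reals_real_update less_Suc_eq)
qed (simp add: p_def den_blocks)

lemma den_For_set:
  assumes "z \<noteq> x"
    and "\<And>t i. i < nval I s b \<Longrightarrow> (\<And>w. w \<noteq> z \<Longrightarrow> w \<noteq> x \<Longrightarrow> nats t w = nats s w) \<Longrightarrow> nats t x 0 = i \<Longrightarrow> nval I t a = h i"
  shows "nats (den I (For x b (NSet z (scalar x) a)) s) z = (\<lambda>i. if i < nval I s b then h i else nats s z i)"
proof -
  let ?P = "\<lambda>j (t :: state). j \<le> nval I s b \<longrightarrow> (\<forall>w. w \<noteq> z \<longrightarrow> w \<noteq> x \<longrightarrow> nats t w = nats s w) \<and>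
    nats t z = (\<lambda>i. if i < j then h i else nats s z i)"
  have "?P (nval I s b) (fold (\<lambda>i s. den I (NSet z (scalar x) a) (nat_update x 0 i s)) [0..<nval I s b] s)"
  proof (rule fold_invariant_upt[where P = ?P])
    fix j t assume j: "j < nval I s b" and P: "?P j t"
    have "nval I (nat_update x 0 j t) a = h j"
      using P j assms(1) by (intro assms(2)) (auto simp: nats_nat_update)
    then show "?P (Suc j) (den I (NSet z (scalar x) a) (nat_update x 0 j t))"
      using P j assms(1) by (auto simp: nats_nat_update fun_eq_iff less_Suc_eq)
  qed auto
  then show ?thesis using assms(1) by (simp add: nats_nat_update)
qed

definition clear_prog :: "string \<Rightarrow> prog" where
  "clear_prog z = For ''i'' GroundSize (NSet z (scalar ''i'') (NConst 0))"

definition copy_prog :: "string \<Rightarrow> string \<Rightarrow> prog" where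
  "copy_prog x z = For ''i'' GroundSize (NSet z (scalar ''i'') (NCell x (scalar ''i'')))"

lemma den_clear_prog:
  "z \<noteq> ''i'' \<Longrightarrow> nats (den I (clear_prog z) s) z = (\<lambda>i. if i < ground_size I then 0 else nats s z i)"
  unfolding clear_prog_def by (subst den_For_set[where h = "\<lambda>_. 0"]) auto

lemma den_copy_prog:
  "z \<noteq> ''i'' \<Longrightarrow> x \<noteq> ''i'' \<Longrightarrow> x \<noteq> z \<Longrightarrow>
    nats (den I (copy_prog x z) s) z = (\<lambda>i. if i < ground_size I then nats s x i else nats s z i)"
  unfolding copy_prog_def by (subst den_For_set[where h = "nats s x"]) auto

lemma clear_copy_simps [simp]:
  "nats_of (clear_prog z) = {''i'', z}" "reals_of (clear_prog z) = {}" "accumulating (clear_prog z)"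
  "nats_of (copy_prog x z) = {''i'', z}" "reals_of (copy_prog x z) = {}" "accumulating (copy_prog x z)"
  "well_formed (clear_prog z) \<longleftrightarrow> z \<noteq> ''i''" "well_formed (copy_prog x z) \<longleftrightarrow> z \<noteq> ''i''"
  by (auto simp: clear_prog_def copy_prog_def)

text \<open>Arrays of naturals: \<open>a\<close> is the guessed set, \<open>s\<close> and \<open>t\<close> the current and the tentative layer
  assignment, \<open>jj\<close> the characteristic function of a set of layers, \<open>u\<close> the query set. The value
  of the guess of the optimum is \<open>j / m\<close> times the value of the singleton \<open>one\<close>. The arrays \<open>S\<close>
  and \<open>T\<close> hold the evaluation of \<open>s\<close> and \<open>t\<close> and \<open>A\<close> that of the guess: cell \<open>0\<close> is the layered
  value, cell \<open>Suc i\<close> the load of constraint \<open>i\<close>, the packing constraints coming first; the naturals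
  of the same name flag the violated constraints.\<close>

locale program =
  fixes p c m \<nu> \<kappa> :: nat
  assumes m_pos: "1 \<le> m" and nu_pos: "1 \<le> \<nu>"
begin

definition guess_exp :: rexp where
  "guess_exp = RDiv (RMul (OfNat (scalar ''j'')) (ValueQuery ''one'')) (real_const m)"

definition layers_prog :: "nat list \<Rightarrow> prog" where
  "layers_prog J = blocks (map (\<lambda>r. NSet ''jj'' (NConst r) (NConst (of_bool (r \<in> set J)))) [0..<Suc \<nu>])"

text \<open>\<open>jj\<close> is indexed by the layer of the element. The addition acts as a
  disjunction: the sum is nonzero iff the layer is selected or the element is guessed.\<close>

definition union_prog :: "string \<Rightarrow> prog" where
  "union_prog x = For ''i'' GroundSize (NSet ''u'' (scalar ''i'')
     (NAdd (NCell ''jj'' (NCell x (scalar ''i''))) (NCell ''a'' (scalar ''i''))))"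

definition weight_exp :: "nat \<Rightarrow> rexp" where
  "weight_exp k = RDiv (real_const ((\<nu> + 1) ^ k * \<nu> ^ (\<nu> + 1)))
     (real_const (\<nu> ^ k * (\<nu> + 1) ^ (\<nu> + 1) * k * (\<nu> choose k)))"

definition add_value_prog :: "string \<Rightarrow> nat \<Rightarrow> prog" where
  "add_value_prog y k = Branch (RLess (ValueQuery ''u'') guess_exp)
     (RSet y (NConst 0) (RAdd (RCell y (NConst 0)) (RMul (weight_exp k) (RDiv (ValueQuery ''u'') guess_exp))))
     (RSet y (NConst 0) (RAdd (RCell y (NConst 0)) (weight_exp k)))"

text \<open>The sets of layers are unrolled into the program text, whose length is exponential in
  the constant \<open>\<nu>\<close> but independent of the input.\<close>

definition value_prog :: "string \<Rightarrow> string \<Rightarrow> prog" where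
  "value_prog x y = Block (RSet y (NConst 0) (real_const 0))
     (blocks (map (\<lambda>J. Block (layers_prog J) (Block (union_prog x) (add_value_prog y (length J))))
       (subseqs [1..<Suc \<nu>])))"

definition entry_exp :: "string \<Rightarrow> nat \<Rightarrow> rexp" where
  "entry_exp z i = (if i < p then PEntry (NConst i) (scalar z) else CEntry (NConst (i - p)) (scalar z))"

definition load_prog :: "string \<Rightarrow> prog" where
  "load_prog y = Block (blocks (map (\<lambda>i. RSet y (NConst (Suc i)) (real_const 0)) [0..<p + c]))
     (For ''i'' GroundSize (Branch (NLess (NConst 0) (NCell ''u'' (scalar ''i'')))
       (blocks (map (\<lambda>i. RSet y (NConst (Suc i)) (RAdd (RCell y (NConst (Suc i))) (entry_exp ''i'' i))) [0..<p + c]))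
       Nop))"

definition load_exp :: "string \<Rightarrow> nat \<Rightarrow> rexp" where
  "load_exp y i = RCell y (NConst (Suc i))"

definition violation_exp :: "string \<Rightarrow> nat \<Rightarrow> rexp" where
  "violation_exp y i = (if i < p
     then RSub (RDiv (RSub (load_exp y i) (load_exp ''A'' i)) (RSub (real_const 1) (load_exp ''A'' i)))
       (RSub (real_const 1) (RDiv (real_const 1) (real_const m)))
     else RSub (RSub (real_const 1) (RDiv (real_const 2) (real_const m))) (load_exp y i))"

text \<open>Expressions cannot branch, so the positive part is realised by a stored 0/1 flag that
  multiplies the square in \<open>potential_exp\<close>.\<close>

definition flag_prog :: "string \<Rightarrow> prog" where
  "flag_prog y = blocks (map (\<lambda>i. Branch (RLess (real_const 0) (violation_exp y i))
     (NSet y (NConst i) (NConst 1)) (NSet y (NConst i) (NConst 0))) [0..<p + c])"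

definition eval_prog :: "string \<Rightarrow> string \<Rightarrow> prog" where
  "eval_prog x y = Block (value_prog x y) (Block (layers_prog [1..<Suc \<nu>])
     (Block (union_prog x) (Block (load_prog y) (flag_prog y))))"

text \<open>Used in comparisons only. Its value is never stored, so the products of real cells do
  not lengthen the memory.\<close>

definition potential_exp :: "string \<Rightarrow> rexp" where
  "potential_exp y = RSub (RCell y (NConst 0)) (RMul (real_const (4 * m ^ 2))
     (sum_exp (map (\<lambda>i. RMul (OfNat (NCell y (NConst i))) (RMul (violation_exp y i) (violation_exp y i))) [0..<p + c])))"

definition admissible_exp :: bexp where
  "admissible_exp = conj_exp (map (\<lambda>i. if i < p
     then BNot (RLess (RSub (real_const 1) (load_exp ''A'' i)) (RMul (entry_exp ''y'' i) (real_const (coarse_scale m (p + c)))))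
     else BNot (BAnd (RLess (load_exp ''A'' i) (real_const 1))
       (RLess (real_const 1) (RMul (entry_exp ''y'' i) (real_const (fine_scale m p c)))))) [0..<p + c])"

definition threshold_exp :: rexp where
  "threshold_exp = RDiv (real_const 1) (RMul (real_const (2 * m)) (OfNat (NAdd GroundSize (NConst 1))))"

text \<open>Evaluating \<open>t\<close> last leaves the tentative set in \<open>u\<close>, to which
  the independence query refers. The dummy is the cell with index \<open>GroundSize\<close>, which
  no query sees.\<close>

definition move_prog :: prog where
  "move_prog = Block (copy_prog ''s'' ''t'') (Block (NSet ''t'' (scalar ''x'') (NConst 0))
     (Block (NSet ''t'' (scalar ''y'') (scalar ''l''))
     (Block (eval_prog ''s'' ''S'') (Block (eval_prog ''t'' ''T'')
     (Branch (BAnd (IndepQuery ''u'') (BAnd admissible_exp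
         (RLess (RAdd (potential_exp ''S'') threshold_exp) (potential_exp ''T''))))
       (copy_prog ''t'' ''s'') Nop)))))"

text \<open>The potential starts no lower than \<open>- 4 * m\<^sup>2 * c\<close> and never exceeds
  \<open>\<nu>\<close>, and a pass that changes anything gains more than
  \<open>1 / (2 * m * (n + 1))\<close>. The factor \<open>n + 1\<close> is supplied by
  \<open>search_prog\<close>.\<close>

definition passes :: nat where
  "passes = (\<nu> + 4 * m ^ 2 * c) * (2 * m)"

definition search_prog :: prog where
  "search_prog = For ''pass'' (NAdd (times_nexp passes (NAdd GroundSize (NConst 1))) (NConst 1))
     (For ''x'' (NAdd GroundSize (NConst 1)) (For ''y'' (NAdd GroundSize (NConst 1))
       (For ''l'' (NConst (Suc \<nu>)) move_prog)))"

definition guess_var :: "nat \<Rightarrow> string" where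
  "guess_var k = replicate (Suc k) (CHR ''g'')"

definition prepare_prog :: prog where
  "prepare_prog = Block (clear_prog ''a'') (Block (blocks (map (\<lambda>k. NSet ''a'' (scalar (guess_var k)) (NConst 1)) [0..<\<kappa>]))
     (Block (clear_prog ''one'') (Block (NSet ''one'' (scalar ''e'') (NConst 1)) (Block (clear_prog ''s'')
     (Block (layers_prog []) (Block (union_prog ''s'') (load_prog ''A'')))))))"

definition feasible_exp :: bexp where
  "feasible_exp = BAnd (IndepQuery ''u'') (conj_exp (map (\<lambda>i. if i < p
     then BNot (RLess (real_const 1) (load_exp ''S'' i))
     else BNot (RLess (load_exp ''S'' i) (RSub (real_const 1) (RDiv (real_const 3) (real_const m))))) [0..<p + c]))"

text \<open>The flag \<open>found\<close> distinguishes the initial empty output, which may be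
  infeasible, from a set that has passed the test.\<close>

definition finish_prog :: prog where
  "finish_prog = Branch (BAnd feasible_exp (BNot (BAnd (NLess (NConst 0) (scalar ''found''))
       (BNot (RLess (ValueQuery ''output'') (ValueQuery ''u''))))))
     (Block (copy_prog ''u'' ''output'') (NSet ''found'' (NConst 0) (NConst 1))) Nop"

definition trial_prog :: prog where
  "trial_prog = Block prepare_prog (Block search_prog (Block (eval_prog ''s'' ''S'') finish_prog))"

text \<open>\<open>\<kappa>\<close> is a constant, so the nest of loops over all guesses stays
  polynomial.\<close>

primrec guess_loops :: "nat \<Rightarrow> prog \<Rightarrow> prog" where
  "guess_loops 0 q = q"
| "guess_loops (Suc k) q = guess_loops k (For (guess_var k) (NAdd GroundSize (NConst 1)) q)"

definition main_prog :: prog where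
  "main_prog = guess_loops \<kappa> (For ''e'' (NAdd GroundSize (NConst 1))
     (For ''j'' (NAdd (times_nexp m (NAdd GroundSize (NConst 1))) (NConst 1)) trial_prog))"

lemmas prog_defs = layers_prog_def union_prog_def add_value_prog_def value_prog_def load_prog_def flag_prog_def eval_prog_def

lemma eval_frame:
  "nats_of (union_prog x) = {''i'', ''u''}" "nats_of (layers_prog J) = {''jj''}" "nats_of (add_value_prog y k) = {}"
  "nats_of (value_prog x y) \<subseteq> {''i'', ''jj'', ''u''}" "nats_of (load_prog y) \<subseteq> {''i''}" "nats_of (flag_prog y) \<subseteq> {y}"
  "nats_of (eval_prog x y) \<subseteq> {''i'', ''jj'', ''u'', y}"
  "reals_of (union_prog x) = {}" "reals_of (layers_prog J) = {}" "reals_of (add_value_prog y k) = {y}"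
  "reals_of (value_prog x y) = {y}" "reals_of (load_prog y) \<subseteq> {y}" "reals_of (flag_prog y) = {}"
  "reals_of (eval_prog x y) = {y}"
  by (auto simp: prog_defs)

lemma guess_var_neqs [simp]:
  "guess_var k \<noteq> ''i''" "guess_var k \<noteq> ''a''" "guess_var k \<noteq> ''s''" "guess_var k \<noteq> ''t''" "guess_var k \<noteq> ''u''"
  "guess_var k \<noteq> ''jj''" "guess_var k \<noteq> ''one''" "guess_var k \<noteq> ''e''" "guess_var k \<noteq> ''j''" "guess_var k \<noteq> ''x''"
  "guess_var k \<noteq> ''y''" "guess_var k \<noteq> ''l''" "guess_var k \<noteq> ''pass''" "guess_var k \<noteq> ''found''" "guess_var k \<noteq> ''output''"
  "guess_var k \<noteq> ''S''" "guess_var k \<noteq> ''T''"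
  by (auto simp: guess_var_def)

lemma guess_var_inj [simp]: "guess_var k = guess_var l \<longleftrightarrow> k = l"
proof
  assume "guess_var k = guess_var l"
  then have "length (guess_var k) = length (guess_var l)" by simp
  then show "k = l" by (simp add: guess_var_def)
qed simp

lemma move_frame:
  "nats_of move_prog \<subseteq> {''i'', ''s'', ''t'', ''u'', ''jj'', ''S'', ''T''}" "reals_of move_prog \<subseteq> {''S'', ''T''}"
proof -
  have "nats_of (eval_prog ''s'' ''S'') \<subseteq> {''i'', ''s'', ''t'', ''u'', ''jj'', ''S'', ''T''}"
    "nats_of (eval_prog ''t'' ''T'') \<subseteq> {''i'', ''s'', ''t'', ''u'', ''jj'', ''S'', ''T''}"
    by (rule order_trans[OF eval_frame(7)], simp)+
  then show "nats_of move_prog \<subseteq> {''i'', ''s'', ''t'', ''u'', ''jj'', ''S'', ''T''}" by (simp add: move_prog_def)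
  show "reals_of move_prog \<subseteq> {''S'', ''T''}" by (simp add: move_prog_def eval_frame)
qed

lemma search_frame:
  "nats_of search_prog \<subseteq> {''pass'', ''x'', ''y'', ''l'', ''i'', ''s'', ''t'', ''u'', ''jj'', ''S'', ''T''}"
  "reals_of search_prog \<subseteq> {''S'', ''T''}"
proof -
  have "nats_of move_prog \<subseteq> {''pass'', ''x'', ''y'', ''l'', ''i'', ''s'', ''t'', ''u'', ''jj'', ''S'', ''T''}"
    by (rule order_trans[OF move_frame(1)]) simp
  then show "nats_of search_prog \<subseteq> {''pass'', ''x'', ''y'', ''l'', ''i'', ''s'', ''t'', ''u'', ''jj'', ''S'', ''T''}"
    by (simp add: search_prog_def)
  show "reals_of search_prog \<subseteq> {''S'', ''T''}" using move_frame(2) by (simp add: search_prog_def)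
qed

lemma trial_frame:
  "nats_of trial_prog \<subseteq> {''pass'', ''x'', ''y'', ''l'', ''i'', ''s'', ''t'', ''u'', ''jj'', ''S'', ''T'', ''a'', ''one'', ''found'', ''output''}"
  (is "_ \<subseteq> ?V")
proof -
  have "nats_of search_prog \<subseteq> ?V" by (rule order_trans[OF search_frame(1)]) simp
  moreover have "nats_of (eval_prog ''s'' ''S'') \<subseteq> ?V" by (rule order_trans[OF eval_frame(7)]) simp
  moreover have "nats_of (load_prog ''A'') \<subseteq> ?V" by (rule order_trans[OF eval_frame(5)]) simp
  ultimately show ?thesis
    by (simp add: trial_prog_def prepare_prog_def finish_prog_def eval_frame(1,2) UN_subset_iff)
qed

lemma guess_loops_simps:
  "nats_of (guess_loops k q) = nats_of q \<union> guess_var ` {..<k}"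
  "well_formed (guess_loops k q) \<longleftrightarrow> well_formed q \<and> (\<forall>i<k. guess_var i \<notin> nats_of q)"
  "accumulating (guess_loops k q) \<longleftrightarrow> accumulating q"
  by (induction k arbitrary: q) (auto simp: lessThan_Suc less_Suc_eq)

lemma union_layers_ok:
  "well_formed (union_prog x)" "accumulating (union_prog x)" "well_formed (layers_prog J)" "accumulating (layers_prog J)"
  by (auto simp: union_prog_def layers_prog_def)

lemma load_ok: "well_formed (load_prog y)" "accumulating (load_prog y)"
  by (auto simp: load_prog_def entry_exp_def)

lemma eval_ok: "well_formed (eval_prog x y)" "accumulating (eval_prog x y)"
  by (auto simp: eval_prog_def value_prog_def add_value_prog_def flag_prog_def guess_exp_def weight_exp_def
      union_layers_ok load_ok)

lemma main_ok: "well_formed main_prog" "accumulating main_prog"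
proof -
  have fr: "''x'' \<notin> nats_of move_prog" "''y'' \<notin> nats_of move_prog" "''l'' \<notin> nats_of move_prog" "''pass'' \<notin> nats_of move_prog"
    by (rule contra_subsetD[OF move_frame(1)], simp)+
  have mv: "well_formed move_prog" "accumulating move_prog"
    by (simp_all add: move_prog_def eval_ok)
  then have se: "well_formed search_prog" "accumulating search_prog"
    using fr by (simp_all add: search_prog_def)
  have tr: "well_formed trial_prog" "accumulating trial_prog"
    using se by (simp_all add: trial_prog_def prepare_prog_def finish_prog_def eval_ok load_ok union_layers_ok)
  have fr2: "''e'' \<notin> nats_of trial_prog" "''j'' \<notin> nats_of trial_prog" "guess_var k \<notin> nats_of trial_prog" for k
    by (rule contra_subsetD[OF trial_frame], simp)+
  show "well_formed main_prog" "accumulating main_prog"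
    using tr fr2 by (simp_all add: main_prog_def guess_loops_simps)
qed

end

section \<open>Correctness of the evaluation of a layer assignment\<close>

lemma nats_den_subset: "nats_of p \<subseteq> V \<Longrightarrow> x \<notin> V \<Longrightarrow> nats (den I p s) x = nats s x"
  by (rule nats_den) blast

lemma reals_den_subset: "reals_of p \<subseteq> V \<Longrightarrow> x \<notin> V \<Longrightarrow> reals (den I p s) x = reals s x"
  by (rule reals_den) blast

locale program_run = program +
  fixes I :: mpc_input
  assumes inst: "mpc_instance p c I"
begin

abbreviation "n \<equiv> ground_size I"
abbreviation "E \<equiv> ground I"
abbreviation "f \<equiv> objective I"

definition pack :: "nat \<Rightarrow> nat \<Rightarrow> real" where "pack i e = read_entry (packing I) i e"
definition cov :: "nat \<Rightarrow> nat \<Rightarrow> real" where "cov i e = read_entry (covering I) i e"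

definition load :: "nat set \<Rightarrow> nat \<Rightarrow> real" where
  "load X i = (if i < p then sum (pack i) X else sum (cov (i - p)) X)"

definition violation :: "nat set \<Rightarrow> nat set \<Rightarrow> nat \<Rightarrow> real" where
  "violation A X i = (if i < p then excess m (pack i) A X else deficit m (cov (i - p)) X)"

definition potential :: "real \<Rightarrow> nat set \<Rightarrow> (nat \<Rightarrow> nat) \<Rightarrow> real" where
  "potential v A L = layered_value E A \<nu> (truncate_at v f) L -
     4 * real m ^ 2 * (\<Sum>i<p + c. (max 0 (violation A (covered E A L {1..\<nu>}) i))\<^sup>2)"

lemma E_iff [simp]: "e \<in> E \<longleftrightarrow> e < n"
  by (simp add: ground_def)

lemma finite_E: "finite E" and card_E: "card E = n"
  by (simp_all add: ground_def)

lemma inst_packing: "packing I \<in> carrier_mat p n" "\<forall>i<p. \<forall>j<n. 0 \<le> packing I $$ (i, j)"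
  and inst_covering: "covering I \<in> carrier_mat c n" "\<forall>i<c. \<forall>j<n. 0 \<le> covering I $$ (i, j)"
  and inst_objective: "\<forall>S\<subseteq>E. 0 \<le> f S" "mono_on (Pow E) f" "submodular_on E f"
  and indep_matroid: "matroid E (indep_sets I)"
proof -
  note props = inst[unfolded mpc_instance_def]
  show "packing I \<in> carrier_mat p n" "\<forall>i<p. \<forall>j<n. 0 \<le> packing I $$ (i, j)"
    "covering I \<in> carrier_mat c n" "\<forall>i<c. \<forall>j<n. 0 \<le> covering I $$ (i, j)"
    "\<forall>S\<subseteq>E. 0 \<le> f S" "mono_on (Pow E) f" "submodular_on E f" "matroid E (indep_sets I)"
    by (insert props, (elim conjE, assumption)+)
qed

lemma dims: "dim_row (packing I) = p" "dim_col (packing I) = n" "dim_row (covering I) = c" "dim_col (covering I) = n"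
  using inst_packing(1) inst_covering(1) by auto

lemma pack_nonneg: "0 \<le> pack i e" and cov_nonneg: "0 \<le> cov i e"
  using inst_packing(2) inst_covering(2) by (simp_all add: pack_def cov_def read_entry_def dims)

lemma pack_outside: "pack i n = 0" and cov_outside: "cov i n = 0"
  by (simp_all add: pack_def cov_def read_entry_def dims)

lemma f_nonneg: "S \<subseteq> E \<Longrightarrow> 0 \<le> f S"
  using inst_objective(1) by blast

lemma f_mono_submodular: "mono_submodular_on E f"
  using inst_objective by (simp add: mono_submodular_on_def)

text \<open>The dummy is \<open>n\<close>, the first number beyond the ground set;
  \<open>read_entry\<close> gives it weight 0 in all constraints.\<close>

lemma packing_covering_truncated:
  assumes "0 \<le> v"
  shows "packing_covering E (indep_sets I) pack cov n m \<nu> (truncate_at v f)"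
proof
  show "mono_submodular_on E (truncate_at v f)"
    by (rule mono_submodular_truncate_at[OF f_mono_submodular f_nonneg assms])
  show "0 \<le> truncate_at v f S" "truncate_at v f S \<le> 1" if "S \<subseteq> E" for S
    using truncate_at_bounds(1,2) f_nonneg[OF that] by blast+
qed (use pack_nonneg cov_nonneg pack_outside cov_outside m_pos nu_pos indep_matroid in simp_all)

lemma sum_violation:
  "(\<Sum>i<p + c. (max 0 (violation A X i))\<^sup>2) =
    (\<Sum>i<p. (max 0 (excess m (pack i) A X))\<^sup>2) + (\<Sum>i<c. (max 0 (deficit m (cov i) X))\<^sup>2)"
proof -
  have "(\<Sum>i<p + c. (max 0 (violation A X i))\<^sup>2) =
    (\<Sum>i<p. (max 0 (violation A X i))\<^sup>2) + (\<Sum>i\<in>{p..<p + c}. (max 0 (violation A X i))\<^sup>2)"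
    by (subst sum.union_disjoint[symmetric]) (auto intro!: sum.cong)
  also have "(\<Sum>i\<in>{p..<p + c}. (max 0 (violation A X i))\<^sup>2) = (\<Sum>i<c. (max 0 (violation A X (i + p)))\<^sup>2)"
    using sum.shift_bounds_nat_ivl[of "\<lambda>i. (max 0 (violation A X i))\<^sup>2" 0 p c]
    by (simp add: add.commute lessThan_atLeast0)
  finally show ?thesis by (simp add: violation_def)
qed

lemma covered_cong: "(\<And>e. e < n \<Longrightarrow> L e = L' e) \<Longrightarrow> covered E A L J = covered E A L' J"
  by (auto simp: covered_def)

lemma potential_cong: "(\<And>e. e < n \<Longrightarrow> L e = L' e) \<Longrightarrow> potential v A L = potential v A L'"
  using covered_cong[of L L'] by (simp add: potential_def layered_value_def)

abbreviation guess_set :: "state \<Rightarrow> nat set" where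
  "guess_set s \<equiv> set_of_array I s ''a''"

abbreviation guess_value :: "state \<Rightarrow> real" where
  "guess_value s \<equiv> rval I s guess_exp"

lemma guess_value_cong: "nats s ''j'' = nats t ''j'' \<Longrightarrow> nats s ''one'' = nats t ''one'' \<Longrightarrow> guess_value s = guess_value t"
  by (simp add: guess_exp_def set_of_array_def)

lemma union_prog_set:
  assumes "x \<noteq> ''u''" "x \<noteq> ''i''"
  shows "set_of_array I (den I (union_prog x) s) ''u'' = {i \<in> E. nats s ''jj'' (nats s x i) \<noteq> 0} \<union> guess_set s"
proof -
  have "nats (den I (union_prog x) s) ''u'' =
    (\<lambda>i. if i < nval I s GroundSize then nats s ''jj'' (nats s x i) + nats s ''a'' i else nats s ''u'' i)"
    unfolding union_prog_def using assms by (intro den_For_set) auto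
  then show ?thesis by (auto simp: set_of_array_def)
qed

lemma layers_prog_cells: "r \<le> \<nu> \<Longrightarrow> nats (den I (layers_prog J) s) ''jj'' r = of_bool (r \<in> set J)"
  unfolding layers_prog_def den_set_cells by simp

lemma layers_union_set:
  assumes "x \<noteq> ''u''" "x \<noteq> ''i''" "x \<noteq> ''jj''" and "\<And>i. i < n \<Longrightarrow> nats s x i \<le> \<nu>" and "set J \<subseteq> {1..\<nu>}"
  shows "set_of_array I (den I (union_prog x) (den I (layers_prog J) s)) ''u'' = covered E (guess_set s) (nats s x) (set J)"
proof -
  have "nats (den I (layers_prog J) s) z = nats s z" if "z \<noteq> ''jj''" for z
    using that by (intro nats_den) (simp add: eval_frame)
  then have 1: "nats (den I (layers_prog J) s) x = nats s x" "guess_set (den I (layers_prog J) s) = guess_set s"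
    using assms by (simp_all add: set_of_array_def)
  show ?thesis unfolding union_prog_set[OF assms(1,2)] 1 covered_def
    using assms(4) by (auto simp: layers_prog_cells)
qed

lemma rval_weight_exp [simp]: "rval I s (weight_exp k) = layer_weight \<nu> k"
proof -
  have nu: "real \<nu> > 0" using nu_pos by simp
  have q: "1 + 1 / real \<nu> = (real \<nu> + 1) / real \<nu>" using nu by (simp add: field_simps)
  have "rval I s (weight_exp k) = ((real \<nu> + 1) ^ k * real \<nu> ^ (\<nu> + 1)) /
    (real \<nu> ^ k * (real \<nu> + 1) ^ (\<nu> + 1) * real k * real (\<nu> choose k))"
    by (simp add: weight_exp_def add.commute del: power_Suc)
  then show ?thesis using nu
    by (simp add: layer_weight_def q power_divide mult.assoc del: power_Suc)
qed

lemma add_value_prog_cell: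
  "reals (den I (add_value_prog y k) s) y 0 =
    reals s y 0 + layer_weight \<nu> k * truncate_at (guess_value s) f (set_of_array I s ''u'')"
  by (simp add: add_value_prog_def reals_real_update truncate_at_def)

lemma value_prog_cell:
  assumes x: "x \<noteq> ''u''" "x \<noteq> ''i''" "x \<noteq> ''jj''" and L: "\<And>i. i < n \<Longrightarrow> nats s x i \<le> \<nu>"
  shows "reals (den I (value_prog x y) s) y 0 = layered_value E (guess_set s) \<nu> (truncate_at (guess_value s) f) (nats s x)"
proof -
  let ?b = "\<lambda>J. Block (layers_prog J) (Block (union_prog x) (add_value_prog y (length J)))"
  let ?h = "\<lambda>J. layer_weight \<nu> (length J) * truncate_at (guess_value s) f (covered E (guess_set s) (nats s x) (set J))"
  have bf: "nats_of (?b J) \<subseteq> {''i'', ''jj'', ''u''}" for J by (auto simp: eval_frame)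
  have body: "reals (den I (?b J) t) y 0 = reals t y 0 + ?h J"
    if J: "set J \<subseteq> {1..\<nu>}" and t: "\<And>z. z \<notin> {''i'', ''jj'', ''u''} \<Longrightarrow> nats t z = nats s z" for J t
  proof -
    let ?t = "den I (union_prog x) (den I (layers_prog J) t)"
    have "nats_of (Block (layers_prog J) (union_prog x)) \<subseteq> {''i'', ''jj'', ''u''}" by (simp add: eval_frame)
    then have nt: "nats ?t z = nats s z" if "z \<notin> {''i'', ''jj'', ''u''}" for z
      using nats_den_subset[of "Block (layers_prog J) (union_prog x)" _ z I t] that t[OF that] by simp
    have "reals ?t y = reals t y" by (simp add: reals_den eval_frame)
    moreover have "guess_value ?t = guess_value s" using nt by (intro guess_value_cong) auto
    moreover have "guess_set t = guess_set s" "nats t x = nats s x"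
      using t x by (auto simp: set_of_array_def)
    ultimately show ?thesis using layers_union_set[OF x _ J, of t] L
      by (simp add: add_value_prog_cell)
  qed
  have "reals (fold (den I) (map ?b Js) t) y 0 = reals t y 0 + (\<Sum>J\<leftarrow>Js. ?h J)"
    if "\<And>J. J \<in> set Js \<Longrightarrow> set J \<subseteq> {1..\<nu>}" and "\<And>z. z \<notin> {''i'', ''jj'', ''u''} \<Longrightarrow> nats t z = nats s z" for Js t
    using that
  proof (induction Js arbitrary: t)
    case (Cons J Js)
    have "nats (den I (?b J) t) z = nats s z" if "z \<notin> {''i'', ''jj'', ''u''}" for z
      using nats_den_subset[OF bf that] Cons.prems(2)[OF that] by simp
    then have "reals (fold (den I) (map ?b Js) (den I (?b J) t)) y 0 = reals (den I (?b J) t) y 0 + (\<Sum>J\<leftarrow>Js. ?h J)"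
      using Cons.prems(1) by (intro Cons.IH) auto
    then show ?case using body[of J t] Cons.prems by simp
  qed simp
  note fold = this
  let ?xs = "[1..<Suc \<nu>]"
  have sub: "set J \<subseteq> {1..\<nu>}" if "J \<in> set (subseqs ?xs)" for J
  proof -
    have "set J \<in> Pow (set ?xs)" using that subseqs_powset[of ?xs] by blast
    then show ?thesis by auto
  qed
  have "reals (den I (value_prog x y) s) y 0 = (\<Sum>J\<leftarrow>subseqs ?xs. ?h J)"
    unfolding value_prog_def den.simps den_blocks
    by (subst fold) (use sub in \<open>simp_all add: reals_real_update\<close>)
  \<comment> \<open>Different subsequences of a distinct list have different sets of elements, so
    the list sum turns into the sum over all subsets.\<close>
  also have "\<dots> = (\<Sum>J\<leftarrow>map set (subseqs ?xs). layer_weight \<nu> (card J) * truncate_at (guess_value s) f (covered E (guess_set s) (nats s x) J))"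
    unfolding map_map
  proof (intro arg_cong[of _ _ sum_list] map_cong refl)
    fix J assume "J \<in> set (subseqs ?xs)"
    then have "distinct J" by (rule subseqs_distinctD) simp
    then show "?h J = ((\<lambda>J. layer_weight \<nu> (card J) * truncate_at (guess_value s) f (covered E (guess_set s) (nats s x) J)) \<circ> set) J"
      by (simp add: distinct_card)
  qed
  also have "\<dots> = (\<Sum>J\<in>set (map set (subseqs ?xs)). layer_weight \<nu> (card J) * truncate_at (guess_value s) f (covered E (guess_set s) (nats s x) J))"
    by (intro sum_list_distinct_conv_sum_set distinct_set_subseqs) simp
  also have "set (map set (subseqs ?xs)) = Pow {1..\<nu>}"
    using subseqs_powset[of ?xs] by (simp add: atLeastLessThanSuc_atLeastAtMost del: upt_Suc)
  finally show ?thesis by (simp add: layered_value_def)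
qed

lemma rval_entry_exp: "rval I t (entry_exp z k) = (if k < p then pack k (nats t z 0) else cov (k - p) (nats t z 0))"
  by (simp add: entry_exp_def pack_def cov_def)

lemma load_prog_cell:
  assumes y: "y \<noteq> ''i''"
  shows "i < p + c \<Longrightarrow> reals (den I (load_prog y) s) y (Suc i) = load (set_of_array I s ''u'') i"
proof -
  let ?add = "blocks (map (\<lambda>i. RSet y (NConst (Suc i)) (RAdd (RCell y (NConst (Suc i))) (entry_exp ''i'' i))) [0..<p + c])"
  let ?body = "Branch (NLess (NConst 0) (NCell ''u'' (scalar ''i''))) ?add Nop"
  let ?z = "den I (blocks (map (\<lambda>i. RSet y (NConst (Suc i)) (real_const 0)) [0..<p + c])) s"
  let ?w = "\<lambda>k e. if k < p then pack k e else cov (k - p) e"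
  let ?P = "\<lambda>j (t :: state). nats t ''u'' = nats s ''u'' \<and>
    (\<forall>k<p + c. reals t y (Suc k) = (\<Sum>e\<in>{e. e < j \<and> nats s ''u'' e \<noteq> 0}. ?w k e))"
  have "?P n (fold (\<lambda>i s. den I ?body (nat_update ''i'' 0 i s)) [0..<n] ?z)"
  proof (rule fold_invariant_upt[where P = ?P])
    show "?P 0 ?z" using den_zero_cells[of _ "p + c" I y s] by (simp add: nats_den)
  next
    fix j t assume P: "?P j t"
    let ?t = "nat_update ''i'' 0 j t"
    have u: "nats ?t ''u'' = nats s ''u''" using P by (simp add: nats_nat_update)
    have S: "{e. e < Suc j \<and> nats s ''u'' e \<noteq> 0} =
      (if nats s ''u'' j \<noteq> 0 then insert j {e. e < j \<and> nats s ''u'' e \<noteq> 0} else {e. e < j \<and> nats s ''u'' e \<noteq> 0})"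
      by (auto simp: less_Suc_eq)
    show "?P (Suc j) (den I ?body ?t)"
    proof (cases "nats s ''u'' j \<noteq> 0")
      case True
      have "nats (den I ?add ?t) = nats ?t \<and>
        (\<forall>i. reals (den I ?add ?t) y (Suc i) = reals ?t y (Suc i) + (if i < p + c then ?w i j else 0))"
        by (intro den_add_cells) (simp add: rval_entry_exp nats_nat_update)
      moreover have "den I ?body ?t = den I ?add ?t" using True u by (simp add: nats_nat_update)
      ultimately show ?thesis using P u True unfolding S by (simp add: add.commute)
    next
      case False
      then have "den I ?body ?t = ?t" using u by (simp add: nats_nat_update)
      then show ?thesis using P u False unfolding S by simp
    qed
  qed
  moreover have "{e. e < n \<and> nats s ''u'' e \<noteq> 0} = set_of_array I s ''u''" by (auto simp: set_of_array_def)
  ultimately show "i < p + c \<Longrightarrow> reals (den I (load_prog y) s) y (Suc i) = load (set_of_array I s ''u'') i"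
    by (simp add: load_prog_def load_def)
qed

text \<open>The loads occupy the cells \<open>Suc i\<close>, which spares the layered value in cell
  0.\<close>

lemma load_prog_cell_0: "reals (den I (load_prog y) s) y 0 = reals s y 0"
proof -
  have P: "reals (fold (den I) (map (\<lambda>i. RSet y (NConst (Suc i)) (g i)) Is) t) y 0 = reals t y 0" for g Is t
    by (induction Is arbitrary: t) (simp_all add: reals_real_update)
  let ?body = "Branch (NLess (NConst 0) (NCell ''u'' (scalar ''i'')))
    (blocks (map (\<lambda>i. RSet y (NConst (Suc i)) (RAdd (RCell y (NConst (Suc i))) (entry_exp ''i'' i))) [0..<p + c])) Nop"
  have "reals (fold (\<lambda>i s. den I ?body (nat_update ''i'' 0 i s)) [0..<n] t) y 0 = reals t y 0" for t
    by (rule fold_invariant_upt[where P = "\<lambda>_ u. reals u y 0 = reals t y 0"]) (simp_all add: den_blocks P)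
  then show ?thesis by (simp add: load_prog_def den_blocks P)
qed

definition guess_loaded :: "state \<Rightarrow> bool" where
  "guess_loaded s \<longleftrightarrow> (\<forall>i<p + c. reals s ''A'' (Suc i) = load (guess_set s) i)"

definition evaluated :: "string \<Rightarrow> real \<Rightarrow> nat set \<Rightarrow> (nat \<Rightarrow> nat) \<Rightarrow> state \<Rightarrow> bool" where
  "evaluated y v A L s \<longleftrightarrow> reals s y 0 = layered_value E A \<nu> (truncate_at v f) L \<and>
     (\<forall>i<p + c. reals s y (Suc i) = load (covered E A L {1..\<nu>}) i \<and>
       nats s y i = of_bool (0 < violation A (covered E A L {1..\<nu>}) i))"

lemma evaluated_cong:
  "reals s y = reals t y \<Longrightarrow> nats s y = nats t y \<Longrightarrow> evaluated y v A L s \<longleftrightarrow> evaluated y v A L t"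
  by (simp add: evaluated_def)

lemma rval_violation_exp:
  assumes "i < p + c" "reals s ''A'' (Suc i) = load A i" "reals s y (Suc i) = load X i"
  shows "rval I s (violation_exp y i) = violation A X i"
  using assms by (simp add: violation_exp_def load_exp_def violation_def load_def excess_def deficit_def)

lemma eval_prog_correct:
  assumes x: "x \<noteq> ''u''" "x \<noteq> ''i''" "x \<noteq> ''jj''" and y: "y \<notin> {''u'', ''i'', ''jj'', ''a'', ''A'', ''j'', ''one''}" "x \<noteq> y"
    and L: "\<And>i. i < n \<Longrightarrow> nats s x i \<le> \<nu>" and A: "guess_loaded s"
  shows "evaluated y (guess_value s) (guess_set s) (nats s x) (den I (eval_prog x y) s)"
    "set_of_array I (den I (eval_prog x y) s) ''u'' = covered E (guess_set s) (nats s x) {1..\<nu>}"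
proof -
  let ?X = "covered E (guess_set s) (nats s x) {1..\<nu>}"
  let ?s1 = "den I (value_prog x y) s"
  let ?s2 = "den I (union_prog x) (den I (layers_prog [1..<Suc \<nu>]) ?s1)"
  let ?s3 = "den I (load_prog y) ?s2"
  let ?s4 = "den I (flag_prog y) ?s3"
  have s4: "den I (eval_prog x y) s = ?s4" by (simp add: eval_prog_def)
  have n1: "nats ?s1 z = nats s z" if "z \<notin> {''i'', ''jj'', ''u''}" for z
    using nats_den_subset[OF eval_frame(4) that] .
  have g1: "guess_set ?s1 = guess_set s" using n1 by (simp add: set_of_array_def)
  have u2: "set_of_array I ?s2 ''u'' = ?X"
  proof -
    have "set [1..<Suc \<nu>] = {1..\<nu>}" by auto
    moreover have "nats ?s1 x = nats s x" using n1 x by simp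
    ultimately show ?thesis using layers_union_set[OF x, of ?s1 "[1..<Suc \<nu>]"] g1 L by (simp del: upt_Suc)
  qed
  have "nats ?s4 ''u'' = nats ?s3 ''u''"
    by (rule nats_den_subset[OF eval_frame(6)]) (use y(1) in auto)
  also have "\<dots> = nats ?s2 ''u''"
    by (rule nats_den_subset[OF eval_frame(5)]) simp
  finally have u4: "nats ?s4 ''u'' = nats ?s2 ''u''" .
  then show "set_of_array I (den I (eval_prog x y) s) ''u'' = ?X" using u2 unfolding s4 by (simp add: set_of_array_def)
  have r4: "reals ?s4 = reals ?s3" by (rule ext, rule reals_den) (simp add: eval_frame)
  have load: "reals ?s3 y (Suc i) = load ?X i" if "i < p + c" for i
    using load_prog_cell[OF _ that, of y ?s2] y(1) u2 by simp
  have A3: "reals ?s3 ''A'' (Suc i) = load (guess_set s) i" if "i < p + c" for i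
  proof -
    have A: "''A'' \<notin> {y}" using y(1) by auto
    have "reals ?s3 ''A'' = reals ?s2 ''A''" by (rule reals_den_subset[OF eval_frame(12) A])
    also have "\<dots> = reals s ''A''" using A by (simp add: reals_den eval_frame)
    finally have "reals ?s3 ''A'' = reals s ''A''" .
    then show ?thesis using \<open>guess_loaded s\<close> that by (simp add: guess_loaded_def)
  qed
  have v0: "reals ?s3 y 0 = reals ?s1 y 0"
  proof -
    have "reals ?s3 y 0 = reals ?s2 y 0" by (rule load_prog_cell_0)
    then show ?thesis by (simp add: reals_den eval_frame)
  qed
  have flags: "nats ?s4 y i = of_bool (0 < violation (guess_set s) ?X i)" if "i < p + c" for i
    unfolding flag_prog_def
    by (rule den_flag_cells[OF _ that]) (use load A3 in \<open>auto intro!: rval_violation_exp\<close>)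
  show "evaluated y (guess_value s) (guess_set s) (nats s x) (den I (eval_prog x y) s)"
    unfolding s4 evaluated_def r4 v0 using load flags value_prog_cell[OF x, of s y] L by auto
qed

lemma rval_potential_exp:
  assumes ev: "evaluated y v A L s" and A: "\<And>i. i < p + c \<Longrightarrow> reals s ''A'' (Suc i) = load A i"
  shows "rval I s (potential_exp y) = potential v A L"
proof -
  let ?X = "covered E A L {1..\<nu>}"
  have "(\<Sum>i\<leftarrow>[0..<p + c]. rval I s (RMul (OfNat (NCell y (NConst i))) (RMul (violation_exp y i) (violation_exp y i))))
    = (\<Sum>i\<in>set [0..<p + c]. (max 0 (violation A ?X i))\<^sup>2)"
  proof (subst sum_list_distinct_conv_sum_set, simp, rule sum.cong[OF refl])
    fix i assume "i \<in> set [0..<p + c]"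
    then have i: "i < p + c" by simp
    have "rval I s (violation_exp y i) = violation A ?X i"
      using ev A i by (intro rval_violation_exp) (auto simp: evaluated_def)
    moreover have "nats s y i = of_bool (0 < violation A ?X i)" using ev i by (simp add: evaluated_def)
    ultimately show "rval I s (RMul (OfNat (NCell y (NConst i))) (RMul (violation_exp y i) (violation_exp y i)))
      = (max 0 (violation A ?X i))\<^sup>2" by (auto simp: power2_eq_square max_def)
  qed
  then show ?thesis using ev
    by (simp add: potential_exp_def potential_def evaluated_def comp_def lessThan_atLeast0)
qed

end

section \<open>The search as an iteration on layer assignments\<close>

lemma den_For_abs:
  assumes step: "\<And>i s. i < nval I s0 b \<Longrightarrow> C s \<Longrightarrow> nats s x 0 = i \<Longrightarrow> C (den I p s) \<and> obs (den I p s) = F i (obs s)"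
    and upd: "\<And>s k. C s \<Longrightarrow> C (nat_update x 0 k s) \<and> obs (nat_update x 0 k s) = obs s"
    and init: "C s0"
  shows "C (den I (For x b p) s0) \<and> obs (den I (For x b p) s0) = fold F [0..<nval I s0 b] (obs s0)"
proof -
  let ?P = "\<lambda>i t. i \<le> nval I s0 b \<longrightarrow> C t \<and> obs t = fold F [0..<i] (obs s0)"
  have "?P (nval I s0 b) (fold (\<lambda>i s. den I p (nat_update x 0 i s)) [0..<nval I s0 b] s0)"
  proof (rule fold_invariant_upt[where P = ?P])
    fix i t assume i: "i < nval I s0 b" and P: "?P i t"
    then have t: "C t" "obs t = fold F [0..<i] (obs s0)" by simp_all
    have u: "C (nat_update x 0 i t)" "obs (nat_update x 0 i t) = obs t" using upd[OF t(1)] by auto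
    have "C (den I p (nat_update x 0 i t)) \<and> obs (den I p (nat_update x 0 i t)) = F i (obs t)"
      using step[OF i u(1)] u(2) by (simp add: nats_nat_update)
    then show "?P (Suc i) (den I p (nat_update x 0 i t))" using t(2) by simp
  qed (simp add: init)
  then show ?thesis using upd by simp
qed

lemma bval_conj_exp_upt: "bval I s (conj_exp (map g [0..<k])) \<longleftrightarrow> (\<forall>i<k. bval I s (g i))"
  by auto

text \<open>\<open>G\<close> collects the elementary moves inside \<open>F\<close>. If
  \<open>F\<close> does not gain more than \<open>\<theta>\<close>, all of them are stationary; this
  property survives composition, so an idle pass certifies every single move.\<close>

definition progressive :: "real \<Rightarrow> ('b \<Rightarrow> real) \<Rightarrow> ('b \<Rightarrow> 'b) \<Rightarrow> ('b \<Rightarrow> 'b) set \<Rightarrow> bool" where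
  "progressive \<theta> val F G \<longleftrightarrow> (\<forall>L. F L = L \<and> (\<forall>g\<in>G. g L = L) \<or> val L + \<theta> < val (F L))"

lemma progressive_fold:
  assumes "0 \<le> \<theta>" and "\<And>i. i \<in> set is \<Longrightarrow> progressive \<theta> val (F i) (G i)"
  shows "progressive \<theta> val (fold F is) (\<Union>i\<in>set is. G i)"
  using assms(2)
proof (induction "is")
  case Nil
  then show ?case by (simp add: progressive_def)
next
  case (Cons i "is")
  have hd: "F i L = L \<and> (\<forall>g\<in>G i. g L = L) \<or> val L + \<theta> < val (F i L)" for L
    using Cons.prems[of i] by (simp add: progressive_def)
  have tl: "fold F is L = L \<and> (\<forall>g\<in>(\<Union>i\<in>set is. G i). g L = L) \<or> val L + \<theta> < val (fold F is L)" for L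
    using Cons by (simp add: progressive_def)
  show ?case unfolding progressive_def
  proof
    fix L
    show "fold F (i # is) L = L \<and> (\<forall>g\<in>(\<Union>i\<in>set (i # is). G i). g L = L) \<or> val L + \<theta> < val (fold F (i # is) L)"
    proof (cases "F i L = L \<and> (\<forall>g\<in>G i. g L = L)")
      case True
      then show ?thesis using tl[of L] by auto
    next
      case False
      then have "val L + \<theta> < val (F i L)" using hd by blast
      moreover have "val (F i L) \<le> val (fold F is (F i L))" using tl[of "F i L"] assms(1) by auto
      ultimately show ?thesis by simp
    qed
  qed
qed

text \<open>Fixed points persist: either every one of the \<open>k\<close> rounds gained
  \<open>\<theta>\<close>, or some round was stationary and so are all later ones.\<close>

lemma progressive_stable:
  assumes F: "progressive \<theta> val F G" and bound: "val ((F ^^ k) L) < val L + real k * \<theta>"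
  shows "\<forall>g\<in>G. g ((F ^^ k) L) = (F ^^ k) L"
proof -
  have "(F ((F ^^ k) L) = (F ^^ k) L \<and> (\<forall>g\<in>G. g ((F ^^ k) L) = (F ^^ k) L)) \<or> val L + real k * \<theta> \<le> val ((F ^^ k) L)" for k
  proof (induction k)
    case (Suc k)
    let ?K = "(F ^^ k) L"
    have F: "F ?K = ?K \<and> (\<forall>g\<in>G. g ?K = ?K) \<or> val ?K + \<theta> < val (F ?K)"
      using F by (simp add: progressive_def)
    show ?case
    proof (cases "F ?K = ?K \<and> (\<forall>g\<in>G. g ?K = ?K)")
      case True
      then show ?thesis by simp
    next
      case False
      then have "val L + real k * \<theta> \<le> val ?K" "val ?K + \<theta> < val (F ?K)" using F Suc by blast+
      then show ?thesis by (simp add: algebra_simps)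
    qed
  qed simp
  then show ?thesis using bound by (meson not_le)
qed

context program_run
begin

definition admissible :: "nat set \<Rightarrow> nat \<Rightarrow> bool" where
  "admissible A e \<longleftrightarrow> (\<forall>i<p. pack i e * real (coarse_scale m (p + c)) \<le> 1 - sum (pack i) A) \<and>
     (\<forall>i<c. 1 \<le> sum (cov i) A \<or> cov i e * real (fine_scale m p c) \<le> 1)"

definition threshold :: real where
  "threshold = 1 / (2 * real m * (real n + 1))"

text \<open>Moves may write to the cell of the dummy. Cutting it off makes stationarity an equality
  of functions.\<close>

definition restrict_layers :: "(nat \<Rightarrow> nat) \<Rightarrow> nat \<Rightarrow> nat" where
  "restrict_layers L = (\<lambda>i. if i < n then L i else 0)"

definition accepted :: "real \<Rightarrow> nat set \<Rightarrow> nat \<Rightarrow> (nat \<Rightarrow> nat) \<Rightarrow> (nat \<Rightarrow> nat) \<Rightarrow> bool" where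
  "accepted v A y L L' \<longleftrightarrow> covered E A L' {1..\<nu>} \<in> indep_sets I \<and> admissible A y \<and>
     potential v A L + threshold < potential v A L'"

definition try_move :: "real \<Rightarrow> nat set \<Rightarrow> nat \<Rightarrow> nat \<Rightarrow> nat \<Rightarrow> (nat \<Rightarrow> nat) \<Rightarrow> nat \<Rightarrow> nat" where
  "try_move v A x y l L =
     (if accepted v A y L (L(x := 0, y := l)) then restrict_layers (L(x := 0, y := l)) else L)"

abbreviation layers :: "state \<Rightarrow> nat \<Rightarrow> nat" where
  "layers s \<equiv> restrict_layers (nats s ''s'')"

lemma potential_restrict [simp]: "potential v A (restrict_layers L) = potential v A L"
  by (rule potential_cong) (simp add: restrict_layers_def)

lemma covered_restrict [simp]: "covered E A (restrict_layers L) J = covered E A L J"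
  by (rule covered_cong) (simp add: restrict_layers_def)

lemma accepted_cong:
  assumes "\<And>i. i < n \<Longrightarrow> L i = K i" "\<And>i. i < n \<Longrightarrow> L' i = K' i"
  shows "accepted v A y L L' \<longleftrightarrow> accepted v A y K K'"
  using potential_cong[of L K] potential_cong[of L' K'] covered_cong[of L' K'] assms
  by (simp add: accepted_def)

lemma bval_admissible_exp:
  assumes "\<And>i. i < p + c \<Longrightarrow> reals s ''A'' (Suc i) = load A i"
  shows "bval I s admissible_exp \<longleftrightarrow> admissible A (nats s ''y'' 0)"
proof -
  have "bval I s admissible_exp \<longleftrightarrow> (\<forall>i<p + c. if i < p
     then \<not> 1 - sum (pack i) A < pack i (nats s ''y'' 0) * real (coarse_scale m (p + c))
     else \<not> (sum (cov (i - p)) A < 1 \<and> 1 < cov (i - p) (nats s ''y'' 0) * real (fine_scale m p c)))"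
    unfolding admissible_exp_def bval_conj_exp_upt
    using assms by (intro all_cong) (simp add: rval_entry_exp load_exp_def load_def)
  also have "\<dots> \<longleftrightarrow> (\<forall>i<p. pack i (nats s ''y'' 0) * real (coarse_scale m (p + c)) \<le> 1 - sum (pack i) A) \<and>
     (\<forall>i<c. \<not> (sum (cov i) A < 1 \<and> 1 < cov i (nats s ''y'' 0) * real (fine_scale m p c)))"
    (is "?l \<longleftrightarrow> ?r")
  proof
    assume l: ?l
    show ?r
    proof (intro conjI allI impI)
      fix i assume "i < p"
      then show "pack i (nats s ''y'' 0) * real (coarse_scale m (p + c)) \<le> 1 - sum (pack i) A"
        using l[rule_format, of i] by (simp add: not_less)
    next
      fix i assume "i < c"
      then show "\<not> (sum (cov i) A < 1 \<and> 1 < cov i (nats s ''y'' 0) * real (fine_scale m p c))"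
        using l[rule_format, of "p + i"] by simp
    qed
  next
    assume r: ?r
    show ?l
    proof (intro allI impI)
      fix i assume i: "i < p + c"
      then have "\<not> i < p \<Longrightarrow> i - p < c" by simp
      then show "if i < p
        then \<not> 1 - sum (pack i) A < pack i (nats s ''y'' 0) * real (coarse_scale m (p + c))
        else \<not> (sum (cov (i - p)) A < 1 \<and> 1 < cov (i - p) (nats s ''y'' 0) * real (fine_scale m p c))"
        using r by (auto simp: not_less)
    qed
  qed
  finally show ?thesis by (auto simp: admissible_def not_less)
qed

lemma guess_set_cong: "nats s ''a'' = nats t ''a'' \<Longrightarrow> guess_set s = guess_set t"
  by (simp add: set_of_array_def)

lemma guess_loaded_cong: "nats s ''a'' = nats t ''a'' \<Longrightarrow> reals s ''A'' = reals t ''A'' \<Longrightarrow> guess_loaded s \<longleftrightarrow> guess_loaded t"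
  by (simp add: guess_loaded_def set_of_array_def)

lemma move_prog_correct:
  assumes A: "guess_loaded s" and L: "\<And>i. i < n \<Longrightarrow> nats s ''s'' i \<le> \<nu>" and l: "nats s ''l'' 0 \<le> \<nu>"
  shows "layers (den I move_prog s) =
    try_move (guess_value s) (guess_set s) (nats s ''x'' 0) (nats s ''y'' 0) (nats s ''l'' 0) (layers s)"
proof -
  let ?x = "nats s ''x'' 0" and ?y = "nats s ''y'' 0" and ?l = "nats s ''l'' 0" and ?L = "nats s ''s''"
  define s1 where "s1 = den I (copy_prog ''s'' ''t'') s"
  define s3 where "s3 = nat_update ''t'' ?y ?l (nat_update ''t'' ?x 0 s1)"
  define s4 where "s4 = den I (eval_prog ''s'' ''S'') s3"
  define s5 where "s5 = den I (eval_prog ''t'' ''T'') s4"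
  let ?c = "BAnd (IndepQuery ''u'') (BAnd admissible_exp (RLess (RAdd (potential_exp ''S'') threshold_exp) (potential_exp ''T'')))"
  have n1: "nats s1 z = nats s z" if "z \<noteq> ''i''" "z \<noteq> ''t''" for z
    unfolding s1_def using that by (intro nats_den) simp
  have r1: "reals s1 = reals s" unfolding s1_def by (rule ext, rule reals_den) simp
  have dm: "den I move_prog s = (if bval I s5 ?c then den I (copy_prog ''t'' ''s'') s5 else s5)"
    by (simp add: move_prog_def s5_def s4_def s3_def s1_def[symmetric] n1 nats_nat_update)
  have n3: "nats s3 z = nats s z" if "z \<noteq> ''i''" "z \<noteq> ''t''" for z
    using that n1 by (simp add: s3_def nats_nat_update)
  have r3: "reals s3 = reals s" by (simp add: s3_def r1)
  have t3: "nats s3 ''t'' i = (?L(?x := 0, ?y := ?l)) i" if "i < n" for i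
    using that by (simp add: s3_def nats_nat_update s1_def den_copy_prog)
  have n4: "nats s4 z = nats s3 z" if "z \<notin> {''i'', ''jj'', ''u'', ''S''}" for z
    unfolding s4_def by (rule nats_den_subset[OF eval_frame(7) that])
  have r4: "reals s4 z = reals s z" if "z \<noteq> ''S''" for z
    unfolding s4_def using that by (subst reals_den) (simp_all add: eval_frame r3)
  have n5: "nats s5 z = nats s4 z" if "z \<notin> {''i'', ''jj'', ''u'', ''T''}" for z
    unfolding s5_def by (rule nats_den_subset[OF eval_frame(7) that])
  have r5: "reals s5 z = reals s4 z" if "z \<noteq> ''T''" for z
    unfolding s5_def using that by (subst reals_den) (simp_all add: eval_frame)
  have g3: "guess_loaded s3" "guess_value s3 = guess_value s" "guess_set s3 = guess_set s"
    using A guess_loaded_cong[of s3 s] guess_value_cong[of s3 s] guess_set_cong[of s3 s] n3 r3 by simp_all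
  have g4: "guess_loaded s4" "guess_value s4 = guess_value s" "guess_set s4 = guess_set s"
    using A guess_loaded_cong[of s4 s] guess_value_cong[of s4 s] guess_set_cong[of s4 s] n3 n4 r4 by simp_all
  have eS: "evaluated ''S'' (guess_value s) (guess_set s) ?L s4"
    using eval_prog_correct(1)[of "''s''" "''S''" s3] g3 n3 L by (simp add: s4_def)
  have eS5: "evaluated ''S'' (guess_value s) (guess_set s) ?L s5"
    using eS evaluated_cong[of s5 "''S''" s4] n5 r5 by simp
  have t4: "nats s4 ''t'' i = (?L(?x := 0, ?y := ?l)) i" if "i < n" for i
    using t3[OF that] n4 by simp
  have t4le: "nats s4 ''t'' i \<le> \<nu>" if "i < n" for i
    using t4[OF that] L[OF that] l by simp
  have eT: "evaluated ''T'' (guess_value s) (guess_set s) (nats s4 ''t'') s5"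
    and u5: "set_of_array I s5 ''u'' = covered E (guess_set s) (nats s4 ''t'') {1..\<nu>}"
    using eval_prog_correct[of "''t''" "''T''" s4] g4 t4le by (simp_all add: s5_def)
  have A5: "reals s5 ''A'' (Suc i) = load (guess_set s) i" if "i < p + c" for i
    using A that r5 r4 by (simp add: guess_loaded_def)
  have y5: "nats s5 ''y'' 0 = ?y" using n5 n4 n3 by simp
  have "bval I s5 ?c \<longleftrightarrow> accepted (guess_value s) (guess_set s) ?y ?L (nats s4 ''t'')"
    using bval_admissible_exp[of s5, OF A5] rval_potential_exp[OF eS5 A5] rval_potential_exp[OF eT A5] u5 y5
    by (simp add: accepted_def threshold_exp_def threshold_def add.commute mult.assoc)
  also have "\<dots> \<longleftrightarrow> accepted (guess_value s) (guess_set s) ?y (layers s) ((layers s)(?x := 0, ?y := ?l))"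
    by (rule accepted_cong) (simp_all add: t4 restrict_layers_def)
  finally have c: "bval I s5 ?c \<longleftrightarrow> accepted (guess_value s) (guess_set s) ?y (layers s) ((layers s)(?x := 0, ?y := ?l))" .
  show ?thesis
  proof (cases "bval I s5 ?c")
    case True
    have "layers (den I (copy_prog ''t'' ''s'') s5) = restrict_layers ((layers s)(?x := 0, ?y := ?l))"
      using n5[of "''t''"] by (auto simp: restrict_layers_def fun_eq_iff den_copy_prog t4)
    then show ?thesis using True c dm by (simp add: try_move_def)
  next
    case False
    have "nats s5 ''s'' = ?L" using n5 n4 n3 by simp
    moreover have "den I move_prog s = s5" using False dm by (simp only: if_False)
    moreover have "\<not> accepted (guess_value s) (guess_set s) ?y (layers s) ((layers s)(?x := 0, ?y := ?l))"
      using False c by blast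
    ultimately show ?thesis by (simp add: try_move_def)
  qed
qed

definition same_guess :: "state \<Rightarrow> state \<Rightarrow> bool" where
  "same_guess r s \<longleftrightarrow> nats s ''a'' = nats r ''a'' \<and> nats s ''j'' = nats r ''j'' \<and> nats s ''one'' = nats r ''one'' \<and>
     reals s ''A'' = reals r ''A'' \<and> (\<forall>i<n. nats s ''s'' i \<le> \<nu>)"

definition pass :: "real \<Rightarrow> nat set \<Rightarrow> (nat \<Rightarrow> nat) \<Rightarrow> nat \<Rightarrow> nat" where
  "pass v A = fold (\<lambda>x. fold (\<lambda>y. fold (\<lambda>l. try_move v A x y l) [0..<Suc \<nu>]) [0..<n + 1]) [0..<n + 1]"

definition pass_count :: nat where
  "pass_count = passes * (n + 1) + 1"

lemma search_prog_correct:
  assumes A: "guess_loaded s" and L: "\<And>i. i < n \<Longrightarrow> nats s ''s'' i \<le> \<nu>"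
  shows "same_guess s (den I search_prog s) \<and>
    layers (den I search_prog s) = (pass (guess_value s) (guess_set s) ^^ pass_count) (layers s)"
proof -
  let ?v = "guess_value s" and ?A = "guess_set s"
  have upd: "same_guess s (nat_update z 0 k t) \<and> layers (nat_update z 0 k t) = layers t"
    if "same_guess s t" "z \<in> {''pass'', ''x'', ''y'', ''l''}" for z k t
    using that by (auto simp: same_guess_def nats_nat_update)
  have move: "(same_guess s (den I move_prog t) \<and> nats (den I move_prog t) ''x'' 0 = x \<and> nats (den I move_prog t) ''y'' 0 = y) \<and>
      layers (den I move_prog t) = try_move ?v ?A x y l (layers t)"
    if "l < Suc \<nu>" "same_guess s t \<and> nats t ''x'' 0 = x \<and> nats t ''y'' 0 = y" "nats t ''l'' 0 = l" for t x y l
  proof -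
    have t: "same_guess s t" "nats t ''x'' 0 = x" "nats t ''y'' 0 = y" using that by auto
    have g: "guess_loaded t" "guess_value t = ?v" "guess_set t = ?A"
      using A guess_loaded_cong[of t s] guess_value_cong[of t s] guess_set_cong[of t s] t(1) by (simp_all add: same_guess_def)
    have fr: "nats (den I move_prog t) z = nats t z" if "z \<notin> {''i'', ''s'', ''t'', ''u'', ''jj'', ''S'', ''T''}" for z
      by (rule nats_den_subset[OF move_frame(1) that])
    have fa: "reals (den I move_prog t) ''A'' = reals t ''A''"
      by (rule reals_den_subset[OF move_frame(2)]) simp
    have eq: "layers (den I move_prog t) = try_move ?v ?A x y l (layers t)"
      using move_prog_correct[OF g(1)] g t that by (simp add: same_guess_def)
    have "nats (den I move_prog t) ''s'' i \<le> \<nu>" if i: "i < n" for i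
    proof -
      have "nats (den I move_prog t) ''s'' i = try_move ?v ?A x y l (layers t) i"
        using fun_cong[OF eq, of i] i by (simp add: restrict_layers_def)
      then show ?thesis using t(1) i \<open>l < Suc \<nu>\<close>
        by (auto simp: try_move_def restrict_layers_def same_guess_def)
    qed
    then have "same_guess s (den I move_prog t)" using t(1) fr fa by (simp add: same_guess_def)
    then show ?thesis using eq fr t by simp
  qed
  \<comment> \<open>The observation \<open>layers\<close> turns each loop into a
    \<open>fold\<close>; the invariants of the inner loops record the counters of the outer
    ones.\<close>
  let ?Fl = "\<lambda>x y l. try_move ?v ?A x y l"
  let ?Fy = "\<lambda>x y. fold (?Fl x y) [0..<Suc \<nu>]"
  let ?Fx = "\<lambda>x. fold (?Fy x) [0..<n + 1]"
  let ?pl = "For ''l'' (NConst (Suc \<nu>)) move_prog"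
  let ?py = "For ''y'' (NAdd GroundSize (NConst 1)) ?pl"
  let ?px = "For ''x'' (NAdd GroundSize (NConst 1)) ?py"
  have ll: "(same_guess s (den I ?pl t) \<and> nats (den I ?pl t) ''x'' 0 = x \<and> nats (den I ?pl t) ''y'' 0 = y) \<and>
      layers (den I ?pl t) = ?Fy x y (layers t)"
    if "same_guess s t \<and> nats t ''x'' 0 = x \<and> nats t ''y'' 0 = y" for t x y
    using den_For_abs[where I = I and b = "NConst (Suc \<nu>)" and ?s0.0 = t and x = "''l''" and p = move_prog and obs = layers
        and F = "?Fl x y" and C = "\<lambda>t. same_guess s t \<and> nats t ''x'' 0 = x \<and> nats t ''y'' 0 = y"]
      move upd that by (simp add: nats_nat_update)
  have ly: "(same_guess s (den I ?py t) \<and> nats (den I ?py t) ''x'' 0 = x) \<and> layers (den I ?py t) = ?Fx x (layers t)"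
    if "same_guess s t \<and> nats t ''x'' 0 = x" for t x
  proof -
    have step: "(same_guess s (den I ?pl t) \<and> nats (den I ?pl t) ''x'' 0 = x) \<and> layers (den I ?pl t) = ?Fy x i (layers t)"
      if "same_guess s t \<and> nats t ''x'' 0 = x" "nats t ''y'' 0 = i" for i t
      using ll[of t x i] that by blast
    have "(same_guess s (den I ?py t) \<and> nats (den I ?py t) ''x'' 0 = x) \<and>
      layers (den I ?py t) = fold (?Fy x) [0..<nval I t (NAdd GroundSize (NConst 1))] (layers t)"
      by (rule den_For_abs[where C = "\<lambda>t. same_guess s t \<and> nats t ''x'' 0 = x"])
        (use step upd that in \<open>auto simp: nats_nat_update simp del: upt_Suc\<close>)
    then show ?thesis by (simp del: upt_Suc)
  qed
  have lx: "same_guess s (den I ?px t) \<and> layers (den I ?px t) = pass ?v ?A (layers t)"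
    if "same_guess s t" for t
  proof -
    have step: "same_guess s (den I ?py t) \<and> layers (den I ?py t) = ?Fx i (layers t)"
      if "same_guess s t" "nats t ''x'' 0 = i" for i t
      using ly[of t i] that by blast
    have "same_guess s (den I ?px t) \<and> layers (den I ?px t) = fold ?Fx [0..<nval I t (NAdd GroundSize (NConst 1))] (layers t)"
      by (rule den_For_abs[where C = "same_guess s"]) (use step upd that in \<open>auto simp del: upt_Suc\<close>)
    then show ?thesis by (simp add: pass_def del: upt_Suc)
  qed
  have fold_const: "fold (\<lambda>_. F) [0..<k] L = (F ^^ k) L" for F :: "(nat \<Rightarrow> nat) \<Rightarrow> nat \<Rightarrow> nat" and k L
    by (induction k) simp_all
  have s: "same_guess s s" using L by (simp add: same_guess_def)
  have "same_guess s (den I search_prog s) \<and> layers (den I search_prog s) =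
      fold (\<lambda>_. pass ?v ?A) [0..<nval I s (NAdd (times_nexp passes (NAdd GroundSize (NConst 1))) (NConst 1))] (layers s)"
    unfolding search_prog_def
    by (rule den_For_abs[where C = "same_guess s"]) (use lx upd s in \<open>auto simp del: upt_Suc\<close>)
  then show ?thesis by (simp add: fold_const pass_count_def del: upt_Suc)
qed

text \<open>The conditions on \<open>X\<close> in \<open>local_optimum_approx\<close> apart from
  local optimality. They survive moves because only \<open>y\<close> can be new, and acceptance
  tests it.\<close>

definition valid_layers :: "nat set \<Rightarrow> (nat \<Rightarrow> nat) \<Rightarrow> bool" where
  "valid_layers A L \<longleftrightarrow> covered E A L {1..\<nu>} \<in> indep_sets I \<and>
     (\<forall>e \<in> covered E A L {1..\<nu>} - A. admissible A e)"

lemma valid_try_move: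
  assumes "valid_layers A L"
  shows "valid_layers A (try_move v A x y l L)"
proof (cases "accepted v A y L (L(x := 0, y := l))")
  case True
  let ?L = "L(x := 0, y := l)"
  have "covered E A ?L {1..\<nu>} \<subseteq> insert y (covered E A L {1..\<nu>})"
    by (auto simp: covered_def split: if_splits)
  then have "valid_layers A ?L"
    using True assms by (auto simp: valid_layers_def accepted_def)
  then show ?thesis using True by (simp add: try_move_def valid_layers_def)
qed (simp add: assms try_move_def)

lemma valid_fold:
  assumes "\<And>i L. valid_layers A L \<Longrightarrow> valid_layers A (F i L)"
  shows "valid_layers A L \<Longrightarrow> valid_layers A (fold F is L)"
  using assms by (induction "is" arbitrary: L) simp_all

lemma valid_pass: "valid_layers A L \<Longrightarrow> valid_layers A ((pass v A ^^ k) L)"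
proof (induction k)
  case (Suc k)
  have "valid_layers A (pass v A L)" if "valid_layers A L" for L
    unfolding pass_def using that
    by (rule valid_fold[rotated]) (rule valid_fold[rotated], assumption,
      rule valid_fold[rotated], assumption, rule valid_try_move)
  then show ?case using Suc by simp
qed simp

lemma threshold_pos: "0 < threshold"
  using m_pos by (simp add: threshold_def)

lemma progressive_pass:
  "progressive threshold (potential v A) (pass v A)
     (\<Union>x\<in>set [0..<n + 1]. \<Union>y\<in>set [0..<n + 1]. \<Union>l\<in>set [0..<Suc \<nu>]. {try_move v A x y l})"
  unfolding pass_def
  using threshold_pos
  by (intro progressive_fold) (auto simp: progressive_def try_move_def accepted_def)

lemma potential_le:
  assumes "A \<subseteq> E" "0 \<le> v"
  shows "potential v A L \<le> real \<nu>"
proof -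
  interpret PC: packing_covering E "indep_sets I" pack cov n p c m \<nu> "truncate_at v f"
    by (rule packing_covering_truncated[OF assms(2)])
  have "covered E A L J \<subseteq> E" for J using assms by (auto simp: covered_def)
  then have "layered_value E A \<nu> (truncate_at v f) L \<le> (\<Sum>J\<in>Pow {1..\<nu>}. layer_weight \<nu> (card J))"
    unfolding layered_value_def using PC.phi_le_1 by (intro sum_mono mult_left_le layer_weight_nonneg) auto
  also have "\<dots> \<le> real \<nu>" by (rule layer_weight_sum_le[OF PC.nu1])
  finally have "layered_value E A \<nu> (truncate_at v f) L \<le> real \<nu>" .
  moreover have "0 \<le> 4 * real m ^ 2 * (\<Sum>i<p + c. (max 0 (violation A (covered E A L {1..\<nu>}) i))\<^sup>2)"
    by (intro mult_nonneg_nonneg sum_nonneg) auto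
  ultimately show ?thesis by (simp add: potential_def)
qed

text \<open>At the start the set is \<open>A\<close> itself. Its packing load beyond
  \<open>A\<close> is 0, so no excess is positive, and each of the \<open>c\<close> deficits is at
  most 1.\<close>

lemma potential_zero_ge:
  assumes "A \<subseteq> E" "0 \<le> v" and L: "\<And>i. i < n \<Longrightarrow> L i = 0"
  shows "- (4 * real m ^ 2 * real c) \<le> potential v A L"
proof -
  interpret PC: packing_covering E "indep_sets I" pack cov n p c m \<nu> "truncate_at v f"
    by (rule packing_covering_truncated[OF assms(2)])
  have "covered E A L J \<subseteq> E" for J using assms by (auto simp: covered_def)
  then have "0 \<le> layered_value E A \<nu> (truncate_at v f) L"
    unfolding layered_value_def using PC.phi_nonneg by (intro sum_nonneg mult_nonneg_nonneg layer_weight_nonneg) auto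
  moreover have "(\<Sum>i<p + c. (max 0 (violation A (covered E A L {1..\<nu>}) i))\<^sup>2) \<le> real c"
  proof -
    have X: "covered E A L {1..\<nu>} = A" using L by (auto simp: covered_def)
    have "1 / real m \<le> 1" using m_pos by simp
    then have "(\<Sum>i<p. (max 0 (excess m (pack i) A A))\<^sup>2) = 0" by (simp add: excess_def)
    moreover have "(\<Sum>i<c. (max 0 (deficit m (cov i) A))\<^sup>2) \<le> (\<Sum>i<c. 1)"
    proof (rule sum_mono)
      fix i
      have "0 \<le> sum (cov i) A" using cov_nonneg by (simp add: sum_nonneg)
      moreover have "0 \<le> 2 / real m" by simp
      ultimately have "deficit m (cov i) A \<le> 1" unfolding deficit_def by linarith
      then have "max 0 (deficit m (cov i) A) \<le> 1" by simp
      then show "(max 0 (deficit m (cov i) A))\<^sup>2 \<le> 1" by (intro power_le_one) auto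
    qed
    ultimately show ?thesis unfolding X sum_violation by simp
  qed
  then have "4 * real m ^ 2 * (\<Sum>i<p + c. (max 0 (violation A (covered E A L {1..\<nu>}) i))\<^sup>2) \<le> 4 * real m ^ 2 * real c"
    by (intro mult_left_mono) auto
  ultimately show ?thesis by (simp add: potential_def)
qed

lemma search_local_optimum:
  assumes A: "guess_loaded s" "guess_set s \<in> indep_sets I" and v: "0 \<le> guess_value s" and L: "\<And>i. i < n \<Longrightarrow> nats s ''s'' i = 0"
  defines "K \<equiv> layers (den I search_prog s)"
  shows "valid_layers (guess_set s) K" and
    "packing_covering.local_optimum E (indep_sets I) pack cov n p c m \<nu> (truncate_at (guess_value s) f) (guess_set s) K"
proof -
  let ?A = "guess_set s" and ?v = "guess_value s"
  interpret PC: packing_covering E "indep_sets I" pack cov n p c m \<nu> "truncate_at ?v f"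
    by (rule packing_covering_truncated[OF v])
  have K: "K = (pass ?v ?A ^^ pass_count) (layers s)"
    using search_prog_correct[OF A(1)] L by (simp add: K_def)
  have AE: "?A \<subseteq> E" by (auto simp: set_of_array_def)
  have "covered E ?A (layers s) {1..\<nu>} = ?A" using L by (auto simp: covered_def restrict_layers_def)
  then have "valid_layers ?A (layers s)" using A(2) by (simp add: valid_layers_def)
  then show "valid_layers ?A K" unfolding K by (rule valid_pass)
  \<comment> \<open>Gaining the threshold in every round would exceed the range of the potential;
    the one additional round makes the inequality strict.\<close>
  have "potential ?v ?A K < potential ?v ?A (layers s) + real pass_count * threshold"
  proof -
    have "real pass_count * threshold = real (\<nu> + 4 * m ^ 2 * c) + threshold"
    proof -
      have "real pass_count = real (\<nu> + 4 * m ^ 2 * c) * (2 * real m * (real n + 1)) + 1"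
        by (simp add: pass_count_def passes_def algebra_simps)
      moreover have "(2 * real m * (real n + 1)) * threshold = 1"
        using m_pos by (simp add: threshold_def)
      ultimately show ?thesis by (simp only: distrib_right mult.assoc mult_1_left mult_1_right)
    qed
    moreover have "potential ?v ?A K \<le> real \<nu>" by (rule potential_le[OF AE v])
    moreover have "- (4 * real m ^ 2 * real c) \<le> potential ?v ?A (layers s)"
      by (rule potential_zero_ge[OF AE v]) (simp add: L restrict_layers_def)
    ultimately show ?thesis using threshold_pos by simp
  qed
  then have stable: "try_move ?v ?A x y l K = K" if "x \<le> n" "y \<le> n" "l \<le> \<nu>" for x y l
  proof -
    have "\<forall>g\<in>(\<Union>x\<in>set [0..<n + 1]. \<Union>y\<in>set [0..<n + 1]. \<Union>l\<in>set [0..<Suc \<nu>]. {try_move ?v ?A x y l}). g K = K"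
      using progressive_stable[OF progressive_pass, of ?v ?A pass_count "layers s"]
        \<open>potential ?v ?A K < potential ?v ?A (layers s) + real pass_count * threshold\<close> unfolding K by blast
    moreover have "try_move ?v ?A x y l \<in> (\<Union>x\<in>set [0..<n + 1]. \<Union>y\<in>set [0..<n + 1]. \<Union>l\<in>set [0..<Suc \<nu>]. {try_move ?v ?A x y l})"
      using that by (intro UN_I[of x] UN_I[of y] UN_I[of l]) auto
    ultimately show ?thesis by blast
  qed
  have val: "PC.local_value B L' = potential ?v B L'" for B L'
    by (simp add: PC.local_value_def PC.penalty_def potential_def sum_violation)
  have adm: "PC.admissible = admissible"
    by (simp add: fun_eq_iff PC.admissible_def admissible_def)
  have thr: "PC.threshold = threshold"
    by (simp add: PC.threshold_def threshold_def card_E)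
  show "PC.local_optimum ?A K"
    unfolding PC.local_optimum_def
  proof (intro ballI allI impI)
    fix x y l assume xy: "x \<in> insert n E" "y \<in> insert n E" "l \<le> \<nu>"
      and ad: "PC.admissible ?A y" and ind: "covered E ?A (K(x := 0, y := l)) {1..\<nu>} \<in> indep_sets I"
    have eq: "try_move ?v ?A x y l K = K" using xy by (intro stable) auto
    \<comment> \<open>An accepted move must raise the potential, but stationarity of
      \<open>K\<close> leaves it unchanged.\<close>
    have "\<not> accepted ?v ?A y K (K(x := 0, y := l))"
    proof
      assume acc: "accepted ?v ?A y K (K(x := 0, y := l))"
      then have "K = restrict_layers (K(x := 0, y := l))" using eq by (simp add: try_move_def)
      then have "potential ?v ?A K = potential ?v ?A (K(x := 0, y := l))" by (metis potential_restrict)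
      then show False using acc threshold_pos by (simp add: accepted_def)
    qed
    then show "PC.local_value ?A (K(x := 0, y := l)) \<le> PC.local_value ?A K + PC.threshold"
      using ad ind unfolding val adm thr by (simp add: accepted_def not_less)
  qed
qed

end

section \<open>Enumeration of the guesses\<close>

text \<open>The pattern of exhaustive guessing: \<open>D\<close> is an invariant, \<open>Q\<close> a
  goal that is never lost again and that is reached once the variables in \<open>V\<close> hold the
  right values \<open>val\<close>. Each enclosing loop discharges one variable, since one of its
  rounds has the right value and the later rounds preserve \<open>Q\<close>.\<close>

definition establishes ::
  "mpc_input \<Rightarrow> (state \<Rightarrow> bool) \<Rightarrow> (state \<Rightarrow> bool) \<Rightarrow> prog \<Rightarrow> string set \<Rightarrow> (string \<Rightarrow> nat) \<Rightarrow> bool" where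
  "establishes I D Q q V val \<longleftrightarrow> (\<forall>s. D s \<longrightarrow> D (den I q s)) \<and> (\<forall>s. D s \<longrightarrow> Q s \<longrightarrow> Q (den I q s)) \<and>
     (\<forall>s. D s \<longrightarrow> (\<forall>z\<in>V. nats s z 0 = val z) \<longrightarrow> Q (den I q s))"

lemma establishes_For:
  assumes q: "establishes I D Q q (insert x V) val" and V: "V \<inter> nats_of q = {}" "x \<notin> V"
    and b: "\<And>s. nval I s b = k" "val x < k"
    and D: "\<And>s i. D (nat_update x 0 i s) = D s" and Q: "\<And>s i. Q (nat_update x 0 i s) = Q s"
  shows "establishes I D Q (For x b q) V val"
proof -
  let ?body = "\<lambda>i s. den I q (nat_update x 0 i s)"
  have body: "D s \<Longrightarrow> D (?body i s)" "D s \<Longrightarrow> Q s \<Longrightarrow> Q (?body i s)" for i s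
    using q D Q by (simp_all add: establishes_def)
  have den: "den I (For x b q) s = nat_update x 0 k (fold ?body [0..<k] s)" for s
    by (simp add: b)
  have foldD: "D (fold ?body [0..<j] s)" if "D s" for j s
    using that body by (induction j) simp_all
  have foldQ: "D (fold ?body [0..<j] s) \<and> Q (fold ?body [0..<j] s)" if "D s" "Q s" for j s
    using that body by (induction j) simp_all
  have est: "Q (fold ?body [0..<k] s)" if s: "D s" "\<forall>z\<in>V. nats s z 0 = val z" for s
  proof -
    have "nats (fold ?body [0..<j] s) z 0 = val z" if "z \<in> V" for j z
    proof (induction j)
      case (Suc j)
      have "z \<notin> nats_of q" "z \<noteq> x" using V that by auto
      then show ?case using Suc by (simp add: nats_den nats_nat_update)
    qed (use s that in simp)
    then have "\<forall>z\<in>insert x V. nats (nat_update x 0 (val x) (fold ?body [0..<val x] s)) z 0 = val z"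
      using V(2) by (auto simp: nats_nat_update)
    then have start: "Q (fold ?body [0..<Suc (val x)] s)"
      using q foldD[OF s(1), of "val x"] D by (simp add: establishes_def)
    have "D (fold ?body [0..<Suc (val x) + d] s) \<and> Q (fold ?body [0..<Suc (val x) + d] s)" for d
    proof (induction d)
      case 0
      then show ?case using start foldD[OF s(1), of "Suc (val x)"] by simp
    next
      case (Suc d)
      then show ?case using body by simp
    qed
    from this[of "k - Suc (val x)"] show ?thesis using b(2) by simp
  qed
  show ?thesis unfolding establishes_def den D Q using foldD foldQ est by blast
qed

section \<open>Single trials and the right guess\<close>

context program_run
begin

abbreviation output_set :: "state \<Rightarrow> nat set" where
  "output_set s \<equiv> set_of_array I s ''output''"

definition approx_feasible :: "nat set \<Rightarrow> bool" where
  "approx_feasible X \<longleftrightarrow> X \<in> indep_sets I \<and> (\<forall>i<p. sum (pack i) X \<le> 1) \<and> (\<forall>i<c. 1 - 3 / real m \<le> sum (cov i) X)"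

text \<open>In the trial with the right guess a stored set of at least the same value may block the
  update; the invariant makes this set approximately feasible as well.\<close>

definition sound :: "state \<Rightarrow> bool" where
  "sound s \<longleftrightarrow> (nats s ''found'' 0 \<noteq> 0 \<longrightarrow> approx_feasible (output_set s))"

definition reached :: "real \<Rightarrow> state \<Rightarrow> bool" where
  "reached t s \<longleftrightarrow> nats s ''found'' 0 \<noteq> 0 \<and> approx_feasible (output_set s) \<and> t \<le> f (output_set s)"

lemma sound_reached_update:
  assumes "z \<noteq> ''found''" "z \<noteq> ''output''"
  shows "sound (nat_update z 0 k s) = sound s" "reached t (nat_update z 0 k s) = reached t s"
  using assms by (simp_all add: sound_def reached_def set_of_array_def nats_nat_update)

lemma prepare_prog_correct:
  defines "s' \<equiv> \<lambda>s. den I prepare_prog s"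
  shows "guess_set (s' s) = {i \<in> E. \<exists>k<\<kappa>. i = nats s (guess_var k) 0}"
    "guess_value (s' s) = real (nats s ''j'' 0) * f {i \<in> E. i = nats s ''e'' 0} / real m"
    "\<And>i. i < n \<Longrightarrow> nats (s' s) ''s'' i = 0" "guess_loaded (s' s)"
    "nats (s' s) ''found'' = nats s ''found''" "nats (s' s) ''output'' = nats s ''output''"
proof -
  let ?g = "map (\<lambda>k. NSet ''a'' (scalar (guess_var k)) (NConst 1))"
  define s1 where "s1 = den I (clear_prog ''a'') s"
  define s2 where "s2 = fold (den I) (?g [0..<\<kappa>]) s1"
  define s3 where "s3 = den I (clear_prog ''one'') s2"
  define s4 where "s4 = nat_update ''one'' (nats s3 ''e'' 0) 1 s3"
  define s5 where "s5 = den I (clear_prog ''s'') s4"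
  define s6 where "s6 = den I (union_prog ''s'') (den I (layers_prog []) s5)"
  define s7 where "s7 = den I (load_prog ''A'') s6"
  have s': "s' s = s7"
    by (simp add: s'_def prepare_prog_def s7_def s6_def s5_def s4_def s3_def s2_def s1_def den_blocks)
  have n1: "nats s1 z = nats s z" if "z \<noteq> ''i''" "z \<noteq> ''a''" for z
    unfolding s1_def using that by (intro nats_den) simp
  have a2: "nats (fold (den I) (?g [0..<k]) s1) ''a'' i = (if \<exists>l<k. i = nats s (guess_var l) 0 then 1 else nats s1 ''a'' i) \<and>
    (\<forall>z. z \<noteq> ''a'' \<longrightarrow> nats (fold (den I) (?g [0..<k]) s1) z = nats s1 z)" for k i
    by (induction k) (auto simp: nats_nat_update n1 less_Suc_eq)
  have n2: "nats s2 z = nats s z" if "z \<noteq> ''i''" "z \<noteq> ''a''" for z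
    using a2 n1 that by (simp add: s2_def)
  have n3: "nats s3 z = nats s2 z" if "z \<noteq> ''i''" "z \<noteq> ''one''" for z
    unfolding s3_def using that by (intro nats_den) simp
  have n4: "nats s4 z = nats s3 z" if "z \<noteq> ''one''" for z
    using that by (simp add: s4_def nats_nat_update)
  have n5: "nats s5 z = nats s4 z" if "z \<noteq> ''i''" "z \<noteq> ''s''" for z
    unfolding s5_def using that by (intro nats_den) simp
  have n6: "nats s6 z = nats s5 z" if "z \<noteq> ''i''" "z \<noteq> ''u''" "z \<noteq> ''jj''" for z
    unfolding s6_def using that by (simp add: nats_den eval_frame)
  have n7: "nats s7 z = nats s6 z" if "z \<noteq> ''i''" for z
    unfolding s7_def by (rule nats_den_subset[OF eval_frame(5)]) (use that in simp)
  have a7: "nats s7 ''a'' = nats s2 ''a''" using n7 n6 n5 n4 n3 by simp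
  have "nats s2 ''a'' i \<noteq> 0 \<longleftrightarrow> (\<exists>k<\<kappa>. i = nats s (guess_var k) 0)" if "i < n" for i
  proof -
    have "nats s1 ''a'' i = 0" using that by (simp add: s1_def den_clear_prog)
    then show ?thesis using conjunct1[OF a2[of \<kappa> i]] by (simp add: s2_def)
  qed
  then have a: "guess_set s7 = {i \<in> E. \<exists>k<\<kappa>. i = nats s (guess_var k) 0}"
    unfolding set_of_array_def a7 by (intro Collect_cong conj_cong refl) simp
  then show "guess_set (s' s) = {i \<in> E. \<exists>k<\<kappa>. i = nats s (guess_var k) 0}" by (simp add: s')
  have "nats s7 ''one'' = nats s4 ''one''" using n7 n6 n5 by simp
  moreover have "nats s4 ''one'' i \<noteq> 0 \<longleftrightarrow> i = nats s ''e'' 0" if "i < n" for i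
  proof -
    have "nats s3 ''one'' i = 0" using that by (simp add: s3_def den_clear_prog)
    moreover have "nats s3 ''e'' 0 = nats s ''e'' 0" using n3 n2 by simp
    ultimately show ?thesis by (simp add: s4_def nats_nat_update)
  qed
  ultimately have "set_of_array I s7 ''one'' = {i \<in> E. i = nats s ''e'' 0}"
    unfolding set_of_array_def by (intro Collect_cong conj_cong refl) simp
  then show "guess_value (s' s) = real (nats s ''j'' 0) * f {i \<in> E. i = nats s ''e'' 0} / real m"
    using n7 n6 n5 n4 n3 n2 by (simp add: s' guess_exp_def)
  show z: "nats (s' s) ''s'' i = 0" if "i < n" for i
    using that n7 n6 by (simp add: s' s5_def den_clear_prog)
  have "nats s5 ''s'' i \<le> \<nu>" "nats s5 ''s'' i = 0" if "i < n" for i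
    using that by (simp_all add: s5_def den_clear_prog)
  then have "set_of_array I s6 ''u'' = guess_set s5"
    using layers_union_set[of "''s''" s5 "[]"] by (simp add: s6_def covered_def)
  also have "\<dots> = guess_set s7" using n7 n6 by (intro guess_set_cong) simp
  finally have u: "set_of_array I s6 ''u'' = guess_set s7" .
  have "reals s7 ''A'' (Suc i) = load (guess_set s7) i" if "i < p + c" for i
    using load_prog_cell[of "''A''" i s6, OF _ that] u by (simp add: s7_def)
  then show "guess_loaded (s' s)" by (simp add: s' guess_loaded_def)
  show "nats (s' s) ''found'' = nats s ''found''" "nats (s' s) ''output'' = nats s ''output''"
    using n7 n6 n5 n4 n3 n2 by (simp_all add: s')
qed

lemma bval_feasible_exp:
  assumes "\<And>i. i < p + c \<Longrightarrow> reals s ''S'' (Suc i) = load (set_of_array I s ''u'') i"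
  shows "bval I s feasible_exp \<longleftrightarrow> approx_feasible (set_of_array I s ''u'')"
proof -
  let ?X = "set_of_array I s ''u''"
  have "(\<forall>i<p + c. bval I s (if i < p then BNot (RLess (real_const 1) (load_exp ''S'' i))
       else BNot (RLess (load_exp ''S'' i) (RSub (real_const 1) (RDiv (real_const 3) (real_const m)))))) \<longleftrightarrow>
     (\<forall>i<p + c. if i < p then sum (pack i) ?X \<le> 1 else 1 - 3 / real m \<le> sum (cov (i - p)) ?X)"
    using assms by (intro all_cong) (simp add: load_exp_def load_def not_less)
  also have "\<dots> \<longleftrightarrow> (\<forall>i<p. sum (pack i) ?X \<le> 1) \<and> (\<forall>i<c. 1 - 3 / real m \<le> sum (cov i) ?X)"
    (is "?l \<longleftrightarrow> ?r")
  proof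
    assume l: ?l
    show ?r
    proof (intro conjI allI impI)
      fix i assume "i < p"
      then show "sum (pack i) ?X \<le> 1" using l[rule_format, of i] by simp
    next
      fix i assume "i < c"
      then show "1 - 3 / real m \<le> sum (cov i) ?X" using l[rule_format, of "p + i"] by simp
    qed
  next
    assume r: ?r
    show ?l
    proof (intro allI impI)
      fix i assume "i < p + c"
      then show "if i < p then sum (pack i) ?X \<le> 1 else 1 - 3 / real m \<le> sum (cov (i - p)) ?X"
        using r by (cases "i < p") simp_all
    qed
  qed
  finally show ?thesis
    by (simp only: feasible_exp_def bval.simps bval_conj_exp_upt approx_feasible_def)
qed

definition search_result :: "state \<Rightarrow> nat set" where
  "search_result s = covered E (guess_set (den I prepare_prog s)) (layers (den I search_prog (den I prepare_prog s))) {1..\<nu>}"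

lemma trial_prog_correct:
  "nats (den I trial_prog s) ''found'' 0 = (if approx_feasible (search_result s) \<and>
     (nats s ''found'' 0 = 0 \<or> f (output_set s) < f (search_result s)) then 1 else nats s ''found'' 0)"
  "output_set (den I trial_prog s) = (if approx_feasible (search_result s) \<and>
     (nats s ''found'' 0 = 0 \<or> f (output_set s) < f (search_result s)) then search_result s else output_set s)"
proof -
  define s1 where "s1 = den I prepare_prog s"
  define s2 where "s2 = den I search_prog s1"
  define s3 where "s3 = den I (eval_prog ''s'' ''S'') s2"
  note prep = prepare_prog_correct[where s = s, folded s1_def]
  have L1: "nats s1 ''s'' i \<le> \<nu>" if "i < n" for i using prep(3) that by simp
  have same: "same_guess s1 s2" using search_prog_correct[OF prep(4) L1] by (simp add: s2_def)
  have g2: "guess_loaded s2" "guess_set s2 = guess_set s1"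
    using prep(4) guess_loaded_cong[of s2 s1] guess_set_cong[of s2 s1] same by (simp_all add: same_guess_def)
  have L2: "nats s2 ''s'' i \<le> \<nu>" if "i < n" for i using same that by (simp add: same_guess_def)
  have u3: "set_of_array I s3 ''u'' = covered E (guess_set s2) (nats s2 ''s'') {1..\<nu>}"
    and e3: "evaluated ''S'' (guess_value s2) (guess_set s2) (nats s2 ''s'') s3"
    using eval_prog_correct[of "''s''" "''S''" s2] g2(1) L2 by (simp_all add: s3_def)
  have X: "set_of_array I s3 ''u'' = search_result s"
    by (simp add: u3 g2 search_result_def s2_def[symmetric] s1_def[symmetric])
  have fo: "nats s3 z = nats s z" if "z = ''found'' \<or> z = ''output''" for z
  proof -
    have "nats s3 z = nats s2 z"
      unfolding s3_def by (rule nats_den_subset[OF eval_frame(7)]) (use that in auto)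
    also have "\<dots> = nats s1 z"
      unfolding s2_def by (rule nats_den_subset[OF search_frame(1)]) (use that in auto)
    finally show ?thesis using prep(5,6) that by auto
  qed
  have out: "output_set s3 = output_set s" using fo by (simp add: set_of_array_def)
  have "bval I s3 feasible_exp \<longleftrightarrow> approx_feasible (search_result s)"
    using bval_feasible_exp[of s3] e3 u3 X by (simp add: evaluated_def)
  then have c: "bval I s3 (BAnd feasible_exp (BNot (BAnd (NLess (NConst 0) (scalar ''found''))
       (BNot (RLess (ValueQuery ''output'') (ValueQuery ''u'')))))) \<longleftrightarrow>
     approx_feasible (search_result s) \<and> (nats s ''found'' 0 = 0 \<or> f (output_set s) < f (search_result s))"
    using fo out X by simp
  have copy: "nats (den I (copy_prog ''u'' ''output'') s3) ''output'' =
      (\<lambda>i. if i < n then nats s3 ''u'' i else nats s3 ''output'' i)"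
    by (rule den_copy_prog) simp_all
  have den: "den I trial_prog s = (if approx_feasible (search_result s) \<and> (nats s ''found'' 0 = 0 \<or> f (output_set s) < f (search_result s))
    then nat_update ''found'' 0 1 (den I (copy_prog ''u'' ''output'') s3) else s3)"
    unfolding c[symmetric] s3_def s2_def s1_def
    by (simp only: trial_prog_def finish_prog_def den.simps nval.simps)
  have "set_of_array I (nat_update ''found'' 0 1 (den I (copy_prog ''u'' ''output'') s3)) ''output'' = search_result s"
    unfolding X[symmetric] by (auto simp: set_of_array_def nats_nat_update copy)
  then show "output_set (den I trial_prog s) = (if approx_feasible (search_result s) \<and>
     (nats s ''found'' 0 = 0 \<or> f (output_set s) < f (search_result s)) then search_result s else output_set s)"
    unfolding den using out by auto
  show "nats (den I trial_prog s) ''found'' 0 = (if approx_feasible (search_result s) \<and>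
     (nats s ''found'' 0 = 0 \<or> f (output_set s) < f (search_result s)) then 1 else nats s ''found'' 0)"
    unfolding den using fo by (auto simp: nats_nat_update)
qed

text \<open>Since \<open>v \<le> f Opt\<close>, the truncated objective is 1 at the optimum, as
  \<open>local_optimum_approx\<close> requires; multiplication by \<open>v\<close> leads back to
  \<open>f\<close>. This is why the value is guessed from below.\<close>

lemma search_result_good:
  assumes A: "guess_set (den I prepare_prog s) = A" "A \<subseteq> Opt" and v: "guess_value (den I prepare_prog s) = v" "0 \<le> v" "v \<le> f Opt"
    and Opt: "Opt \<in> indep_sets I" "\<And>i. i < p \<Longrightarrow> sum (pack i) Opt \<le> 1" "\<And>i. i < c \<Longrightarrow> 1 \<le> sum (cov i) Opt"
    and guess: "\<And>e. e \<in> Opt - A \<Longrightarrow> truncate_at v f (insert e A) - truncate_at v f A \<le> 1 / real (fine_scale m p c)"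
      "\<And>e i. e \<in> Opt - A \<Longrightarrow> i < c \<Longrightarrow> 1 \<le> sum (cov i) A \<or> cov i e * real (fine_scale m p c) \<le> 1"
  shows "approx_feasible (search_result s) \<and> v * (layer_ratio \<nu> - 4 / real m) \<le> f (search_result s)"
proof -
  interpret PC: packing_covering E "indep_sets I" pack cov n p c m \<nu> "truncate_at v f"
    by (rule packing_covering_truncated[OF v(2)])
  define s1 where "s1 = den I prepare_prog s"
  define K where "K = layers (den I search_prog s1)"
  note prep = prepare_prog_correct[where s = s, folded s1_def]
  have A1: "guess_set s1 = A" "guess_value s1 = v" using A v by (simp_all add: s1_def)
  have AI: "A \<in> indep_sets I" using matroid_downward[OF indep_matroid Opt(1) A(2)] .
  have loc: "valid_layers A K" "PC.local_optimum A K"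
    using search_local_optimum[OF prep(4), unfolded A1, OF AI v(2) prep(3)] by (simp_all add: K_def)
  have X: "search_result s = covered E A K {1..\<nu>}"
    by (simp add: search_result_def K_def A1 s1_def[symmetric])
  have XE: "search_result s \<subseteq> E"
    using indep_matroid loc(1) unfolding X valid_layers_def matroid_def by auto
  have "(\<forall>i<p. sum (pack i) (search_result s) \<le> 1) \<and> (\<forall>i<c. 1 - 3 / real m \<le> sum (cov i) (search_result s)) \<and>
    layer_ratio \<nu> - 4 / real m \<le> truncate_at v f (search_result s)"
  proof (rule PC.local_optimum_approx[OF A(2) Opt _ guess X _ _ loc(2)])
    show "truncate_at v f Opt = 1" using v by (simp add: truncate_at_def)
    show "search_result s \<in> indep_sets I" using loc(1) by (simp add: valid_layers_def X)
    show "PC.admissible A e" if "e \<in> search_result s - A" for e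
      using loc(1) that by (simp add: valid_layers_def X PC.admissible_def admissible_def)
  qed
  moreover have "v * truncate_at v f (search_result s) \<le> f (search_result s)"
    using truncate_at_bounds(3)[of f "search_result s" v] f_nonneg[OF XE] v(2) by simp
  moreover have "search_result s \<in> indep_sets I" using loc(1) by (simp add: valid_layers_def X)
  ultimately show ?thesis
    using mult_left_mono[of "layer_ratio \<nu> - 4 / real m" "truncate_at v f (search_result s)" v] v(2)
    by (auto simp: approx_feasible_def)
qed

text \<open>The optimum lies between the value \<open>g\<close> of its best single element and
  \<open>n * g\<close>. Hence a multiple of \<open>g / m\<close> with a factor of at most
  \<open>m * n\<close> approximates it from below up to \<open>g / m\<close>, which is at most a
  \<open>1 / m\<close> part of it.\<close>

lemma value_guess:
  assumes "Opt \<subseteq> E"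
  shows "\<exists>e j. e \<le> n \<and> j \<le> m * (n + 1) \<and> real j * f {i \<in> E. i = e} / real m \<le> f Opt \<and>
    (1 - 1 / real m) * f Opt \<le> real j * f {i \<in> E. i = e} / real m"
proof (cases "Opt = {}")
  case True
  \<comment> \<open>The index \<open>n\<close> denotes no element, so the guessed singleton is empty
    and equals \<open>Opt\<close>.\<close>
  have "{i \<in> E. i = n} = Opt" using True by auto
  moreover have "0 \<le> f Opt" using f_nonneg assms by simp
  then have "(1 - 1 / real m) * f Opt \<le> 1 * f Opt" by (intro mult_right_mono) auto
  ultimately show ?thesis using m_pos by (intro exI[of _ n] exI[of _ m]) simp
next
  case False
  have fin: "finite Opt" using assms finite_E finite_subset by auto
  obtain e where e: "e \<in> Opt" and max: "\<And>x. x \<in> Opt \<Longrightarrow> f {x} \<le> f {e}"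
  proof -
    have ne: "finite ((\<lambda>x. f {x}) ` Opt)" "(\<lambda>x. f {x}) ` Opt \<noteq> {}" using fin False by auto
    from Max_in[OF this] obtain e where "e \<in> Opt" "f {e} = Max ((\<lambda>x. f {x}) ` Opt)" by auto
    then show ?thesis using that[of e] Max_ge[OF ne(1)] by auto
  qed
  have eE: "e < n" "{i \<in> E. i = e} = {e}" using e assms by auto
  define g where "g = f {e}"
  have g0: "0 \<le> g" using f_nonneg[of "{e}"] eE by (simp add: g_def)
  have lo: "g \<le> f Opt"
    unfolding g_def using e assms by (intro mono_submodular_on_mono[OF f_mono_submodular]) auto
  have hi: "f Opt \<le> real n * g"
  proof -
    have "f ({} \<union> Opt) - f {} \<le> (\<Sum>x\<in>Opt. f (insert x {}) - f {})"
      using assms fin by (intro sum_marginals_ge[OF f_mono_submodular]) auto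
    then have "f Opt \<le> (\<Sum>x\<in>Opt. f {x}) - real (card Opt) * f {} + f {}" by (simp add: sum_subtractf)
    \<comment> \<open>\<open>f {}\<close> may be positive; as \<open>Opt\<close> is nonempty, it is
      absorbed by the subtracted multiple.\<close>
    moreover have "f {} \<le> real (card Opt) * f {}"
    proof -
      have "1 \<le> card Opt" using False fin by (simp add: Suc_le_eq card_gt_0_iff)
      then show ?thesis using mult_right_mono[of 1 "real (card Opt)" "f {}"] f_nonneg[of "{}"] by simp
    qed
    moreover have "(\<Sum>x\<in>Opt. f {x}) \<le> real (card Opt) * g"
      using max by (intro sum_bounded_above) (simp add: g_def)
    moreover have "real (card Opt) * g \<le> real n * g"
      using card_mono[OF finite_E assms] g0 by (intro mult_right_mono) (simp_all add: card_E)
    ultimately show ?thesis by linarith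
  qed
  show ?thesis
  proof (cases "g = 0")
    case True
    then have "f Opt = 0" using lo hi by simp
    then show ?thesis by (intro exI[of _ n] exI[of _ 0]) simp
  next
    case g: False
    then have gp: "g > 0" using g0 by simp
    have mp: "real m > 0" using m_pos by simp
    \<comment> \<open>Rounding takes place in the proof only; the program runs through all values of
      \<open>j\<close>.\<close>
    define j where "j = nat \<lfloor>real m * f Opt / g\<rfloor>"
    have nn: "0 \<le> real m * f Opt / g" using lo gp mp by simp
    have j: "real j \<le> real m * f Opt / g" "real m * f Opt / g < real j + 1"
      using nn unfolding j_def by linarith+
    have "real m * f Opt \<le> real m * (real n * g)" using hi mp by (intro mult_left_mono) auto
    then have "real m * f Opt / g \<le> real m * real n" using gp by (simp add: divide_le_eq mult.assoc)
    then have "real j \<le> real (m * n)" using j(1) by simp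
    then have "j \<le> m * (n + 1)" by (simp only: of_nat_le_iff) simp
    moreover have "real j * g / real m \<le> f Opt"
      using j(1) gp mp by (simp add: le_divide_eq divide_le_eq mult.commute)
    moreover have "(1 - 1 / real m) * f Opt \<le> real j * g / real m"
    proof -
      have "real m * f Opt < (real j + 1) * g" using j(2) gp by (simp add: divide_less_eq)
      then have "f Opt < (real j + 1) * g / real m" using mp by (simp add: less_divide_eq mult.commute)
      then have "f Opt - g / real m < real j * g / real m" by (simp add: distrib_right add_divide_distrib)
      moreover have "g / real m \<le> f Opt / real m" using lo mp by (intro divide_right_mono) auto
      ultimately show ?thesis by (simp add: left_diff_distrib)
    qed
    ultimately show ?thesis using eE by (intro exI[of _ e] exI[of _ j]) (simp add: g_def)
  qed
qed

text \<open>The value \<open>n\<close> is no element and pads the guess, so that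
  \<open>\<kappa>\<close> variables also describe smaller sets.\<close>

lemma guess_enumeration:
  assumes "A \<subseteq> E" "card A \<le> \<kappa>"
  shows "\<exists>g :: nat \<Rightarrow> nat. (\<forall>k. g k \<le> n) \<and> {i \<in> E. \<exists>k<\<kappa>. i = g k} = A"
proof -
  have fin: "finite A" using assms(1) finite_E finite_subset by auto
  define xs where "xs = sorted_list_of_set A"
  have xs: "set xs = A" "length xs = card A" using fin by (simp_all add: xs_def)
  define g where "g k = (if k < length xs then xs ! k else n)" for k
  have gA: "g k \<in> A" if "k < length xs" for k using that xs(1) nth_mem by (auto simp: g_def)
  have "g k \<le> n" for k
  proof (cases "k < length xs")
    case True
    then have "g k \<in> E" using gA assms(1) by (blast intro: subsetD)
    then show ?thesis by simp
  qed (simp add: g_def)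
  moreover have "{i \<in> E. \<exists>k<\<kappa>. i = g k} = A"
  proof (intro equalityI subsetI)
    fix i assume "i \<in> {i \<in> E. \<exists>k<\<kappa>. i = g k}"
    then obtain k where k: "i < n" "i = g k" by auto
    then have "k < length xs" by (auto simp: g_def split: if_splits)
    then show "i \<in> A" using gA k by simp
  next
    fix i assume i: "i \<in> A"
    then obtain k where "k < length xs" "i = xs ! k" using xs(1) by (metis in_set_conv_nth)
    then show "i \<in> {i \<in> E. \<exists>k<\<kappa>. i = g k}" using i assms xs(2) by (auto simp: g_def intro!: exI[of _ k])
  qed
  ultimately show ?thesis by blast
qed

lemma main_prog_correct:
  assumes kappa: "(1 + 2 * c) * fine_scale m p c \<le> \<kappa>"
    and Opt: "Opt \<subseteq> E" "Opt \<in> indep_sets I" "\<And>i. i < p \<Longrightarrow> sum (pack i) Opt \<le> 1" "\<And>i. i < c \<Longrightarrow> 1 \<le> sum (cov i) Opt"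
  shows "\<exists>v. (1 - 1 / real m) * f Opt \<le> v \<and> 0 \<le> v \<and>
    reached (v * (layer_ratio \<nu> - 4 / real m)) (den I main_prog init_state)"
proof -
  obtain e j where ej: "e \<le> n" "j \<le> m * (n + 1)" "real j * f {i \<in> E. i = e} / real m \<le> f Opt"
    "(1 - 1 / real m) * f Opt \<le> real j * f {i \<in> E. i = e} / real m"
    using value_guess[OF Opt(1)] by blast
  define v where "v = real j * f {i \<in> E. i = e} / real m"
  have "{i \<in> E. i = e} \<subseteq> E" by auto
  then have v: "0 \<le> v" using f_nonneg by (simp add: v_def)
  interpret PC: packing_covering E "indep_sets I" pack cov n p c m \<nu> "truncate_at v f"
    by (rule packing_covering_truncated[OF v])
  obtain A where A: "A \<subseteq> Opt" "card A \<le> (1 + 2 * c) * fine_scale m p c"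
    "\<And>e. e \<in> Opt - A \<Longrightarrow> truncate_at v f (insert e A) - truncate_at v f A \<le> 1 / real (fine_scale m p c)"
    "\<And>e i. e \<in> Opt - A \<Longrightarrow> i < c \<Longrightarrow> 1 \<le> sum (cov i) A \<or> cov i e * real (fine_scale m p c) \<le> 1"
    using PC.guess_exists[OF Opt(1)] by blast
  obtain g where g: "\<And>k. g k \<le> n" "{i \<in> E. \<exists>k<\<kappa>. i = g k} = A"
    using guess_enumeration[of A] A(1,2) Opt(1) kappa by (meson order_trans)
  \<comment> \<open>The index of a guess variable is read off from the length of its name, which is
    \<open>Suc k\<close> by \<open>guess_var_def\<close>.\<close>
  define val where "val z = (if z = ''e'' then e else if z = ''j'' then j else g (length z - 1))" for z :: string
  have val: "val (guess_var k) = g k" for k by (simp add: val_def) (simp add: guess_var_def)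
  let ?t = "v * (layer_ratio \<nu> - 4 / real m)"
  let ?G = "\<lambda>k. guess_var ` {..<k}"
  have est: "establishes I sound (reached ?t) trial_prog (insert ''j'' (insert ''e'' (?G \<kappa>))) val"
    unfolding establishes_def
  proof (intro conjI allI impI)
    fix s assume s: "sound s"
    show "sound (den I trial_prog s)" using s by (simp add: sound_def trial_prog_correct)
    show "reached ?t (den I trial_prog s)" if "reached ?t s"
      using that by (simp add: reached_def trial_prog_correct)
    show "reached ?t (den I trial_prog s)"
      if z: "\<forall>z\<in>insert ''j'' (insert ''e'' (?G \<kappa>)). nats s z 0 = val z"
    proof -
      have gv: "nats s (guess_var k) 0 = g k" if "k < \<kappa>" for k using z that val by auto
      have "guess_set (den I prepare_prog s) = A"
        unfolding prepare_prog_correct(1) g(2)[symmetric] using gv by auto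
      moreover have "guess_value (den I prepare_prog s) = v"
        unfolding prepare_prog_correct(2) v_def using z by (simp add: val_def)
      ultimately have "approx_feasible (search_result s) \<and> ?t \<le> f (search_result s)"
        using A(1,3,4) v ej(3) Opt(2-4) by (intro search_result_good[of s A Opt v]) (auto simp: v_def)
      then show ?thesis using s by (auto simp: reached_def sound_def trial_prog_correct not_less)
    qed
  qed
  have fr: "z \<notin> nats_of trial_prog" if "z = ''e'' \<or> z = ''j'' \<or> (\<exists>k. z = guess_var k)" for z
    by (rule contra_subsetD[OF trial_frame]) (use that in \<open>elim disjE exE; simp\<close>)
  have nb: "\<And>s. nval I s (NAdd (times_nexp m (NAdd GroundSize (NConst 1))) (NConst 1)) = m * (n + 1) + 1"
    "\<And>s. nval I s (NAdd GroundSize (NConst 1)) = n + 1" by simp_all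
  let ?J = "For ''j'' (NAdd (times_nexp m (NAdd GroundSize (NConst 1))) (NConst 1)) trial_prog"
  let ?E = "For ''e'' (NAdd GroundSize (NConst 1)) ?J"
  have estJ: "establishes I sound (reached ?t) ?J (insert ''e'' (?G \<kappa>)) val"
  proof (rule establishes_For[OF est _ _ nb(1)])
    show "insert ''e'' (?G \<kappa>) \<inter> nats_of trial_prog = {}" using fr by auto
    show "''j'' \<notin> insert ''e'' (?G \<kappa>)" by (auto simp: guess_var_neqs[symmetric])
    show "val ''j'' < m * (n + 1) + 1" using ej(2) by (simp add: val_def)
  qed (simp_all add: sound_reached_update)
  have estE: "establishes I sound (reached ?t) ?E (?G \<kappa>) val"
  proof (rule establishes_For[OF estJ _ _ nb(2)])
    show "?G \<kappa> \<inter> nats_of ?J = {}" using fr by (auto simp: guess_var_neqs[symmetric])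
    show "''e'' \<notin> ?G \<kappa>" by (auto simp: guess_var_neqs[symmetric])
    show "val ''e'' < n + 1" using ej(1) by (simp add: val_def)
  qed (simp_all add: sound_reached_update)
  have loops: "establishes I sound (reached ?t) (guess_loops k q) {} val"
    if "establishes I sound (reached ?t) q (?G k) val" "\<And>i. i < k \<Longrightarrow> guess_var i \<notin> nats_of q" for k q
    using that
  proof (induction k arbitrary: q)
    case (Suc k)
    have "establishes I sound (reached ?t) (For (guess_var k) (NAdd GroundSize (NConst 1)) q) (?G k) val"
    proof (rule establishes_For[OF _ _ _ nb(2)])
      show "establishes I sound (reached ?t) q (insert (guess_var k) (?G k)) val"
        using Suc.prems(1) by (simp add: lessThan_Suc)
      show "?G k \<inter> nats_of q = {}" using Suc.prems(2) less_SucI by blast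
      show "guess_var k \<notin> ?G k" by auto
      show "val (guess_var k) < n + 1" using g(1)[of k] by (simp add: val)
    qed (simp_all add: sound_reached_update)
    moreover have "guess_var i \<notin> nats_of (For (guess_var k) (NAdd GroundSize (NConst 1)) q)" if "i < k" for i
      using Suc.prems(2)[of i] that by simp
    ultimately show ?case using Suc.IH by simp
  qed simp
  have "establishes I sound (reached ?t) main_prog {} val"
    unfolding main_prog_def by (rule loops[OF estE]) (use fr in simp)
  moreover have "sound init_state" by (simp add: sound_def init_state_def)
  ultimately have "reached ?t (den I main_prog init_state)" by (simp add: establishes_def)
  then show ?thesis using v ej(4) by (auto simp: v_def)
qed

section \<open>Matrix constraints and the final estimate\<close>

lemma matrix_row_sum:
  assumes "M \<in> carrier_mat k n" "i < k" "S \<subseteq> E"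
  shows "(M *\<^sub>v indicator_vec n S) $ i = (\<Sum>e\<in>S. read_entry M i e)"
proof -
  have "(M *\<^sub>v indicator_vec n S) $ i = (\<Sum>j = 0..<n. M $$ (i, j) * indicator S j)"
    using assms(1,2) by (simp add: scalar_prod_def indicator_vec_def)
  also have "\<dots> = (\<Sum>j\<in>S. M $$ (i, j) * indicator S j)"
    using assms(3) by (intro sum.mono_neutral_right) (auto simp: indicator_def ground_def)
  also have "\<dots> = (\<Sum>e\<in>S. read_entry M i e)"
    using assms by (intro sum.cong) (auto simp: read_entry_def)
  finally show ?thesis .
qed

lemma satisfies_packing_iff: "S \<subseteq> E \<Longrightarrow> satisfies_packing I S \<longleftrightarrow> (\<forall>i<p. sum (pack i) S \<le> 1)"
  using matrix_row_sum[OF inst_packing(1)]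
  by (auto simp: satisfies_packing_def less_eq_vec_def all_ones_def dims pack_def)

lemma satisfies_covering_iff: "S \<subseteq> E \<Longrightarrow> satisfies_covering \<alpha> I S \<longleftrightarrow> (\<forall>i<c. \<alpha> \<le> sum (cov i) S)"
  using matrix_row_sum[OF inst_covering(1)]
  by (auto simp: satisfies_covering_def less_eq_vec_def all_ones_def dims cov_def)

end

text \<open>One half of \<open>\<epsilon>\<close> is the distance of \<open>\<rho>\<close> from its
  limit \<open>r\<close>, the other half pays \<open>5 * \<eta>\<close>: four for the local search
  and one for the guessed value. If \<open>\<rho> - 4 * \<eta>\<close> is negative, the factor
  \<open>r - \<epsilon>\<close> is not positive either.\<close>

lemma approximation_arithmetic:
  fixes r \<rho> \<eta> \<epsilon> v a :: real
  assumes "r - \<epsilon> / 2 \<le> \<rho>" "\<rho> \<le> 1" "0 \<le> \<eta>" "10 * \<eta> \<le> \<epsilon>" "\<eta> \<le> 1" "0 \<le> a" "0 \<le> v" "(1 - \<eta>) * a \<le> v"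
    and y: "v * (\<rho> - 4 * \<eta>) \<le> y" "0 \<le> y"
  shows "(r - \<epsilon>) * a \<le> y"
proof (cases "0 \<le> \<rho> - 4 * \<eta>")
  case True
  have "\<eta> * (\<rho> - 4 * \<eta>) \<le> \<eta> * 1" using assms by (intro mult_left_mono) auto
  then have "\<rho> - 5 * \<eta> \<le> (1 - \<eta>) * (\<rho> - 4 * \<eta>)" by (simp add: algebra_simps)
  then have "r - \<epsilon> \<le> (1 - \<eta>) * (\<rho> - 4 * \<eta>)" using assms by linarith
  then have "(r - \<epsilon>) * a \<le> (1 - \<eta>) * (\<rho> - 4 * \<eta>) * a" using assms by (intro mult_right_mono) auto
  also have "\<dots> = ((1 - \<eta>) * a) * (\<rho> - 4 * \<eta>)" by simp
  also have "\<dots> \<le> v * (\<rho> - 4 * \<eta>)" using assms True by (intro mult_right_mono) auto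
  finally show ?thesis using y by simp
next
  case False
  then have "r - \<epsilon> \<le> 0" using assms by linarith
  then have "(r - \<epsilon>) * a \<le> 0" using assms by (simp add: mult_nonpos_nonneg)
  then show ?thesis using y by simp
qed

theorem theorem2:
  fixes p c :: nat and \<epsilon> \<delta> :: real
  assumes "\<epsilon> > 0" and "\<delta> > 0"
  shows "\<exists>(A :: com) (time :: nat poly) (space :: nat poly).
    \<forall>I. mpc_instance p c I \<and> (\<exists>S. feasible I S) \<longrightarrow>
      halts_within I A (poly time (ground_size I)) \<and>
      (\<forall>L. input_of_length L I \<longrightarrow> memory_of_length (poly space (ground_size I + L)) I A) \<and>
      (\<forall>Opt. optimal I Opt \<longrightarrow>
        measure_pmf.prob (output_after I A (poly time (ground_size I)))
          {S. S \<in> indep_sets I \<and>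
              objective I S \<ge> (1 - 1 / exp 1 - \<epsilon>) * objective I Opt \<and>
              satisfies_packing I S \<and>
              satisfies_covering (1 - \<epsilon>) I S}
        \<ge> 1 - \<delta>)"
proof -
  obtain m :: nat where m: "1 \<le> m" "10 * (1 / real m) \<le> \<epsilon>"
  proof -
    obtain k :: nat where k: "10 / \<epsilon> < real k" using reals_Archimedean2 by blast
    have "0 < 10 / \<epsilon>" using assms(1) by simp
    then have "0 < real k" using k by linarith
    then have "1 \<le> k" "10 * (1 / real k) \<le> \<epsilon>" using k assms(1) by (auto simp: field_simps)
    then show ?thesis by (rule that)
  qed
  obtain \<nu> where nu: "1 \<le> \<nu>" "1 - 1 / exp 1 - \<epsilon> / 2 \<le> layer_ratio \<nu>"
  proof -
    have "\<forall>\<^sub>F k in sequentially. 1 - 1 / exp 1 - \<epsilon> / 2 < layer_ratio k"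
      using order_tendstoD(1)[OF layer_ratio_tendsto, of "1 - 1 / exp 1 - \<epsilon> / 2"] assms(1) by simp
    then have "\<forall>\<^sub>F k in sequentially. 1 - 1 / exp 1 - \<epsilon> / 2 < layer_ratio k \<and> 1 \<le> k"
      using eventually_ge_at_top[of 1] by (rule eventually_conj)
    then obtain k where "1 - 1 / exp 1 - \<epsilon> / 2 < layer_ratio k \<and> 1 \<le> k"
      using eventually_happens'[OF sequentially_bot] by blast
    then show ?thesis using that[of k] by simp
  qed
  define \<kappa> where "\<kappa> = (1 + 2 * c) * fine_scale m p c"
  interpret program p c m \<nu> \<kappa> using m nu by unfold_locales
  obtain time space where compiled: "\<And>I. halts_within I (compile main_prog) (poly time (ground_size I)) \<and>
    (\<forall>L. input_of_length L I \<longrightarrow> memory_of_length (poly space (ground_size I + L)) I (compile main_prog)) \<and>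
    output_after I (compile main_prog) (poly time (ground_size I)) =
      return_pmf (set_of_array I (den I main_prog init_state) ''output'')"
    using compile_polynomial[OF main_ok] by blast
  have good: "S \<in> indep_sets I \<and> (1 - 1 / exp 1 - \<epsilon>) * objective I Opt \<le> objective I S \<and>
      satisfies_packing I S \<and> satisfies_covering (1 - \<epsilon>) I S"
    if inst: "mpc_instance p c I" and opt: "optimal I Opt"
      and S: "S = set_of_array I (den I main_prog init_state) ''output''" for I Opt S
  proof -
    interpret program_run p c m \<nu> \<kappa> I using inst by unfold_locales
    have Opt: "Opt \<subseteq> E" "Opt \<in> indep_sets I" "satisfies_packing I Opt" "satisfies_covering 1 I Opt"
      using opt by (simp_all add: optimal_def feasible_def)
    obtain v where v: "(1 - 1 / real m) * f Opt \<le> v" "0 \<le> v"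
      "reached (v * (layer_ratio \<nu> - 4 / real m)) (den I main_prog init_state)"
      using main_prog_correct[of Opt] Opt satisfies_packing_iff satisfies_covering_iff \<kappa>_def by auto
    have SE: "S \<subseteq> E" by (auto simp: S set_of_array_def)
    have feas: "approx_feasible S" and val: "v * (layer_ratio \<nu> - 4 / real m) \<le> f S"
      using v(3) by (simp_all add: reached_def S)
    have "1 - \<epsilon> \<le> 1 - 3 / real m" using m by (simp add: field_simps)
    then have "satisfies_covering (1 - \<epsilon>) I S"
      using feas satisfies_covering_iff[OF SE] by (auto simp: approx_feasible_def intro: order_trans)
    moreover have "(1 - 1 / exp 1 - \<epsilon>) * f Opt \<le> f S"
    proof (rule approximation_arithmetic[OF nu(2) layer_ratio_bounds(2)[OF nu(1)] _ m(2) _ f_nonneg[OF Opt(1)] v(2,1)])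
      show "v * (layer_ratio \<nu> - 4 * (1 / real m)) \<le> f S" using val by simp
    qed (use m(1) f_nonneg[OF SE] in simp_all)
    ultimately show ?thesis using feas satisfies_packing_iff[OF SE] by (simp add: approx_feasible_def)
  qed
  show ?thesis
  proof (rule exI[of _ "compile main_prog"], rule exI[of _ time], rule exI[of _ space], intro allI impI conjI)
    fix I Opt
    assume "mpc_instance p c I \<and> (\<exists>S. feasible I S)" "optimal I Opt"
    \<comment> \<open>The output distribution is a point mass on a good set, so the probability is
      1.\<close>
    then show "1 - \<delta> \<le> measure_pmf.prob (output_after I (compile main_prog) (poly time (ground_size I)))
          {S. S \<in> indep_sets I \<and> objective I S \<ge> (1 - 1 / exp 1 - \<epsilon>) * objective I Opt \<and>
              satisfies_packing I S \<and> satisfies_covering (1 - \<epsilon>) I S}"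
      using compiled good[of I Opt] assms(2) by (simp add: measure_return_pmf indicator_def)
  qed (use compiled in auto)
qed

end
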